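(* Let $1<q<n$ and let $Q$ be an origin-symmetric star body in $\mathbb{R}^n$. Let $\mu$ be a finite even Borel measure on $\mathbb{S}^{n-1}$, with $\mu(\mathbb{S}^{n-1})>0$, satisfying $$\frac{\mu(\mathbb{S}^{n-1}\cap\xi_i)}{\mu(\mathbb{S}^{n-1})}<\min\left\{\frac{i}{q},1\right\}$$ for every $i\in\{1,\dots,n-1\}$ and every $i$-dimensional linear subspace $\xi_i\subset\mathbb{R}^n$. Then there exists an origin-symmetric convex body $K$ in $\mathbb{R}^n$ such that $\widetilde{C}_q(K,Q,\cdot)=\mu$.
   Context: $\mathbb{S}^{n-1}$ is the unit sphere of $\mathbb{R}^n$ and $du$ is the standard surface measure on it. A star body is a compact set $Q\subset\mathbb{R}^n$, star-shaped with respect to the origin (the segment joining any point of $Q$ to the origin lies in $Q$), whose radial function $\rho_Q(u)=\max\{\lambda:\lambda u\in Q\}$, $u\in\mathbb{S}^{n-1}$, is positive and continuous. A convex body is a compact convex set with non-empty interior; an origin-symmetric convex body contains the origin in its interior and is a star body. A measure on $\mathbb{S}^{n-1}$ is even if it takes the same value on antipodal measurable subsets $\eta$ and $-\eta$. For $q\in\mathbb{R}$, a star body $Q$, and a convex body $K$ containing the origin in its interior, the generalized $q$-th dual curvature measure is the Borel measure on $\mathbb{S}^{n-1}$ $$\widetilde{C}_q(K,Q,\eta)=\frac1n\int_{\boldsymbol{\alpha}_K^*(\eta)}\rho_K^q(u)\rho_Q^{n-q}(u)\,du,\qquad \eta\subset\mathbb{S}^{n-1}\text{ Borel},$$ where $\boldsymbol{\alpha}_K^*(\eta)=\{u\in\mathbb{S}^{n-1}:\rho_K(u)u\in\nu_K^{-1}(\eta)\}$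 and $\nu_K^{-1}(\eta)$ is the set of boundary points of $K$ having an outer unit normal vector belonging to $\eta$. *)

theory Defs
  imports "HOL-Analysis.Analysis"
begin

definition origin_symmetric :: "'a::real_vector set \<Rightarrow> bool" where
  "origin_symmetric A \<longleftrightarrow> uminus ` A = A"

definition convex_body :: "'a::euclidean_space set \<Rightarrow> bool" where
  "convex_body K \<longleftrightarrow> compact K \<and> convex K \<and> interior K \<noteq> {}"

definition radial :: "'a::euclidean_space set \<Rightarrow> 'a \<Rightarrow> real" where
  "radial Q u = (GREATEST l. l *\<^sub>R u \<in> Q)"

text \<open>Non-emptiness is part of the notion: otherwise the maximum defining the radial function
  does not exist.\<close>

definition star_body :: "'a::euclidean_space set \<Rightarrow> bool" where
  "star_body Q \<longleftrightarrow>
     compact Q \<and> Q \<noteq> {} \<and> (\<forall>x\<in>Q. closed_segment x 0 \<subseteq> Q) \<and>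
     (\<forall>u\<in>sphere 0 1. 0 < radial Q u) \<and> continuous_on (sphere 0 1) (radial Q)"

abbreviation sphere_borel :: "'a::euclidean_space measure" where
  "sphere_borel \<equiv> restrict_space borel (sphere 0 1)"

text \<open>The surface measure is the one given by polar coordinates: a Borel subset of the sphere has
  \<open>n\<close> times the volume of the cone over it. The origin is removed because it has no direction.\<close>

definition surface_measure :: "'a::euclidean_space measure" where
  "surface_measure =
     scale_measure (ennreal (real DIM('a)))
       (distr (restrict_space lborel (ball 0 1 - {0})) sphere_borel (\<lambda>x. x /\<^sub>R norm x))"

lemma measurable_direction:
  "(\<lambda>x::'a::euclidean_space. x /\<^sub>R norm x)
     \<in> restrict_space lborel (ball 0 1 - {0}) \<rightarrow>\<^sub>M sphere_borel"
  by (rule measurable_restrict_space2)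
     (auto intro!: measurable_restrict_space1 simp: space_restrict_space)

lemma sets_surface_measure [simp, measurable_cong]:
  "sets surface_measure = sets sphere_borel"
  by (simp add: surface_measure_def)

lemma space_surface_measure [simp]: "space surface_measure = sphere 0 1"
  by (simp add: surface_measure_def space_restrict_space space_scale_measure)

lemma emeasure_surface_measure:
  fixes A :: "'a::euclidean_space set"
  assumes "A \<in> sets sphere_borel"
  shows "emeasure surface_measure A =
    ennreal (real DIM('a)) * emeasure lborel {x. 0 < norm x \<and> norm x < 1 \<and> x /\<^sub>R norm x \<in> A}"
proof -
  have eq: "(\<lambda>x. x /\<^sub>R norm x) -` A \<inter> space (restrict_space lborel (ball 0 1 - {0}))
      = {x. 0 < norm x \<and> norm x < 1 \<and> x /\<^sub>R norm x \<in> A}"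
    by (auto simp: space_restrict_space)
  have "emeasure (distr (restrict_space lborel (ball 0 1 - {0})) sphere_borel
      (\<lambda>x. x /\<^sub>R norm x)) A
    = emeasure lborel {x. 0 < norm x \<and> norm x < 1 \<and> x /\<^sub>R norm x \<in> A}"
    unfolding emeasure_distr[OF measurable_direction assms] eq
    by (rule emeasure_restrict_space) auto
  thus ?thesis
    by (simp add: surface_measure_def)
qed

definition outer_unit_normal :: "'a::euclidean_space set \<Rightarrow> 'a \<Rightarrow> 'a \<Rightarrow> bool" where
  "outer_unit_normal K x v \<longleftrightarrow> norm v = 1 \<and> (\<forall>y\<in>K. v \<bullet> y \<le> v \<bullet> x)"

definition inverse_gauss_image :: "'a::euclidean_space set \<Rightarrow> 'a set \<Rightarrow> 'a set" where
  "inverse_gauss_image K \<eta> = {x \<in> frontier K. \<exists>v\<in>\<eta>. outer_unit_normal K x v}"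

definition reverse_radial_gauss_image :: "'a::euclidean_space set \<Rightarrow> 'a set \<Rightarrow> 'a set" where
  "reverse_radial_gauss_image K \<eta> =
     {u \<in> sphere 0 1. radial K u *\<^sub>R u \<in> inverse_gauss_image K \<eta>}"

text \<open>For Borel \<open>\<eta>\<close> the domain of integration is in general only measurable up to a null set,
  hence the completion.\<close>

definition dual_curvature ::
    "real \<Rightarrow> 'a::euclidean_space set \<Rightarrow> 'a set \<Rightarrow> 'a set \<Rightarrow> ennreal" where
  "dual_curvature q K Q \<eta> =
     ennreal (1 / real DIM('a)) *
     (\<integral>\<^sup>+u\<in>reverse_radial_gauss_image K \<eta>.
        ennreal (radial K u powr q * radial Q u powr (real DIM('a) - q)) \<partial>completion surface_measure)"

definition even_measure :: "'a::euclidean_space measure \<Rightarrow> bool" where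
  "even_measure \<mu> \<longleftrightarrow> (\<forall>\<eta>\<in>sets \<mu>. emeasure \<mu> (uminus ` \<eta>) = emeasure \<mu> \<eta>)"

end

theory Submission
  imports Defs "HOL-Complex_Analysis.Great_Picard"
begin

text \<open>A continuous positive even function \<open>p\<close> on the sphere determines the norm
  \<open>N(x) = max {p(v) (x \<bullet> v)}\<close> with unit ball \<open>K\<close>, whose radial function is \<open>1/N\<close>. The body sought is
  obtained by maximizing the scale invariant functional
  \<open>J(p) = (1/q) log V(p) + (1/|\<mu>|) \<integral> log p d\<mu>\<close> with \<open>V(p) = \<integral> N\<^sup>-\<^sup>q \<rho>\<^sub>Q\<^sup>n\<^sup>-\<^sup>q du\<close>. Replacing \<open>p\<close> by
  \<open>1/h\<^sub>K\<close> does not change \<open>N\<close> and does not decrease \<open>J\<close>.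

  Choosing successively longest vectors of projections of \<open>K\<close> gives an orthonormal frame \<open>e\<^sub>i\<close> and
  \<open>a\<^sub>0 \<ge> a\<^sub>1 \<ge> \<dots> > 0\<close> such that \<open>K\<close> lies in the box with half sides \<open>a\<^sub>i\<close> while \<open>h\<^sub>K(v)\<close> is at least a
  constant times \<open>max a\<^sub>i |v \<bullet> e\<^sub>i|\<close>. The first property bounds \<open>V\<close> by a constant times
  \<open>\<Prod> a\<^sub>i\<^sup>s\<^sup>i\<close> for any exponents in \<open>(0, 1)\<close> with sum \<open>q\<close>; the second and the subspace mass inequality,
  made uniform by compactness, bound \<open>\<integral> log h\<^sub>K d\<mu>\<close> from below. With suitable exponents,
  \<open>J(1/h\<^sub>K) \<le> C - \<epsilon> log (a\<^sub>0/a\<^sub>n\<^sub>-\<^sub>1)\<close>, so maximizing sequences do not degenerate and the theorem of Arzela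
  and Ascoli yields a maximizer.

  At almost every \<open>u\<close> the maximum defining \<open>N(u)\<close> is attained at a single \<open>v\<close>, which is the outer unit
  normal of \<open>K\<close> at \<open>\<rho>\<^sub>K(u) u\<close>. Varying the maximizer along \<open>p exp(-t g)\<close> therefore shows that the dual
  curvature measure and \<open>\<mu>\<close> have proportional integrals of every even continuous \<open>g\<close>.\<close>

section \<open>Orthonormal frames and rotation invariance\<close>

text \<open>Two difficulties shape the argument. A perturbed support function need not be a support
  function, so the functional lives on all positive even \<open>p\<close>, a class preserved by
  \<open>p exp(-t g)\<close>; the body is then the Wulff shape of \<open>1/p\<close>, and passing to
  \<open>1/h\<close> shows that maximizing over this larger class is the same as maximizing over
  bodies, with Lipschitz bounds as a bonus. Secondly, the size of elongated bodies must be weighed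
  against mass near subspaces. With exponents s_i the estimate of V pairs ln (a_i / a_(i+1)) with
  the sum of the last n-i-1 exponents, while the integral of log h pairs it with the mass near the
  orthogonal complement of the first i+1 frame vectors, a subspace of dimension n-i-1. Integrability
  of |y|^(-s) at 0 forces every exponent below 1 and homogeneity fixes their sum to be q, so these
  tail sums can come arbitrarily close to min(n-i-1, q); divided by q this is the threshold in the
  hypothesis on \<mu>. Finally only even g arise as variations, which suffices because both measures
  are even.\<close>

text \<open>Uniqueness of Haar measure, in the case of a rotated copy of Lebesgue measure: integrating
  \<open>f x * g y\<close> with \<open>f\<close> the indicator of a ball, and translating first \<open>y\<close> and then \<open>x\<close>,
  interchanges the roles of the two measures.\<close>

lemma lborel_distr_orthogonal_transformation:
  fixes T :: "'a::euclidean_space \<Rightarrow> 'a"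
  assumes T: "orthogonal_transformation T"
  shows "distr lborel borel T = lborel"
proof -
  have lin: "linear T" and nrm: "\<And>x. norm (T x) = norm x"
    using T by (auto simp: orthogonal_transformation)
  have meas[measurable]: "T \<in> borel_measurable borel"
    using lin by (intro borel_measurable_continuous_onI linear_continuous_on)
       (simp add: linear_conv_bounded_linear)
  let ?N = "distr lborel borel T"
  let ?B = "cball 0 1 :: 'a set"
  obtain T' where T': "\<And>x. T (T' x) = x"
    using orthogonal_transformation_surj[OF T] by (metis surj_f_inv_f)
  have trans: "(\<integral>\<^sup>+y. h (y + a) \<partial>?N) = (\<integral>\<^sup>+y. h y \<partial>?N)"
    if [measurable]: "h \<in> borel_measurable borel" for h :: "'a \<Rightarrow> ennreal" and a
  proof -
    have "(\<integral>\<^sup>+y. h (y + a) \<partial>?N) = (\<integral>\<^sup>+y. h (T (T' a + y)) \<partial>lborel)"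
      by (simp add: nn_integral_distr linear_add[OF lin] T' add.commute)
    also have "\<dots> = (\<integral>\<^sup>+y. h (T y) \<partial>distr lborel borel ((+) (T' a)))"
      by (simp add: nn_integral_distr)
    also have "\<dots> = (\<integral>\<^sup>+y. h y \<partial>?N)"
      by (simp add: lborel_distr_plus nn_integral_distr)
    finally show ?thesis .
  qed
  have trans0: "(\<integral>\<^sup>+x. h (x + a) \<partial>lborel) = (\<integral>\<^sup>+x. h x \<partial>lborel)"
    if [measurable]: "h \<in> borel_measurable borel" for h :: "'a \<Rightarrow> ennreal" and a
  proof -
    have "(\<integral>\<^sup>+x. h (x + a) \<partial>lborel) = (\<integral>\<^sup>+x. h x \<partial>distr lborel borel ((+) a))"
      by (simp add: nn_integral_distr add.commute)
    thus ?thesis by (simp add: lborel_distr_plus)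
  qed
  have NB: "emeasure ?N ?B = emeasure lborel ?B"
  proof -
    have "T -` ?B = ?B" by (auto simp: nrm)
    thus ?thesis by (simp add: emeasure_distr)
  qed
  have finB: "emeasure lborel ?B \<noteq> \<infinity>" "emeasure lborel ?B \<noteq> 0"
  proof -
    show "emeasure lborel ?B \<noteq> \<infinity>" using emeasure_lborel_cball_finite by (metis infinity_ennreal_def less_irrefl)
    have "0 < measure lborel ?B" using content_cball_pos[of 1 "0::'a"] by simp
    thus "emeasure lborel ?B \<noteq> 0" by (auto simp: measure_def)
  qed
  \<comment> \<open>Interchanging the integrals requires sigma-finiteness; centred balls are
    invariant under \<open>T\<close>, so they keep their finite mass.\<close>
  interpret N: sigma_finite_measure ?N
  proof
    show "\<exists>A. countable A \<and> A \<subseteq> sets ?N \<and> \<Union> A = space ?N \<and> (\<forall>a\<in>A. emeasure ?N a \<noteq> \<infinity>)"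
    proof (intro exI[of _ "range (\<lambda>n::nat. cball 0 (real n))"] conjI ballI)
      show "\<Union> (range (\<lambda>n::nat. cball (0::'a) (real n))) = space ?N"
        using real_arch_simple by (fastforce simp: mem_cball_0)
      fix a assume "a \<in> range (\<lambda>n::nat. cball (0::'a) (real n))"
      then obtain n where n: "a = cball 0 (real n)" by auto
      have "T -` a = a" unfolding n by (auto simp: nrm)
      thus "emeasure ?N a \<noteq> \<infinity>" using n emeasure_lborel_cball_finite[of 0 "real n"]
        by (simp add: emeasure_distr less_top)
    qed auto
  qed
  interpret P: pair_sigma_finite lborel ?N ..
  show ?thesis
  proof (rule measure_eqI)
    fix A :: "'a set" assume "A \<in> sets ?N"
    hence [measurable]: "A \<in> sets borel" by simp
    define f g :: "'a \<Rightarrow> ennreal" where "f = indicator ?B" and "g = indicator A"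
    have [measurable]: "f \<in> borel_measurable borel" "g \<in> borel_measurable borel"
      by (auto simp: f_def g_def intro!: borel_measurable_indicator)
    have fg: "(\<lambda>(x, y). f x * g (y + x)) \<in> borel_measurable (lborel \<Otimes>\<^sub>M ?N)"
      "(\<lambda>(x, y). f (x + (- y)) * g x) \<in> borel_measurable (lborel \<Otimes>\<^sub>M ?N)"
      by (simp_all cong: measurable_cong_sets add: sets_pair_measure_cong[of lborel borel ?N borel])
    have "emeasure lborel ?B * emeasure ?N A = (\<integral>\<^sup>+x. f x \<partial>lborel) * (\<integral>\<^sup>+y. g y \<partial>?N)"
      by (simp add: f_def g_def)
    also have "\<dots> = (\<integral>\<^sup>+x. f x * (\<integral>\<^sup>+y. g (y + x) \<partial>?N) \<partial>lborel)"
      by (simp add: trans nn_integral_multc)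
    also have "\<dots> = (\<integral>\<^sup>+x. \<integral>\<^sup>+y. f x * g (y + x) \<partial>?N \<partial>lborel)"
      by (simp add: nn_integral_cmult)
    also have "\<dots> = (\<integral>\<^sup>+y. \<integral>\<^sup>+x. f x * g (y + x) \<partial>lborel \<partial>?N)"
      by (rule P.Fubini'[OF fg(1), symmetric])
    also have "\<dots> = (\<integral>\<^sup>+y. \<integral>\<^sup>+x. f (x + (- y)) * g x \<partial>lborel \<partial>?N)"
    proof (rule nn_integral_cong)
      fix y :: 'a
      show "(\<integral>\<^sup>+x. f x * g (y + x) \<partial>lborel) = (\<integral>\<^sup>+x. f (x + (- y)) * g x \<partial>lborel)"
        using trans0[of "\<lambda>x. f (x + (- y)) * g x" y] by (simp add: add.commute)
    qed
    also have "\<dots> = (\<integral>\<^sup>+x. \<integral>\<^sup>+y. f (x + (- y)) * g x \<partial>?N \<partial>lborel)"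
      by (rule P.Fubini'[OF fg(2)])
    also have "\<dots> = (\<integral>\<^sup>+x. (\<integral>\<^sup>+y. f (y + (- x)) \<partial>?N) * g x \<partial>lborel)"
    proof (rule nn_integral_cong)
      fix x :: 'a
      \<comment> \<open>The ball is symmetric about the origin; after this reflection the inner
        integral is again one over a translate in \<open>y\<close>.\<close>
      have "f (x + (- y)) = f (y + (- x))" for y
        by (simp add: f_def indicator_def norm_minus_commute)
      thus "(\<integral>\<^sup>+y. f (x + (- y)) * g x \<partial>?N) = (\<integral>\<^sup>+y. f (y + (- x)) \<partial>?N) * g x"
        by (simp add: nn_integral_multc)
    qed
    also have "\<dots> = (\<integral>\<^sup>+y. f y \<partial>?N) * (\<integral>\<^sup>+x. g x \<partial>lborel)"
      by (subst trans) (simp_all add: nn_integral_cmult)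
    also have "\<dots> = emeasure ?N ?B * emeasure lborel A"
      by (simp add: f_def g_def)
    also have "\<dots> = emeasure lborel ?B * emeasure lborel A" by (simp only: NB)
    finally show "emeasure ?N A = emeasure lborel A"
      using finB by (simp add: ennreal_mult_cancel_left)
  qed simp
qed

lemma nn_integral_lborel_orthogonal_transformation:
  fixes T :: "'a::euclidean_space \<Rightarrow> 'a"
  assumes "orthogonal_transformation T" and [measurable]: "f \<in> borel_measurable borel"
  shows "(\<integral>\<^sup>+x. f (T x) \<partial>lborel) = (\<integral>\<^sup>+x. f x \<partial>lborel)"
proof -
  have [measurable]: "T \<in> borel_measurable borel"
    using orthogonal_transformation_linear[OF assms(1)]
    by (intro borel_measurable_continuous_onI linear_continuous_on)
       (simp add: linear_conv_bounded_linear)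
  have "(\<integral>\<^sup>+x. f (T x) \<partial>lborel) = (\<integral>\<^sup>+x. f x \<partial>distr lborel borel T)"
    by (simp add: nn_integral_distr)
  thus ?thesis by (simp add: lborel_distr_orthogonal_transformation[OF assms(1)])
qed

text \<open>Vectors with index \<open>m\<close> or more are unconstrained, so partial frames can be
  extended by function update. The order of the indices will carry information: the half sides of
  the adapted box decrease along it.\<close>

definition orthonormal_frame :: "nat \<Rightarrow> (nat \<Rightarrow> 'a::euclidean_space) \<Rightarrow> bool" where
  "orthonormal_frame m e \<longleftrightarrow> (\<forall>i<m. \<forall>j<m. e i \<bullet> e j = (if i = j then 1 else 0))"

lemma orthonormal_frame_inj: "orthonormal_frame m e \<Longrightarrow> inj_on e {..<m}"
  by (auto simp: orthonormal_frame_def inj_on_def) (metis zero_neq_one)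

lemma orthonormal_frame_norm: "orthonormal_frame m e \<Longrightarrow> i < m \<Longrightarrow> norm (e i) = 1"
  by (simp add: orthonormal_frame_def norm_eq_1)

lemma orthonormal_frame_independent:
  fixes e :: "nat \<Rightarrow> 'a::euclidean_space"
  assumes "orthonormal_frame m e" shows "independent (e ` {..<m})"
proof (rule pairwise_orthogonal_independent)
  show "pairwise orthogonal (e ` {..<m})"
    using assms by (force simp: pairwise_def orthogonal_def orthonormal_frame_def)
  show "0 \<notin> e ` {..<m}" using assms orthonormal_frame_norm by force
qed

lemma dim_orthonormal_frame:
  fixes e :: "nat \<Rightarrow> 'a::euclidean_space"
  assumes "orthonormal_frame m e" shows "dim (e ` {..<m}) = m"
  using dim_eq_card_independent[OF orthonormal_frame_independent[OF assms]]
  by (simp add: card_image[OF orthonormal_frame_inj[OF assms]])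

lemma span_orthonormal_frame:
  fixes e :: "nat \<Rightarrow> 'a::euclidean_space"
  assumes "orthonormal_frame DIM('a) e" shows "span (e ` {..<DIM('a)}) = UNIV"
  using dim_orthonormal_frame[OF assms] dim_eq_full by blast

lemma orthonormal_frame_expansion:
  fixes e :: "nat \<Rightarrow> 'a::euclidean_space"
  assumes e: "orthonormal_frame DIM('a) e"
  shows "(\<Sum>i<DIM('a). (x \<bullet> e i) *\<^sub>R e i) = x"
proof -
  define y where "y = x - (\<Sum>i<DIM('a). (x \<bullet> e i) *\<^sub>R e i)"
  have "y \<bullet> e j = 0" if "j < DIM('a)" for j
  proof -
    have "(\<Sum>i<DIM('a). (x \<bullet> e i) * (e i \<bullet> e j)) = (\<Sum>i<DIM('a). if i = j then x \<bullet> e j else 0)"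
      using e that by (intro sum.cong) (auto simp: orthonormal_frame_def)
    thus ?thesis using that by (simp add: y_def inner_diff_left inner_sum_left)
  qed
  hence "orthogonal y z" if "z \<in> span (e ` {..<DIM('a)})" for z
    using that by (intro orthogonal_to_span[OF that]) (auto simp: orthogonal_def)
  hence "orthogonal y y" using span_orthonormal_frame[OF e] by auto
  thus ?thesis by (simp add: y_def orthogonal_self)
qed

lemma orthonormal_frame_norm_le:
  fixes e :: "nat \<Rightarrow> 'a::euclidean_space"
  assumes e: "orthonormal_frame DIM('a) e"
  shows "norm x \<le> (\<Sum>i<DIM('a). \<bar>x \<bullet> e i\<bar>)"
proof -
  have "norm x = norm (\<Sum>i<DIM('a). (x \<bullet> e i) *\<^sub>R e i)"
    by (simp add: orthonormal_frame_expansion[OF e])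
  also have "\<dots> \<le> (\<Sum>i<DIM('a). norm ((x \<bullet> e i) *\<^sub>R e i))" by (rule norm_sum)
  also have "\<dots> = (\<Sum>i<DIM('a). \<bar>x \<bullet> e i\<bar>)"
    by (intro sum.cong) (auto simp: orthonormal_frame_norm[OF e])
  finally show ?thesis .
qed

lemma orthonormal_frame_large_coordinate:
  fixes e :: "nat \<Rightarrow> 'a::euclidean_space"
  assumes e: "orthonormal_frame DIM('a) e" and "norm x = 1"
  shows "\<exists>i<DIM('a). 1 / DIM('a) \<le> \<bar>x \<bullet> e i\<bar>"
proof (rule ccontr)
  assume "\<not> ?thesis"
  hence "\<bar>x \<bullet> e i\<bar> < 1 / DIM('a)" if "i < DIM('a)" for i
    using that by (meson not_le_imp_less)
  hence "(\<Sum>i<DIM('a). \<bar>x \<bullet> e i\<bar>) < (\<Sum>i<DIM('a). 1 / DIM('a))"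
    by (intro sum_strict_mono) (auto simp: lessThan_empty_iff)
  thus False using orthonormal_frame_norm_le[OF e, of x] assms by simp
qed

text \<open>The rotation \<open>T\<close> carrying the standard basis to the frame turns frame
  coordinates into standard ones, in which Lebesgue measure is a product.\<close>

lemma nn_integral_orthonormal_frame_prod:
  fixes e :: "nat \<Rightarrow> 'a::euclidean_space" and f :: "nat \<Rightarrow> real \<Rightarrow> ennreal"
  assumes e: "orthonormal_frame DIM('a) e"
    and [measurable]: "\<And>i. f i \<in> borel_measurable borel"
  shows "(\<integral>\<^sup>+x. (\<Prod>i<DIM('a). f i (x \<bullet> e i)) \<partial>(lborel :: 'a measure)) =
         (\<Prod>i<DIM('a). \<integral>\<^sup>+y. f i y \<partial>lborel)"
proof -
  obtain k where k: "bij_betw k (Basis :: 'a set) {..<DIM('a)}"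
    using ex_bij_betw_finite_nat[OF finite_Basis] by (auto simp: lessThan_atLeast0)
  define T where "T x = (\<Sum>b\<in>Basis. (x \<bullet> b) *\<^sub>R e (k b))" for x :: 'a
  have kb: "k b < DIM('a)" if "b \<in> Basis" for b using bij_betw_apply[OF k that] by simp
  have ip: "T x \<bullet> e (k b) = x \<bullet> b" if "b \<in> Basis" for x b
  proof -
    have "e (k c) \<bullet> e (k b) = (if c = b then 1 else 0)" if "c \<in> Basis" for c
      using e kb that \<open>b \<in> Basis\<close> inj_on_eq_iff[OF bij_betw_imp_inj_on[OF k], of c b]
      by (auto simp: orthonormal_frame_def)
    hence "T x \<bullet> e (k b) = (\<Sum>c\<in>Basis. if c = b then x \<bullet> b else 0)"
      unfolding T_def inner_sum_left by (intro sum.cong) auto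
    thus ?thesis using that by simp
  qed
  have ot: "orthogonal_transformation T"
    unfolding orthogonal_transformation_def
  proof
    show "linear T" unfolding T_def
      by (intro linearI) (simp_all add: inner_simps scaleR_add_left sum.distrib scaleR_sum_right)
    show "\<forall>v w. T v \<bullet> T w = v \<bullet> w"
    proof (intro allI)
      fix v w
      have "T v \<bullet> T w = (\<Sum>b\<in>Basis. (w \<bullet> b) * (T v \<bullet> e (k b)))"
        by (simp add: T_def[of w] inner_sum_right)
      also have "\<dots> = (\<Sum>b\<in>Basis. (w \<bullet> b) * (v \<bullet> b))" by (intro sum.cong) (auto simp: ip)
      also have "\<dots> = v \<bullet> w" by (subst euclidean_inner) (simp add: mult.commute)
      finally show "T v \<bullet> T w = v \<bullet> w" .
    qed
  qed
  have "(\<integral>\<^sup>+x. (\<Prod>i<DIM('a). f i (x \<bullet> e i)) \<partial>(lborel :: 'a measure))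
      = (\<integral>\<^sup>+x. (\<Prod>i<DIM('a). f i (T x \<bullet> e i)) \<partial>(lborel :: 'a measure))"
    by (rule nn_integral_lborel_orthogonal_transformation[OF ot, symmetric]) measurable
  also have "\<dots> = (\<integral>\<^sup>+x. (\<Prod>b\<in>Basis. f (k b) (x \<bullet> b)) \<partial>(lborel :: 'a measure))"
    by (intro nn_integral_cong) (simp add: prod.reindex_bij_betw[OF k, symmetric] ip)
  also have "\<dots> = (\<Prod>b\<in>(Basis::'a set). \<integral>\<^sup>+y. f (k b) y \<partial>lborel)"
    by (rule nn_integral_lborel_prod) auto
  also have "\<dots> = (\<Prod>i<DIM('a). \<integral>\<^sup>+y. f i y \<partial>lborel)"
    by (rule prod.reindex_bij_betw[OF k])
  finally show ?thesis .
qed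

section \<open>Symmetric bodies and their gauges\<close>

definition admissible :: "('a::euclidean_space \<Rightarrow> real) \<Rightarrow> bool" where
  "admissible p \<longleftrightarrow> continuous_on (sphere 0 1) p \<and> (\<forall>v\<in>sphere 0 1. 0 < p v \<and> p (- v) = p v)"

text \<open>This is the support function of the set of all points \<open>p v *\<^sub>R v\<close>.
  Its unit ball is the polar of that set, or equivalently the Wulff shape of
  \<open>1 / p\<close>.\<close>

definition gauge_of :: "('a::euclidean_space \<Rightarrow> real) \<Rightarrow> 'a \<Rightarrow> real" where
  "gauge_of p x = (SUP v\<in>sphere 0 1. p v * (x \<bullet> v))"

definition body_of :: "('a::euclidean_space \<Rightarrow> real) \<Rightarrow> 'a set" where
  "body_of p = {x. gauge_of p x \<le> 1}"

lemma sphere_ne: "sphere (0::'a::euclidean_space) 1 \<noteq> {}"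
  using vector_choose_size[of 1] by (metis empty_iff mem_sphere_0 zero_le_one)

lemma admissible_bounds:
  fixes p :: "'a::euclidean_space \<Rightarrow> real"
  assumes "admissible p"
  obtains c C where "0 < c" "c \<le> C" "\<And>v. norm v = 1 \<Longrightarrow> c \<le> p v \<and> p v \<le> C"
proof -
  have con: "continuous_on (sphere 0 1) p" and pos: "\<And>v. norm v = 1 \<Longrightarrow> 0 < p v"
    using assms by (auto simp: admissible_def)
  obtain x where x: "x \<in> sphere 0 1" "\<forall>y\<in>sphere 0 1. p x \<le> p y"
    using continuous_attains_inf[OF compact_sphere sphere_ne con] by blast
  obtain z where z: "z \<in> sphere 0 1" "\<forall>y\<in>sphere 0 1. p y \<le> p z"
    using continuous_attains_sup[OF compact_sphere sphere_ne con] by blast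
  show ?thesis using x z pos by (intro that[of "p x" "p z"]) auto
qed

lemma continuous_on_gauge_term:
  "admissible p \<Longrightarrow> continuous_on (sphere 0 1) (\<lambda>v. p v * (x \<bullet> v))"
  by (auto simp: admissible_def intro!: continuous_intros)

lemma gauge_of_attained:
  assumes "admissible p"
  obtains v where "norm v = 1" "gauge_of p x = p v * (x \<bullet> v)"
proof -
  obtain z where z: "z \<in> sphere 0 1" "\<forall>y\<in>sphere 0 1. p y * (x \<bullet> y) \<le> p z * (x \<bullet> z)"
    using continuous_attains_sup[OF compact_sphere sphere_ne continuous_on_gauge_term[OF assms]] by blast
  have "gauge_of p x = p z * (x \<bullet> z)"
    unfolding gauge_of_def using z by (intro cSup_eq_maximum) auto
  thus ?thesis using z that by auto
qed

lemma gauge_of_ge: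
  assumes "admissible p" "norm v = 1"
  shows "p v * (x \<bullet> v) \<le> gauge_of p x"
  unfolding gauge_of_def
proof (rule cSUP_upper)
  show "bdd_above ((\<lambda>v. p v * (x \<bullet> v)) ` sphere 0 1)"
    using compact_continuous_image[OF continuous_on_gauge_term[OF assms(1)] compact_sphere]
    by (simp add: compact_imp_bounded bounded_imp_bdd_above)
qed (use assms in auto)

lemma gauge_of_le:
  assumes "\<And>v. norm v = 1 \<Longrightarrow> p v * (x \<bullet> v) \<le> B"
  shows "gauge_of p x \<le> B"
  unfolding gauge_of_def by (rule cSUP_least[OF sphere_ne]) (use assms in auto)

lemma gauge_of_triangle:
  assumes "admissible p"
  shows "gauge_of p (x + y) \<le> gauge_of p x + gauge_of p y"
  by (rule gauge_of_le)
    (use add_mono[OF gauge_of_ge[OF assms] gauge_of_ge[OF assms]] in \<open>simp add: inner_add_left distrib_left\<close>)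

lemma gauge_of_scaleR:
  assumes "0 \<le> t" "admissible p"
  shows "gauge_of p (t *\<^sub>R x) = t * gauge_of p x"
proof (rule antisym)
  show "gauge_of p (t *\<^sub>R x) \<le> t * gauge_of p x"
  proof (rule gauge_of_le)
    fix v :: 'a assume "norm v = 1"
    from mult_left_mono[OF gauge_of_ge[OF assms(2) this, of x] assms(1)]
    show "p v * (t *\<^sub>R x \<bullet> v) \<le> t * gauge_of p x" by (simp add: algebra_simps)
  qed
  obtain v where v: "norm v = 1" "gauge_of p x = p v * (x \<bullet> v)" using gauge_of_attained[OF assms(2)] .
  show "t * gauge_of p x \<le> gauge_of p (t *\<^sub>R x)"
    using gauge_of_ge[OF assms(2) v(1), of "t *\<^sub>R x"] v(2) by (simp add: algebra_simps)
qed

lemma gauge_of_0 [simp]: "gauge_of p 0 = 0"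
  using sphere_ne by (simp add: gauge_of_def)

lemma gauge_of_minus:
  assumes "admissible p"
  shows "gauge_of p (- x) = gauge_of p x"
proof -
  have le: "gauge_of p (- x) \<le> gauge_of p x" for x
  proof (rule gauge_of_le)
    fix v :: 'a assume v: "norm v = 1"
    with gauge_of_ge[OF assms, of "- v" x] assms show "p v * (- x \<bullet> v) \<le> gauge_of p x"
      by (simp add: admissible_def)
  qed
  from le[of x] le[of "- x"] show ?thesis by simp
qed

lemma gauge_of_lower:
  assumes "admissible p" "\<And>v. norm v = 1 \<Longrightarrow> c \<le> p v"
  shows "c * norm x \<le> gauge_of p x"
proof (cases "x = 0")
  case False
  define v where "v = x /\<^sub>R norm x"
  have v: "norm v = 1" "x \<bullet> v = norm x"
    using False by (auto simp: v_def dot_square_norm power2_eq_square)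
  have "c * norm x \<le> p v * norm x" using assms(2)[OF v(1)] by (intro mult_right_mono) auto
  also have "\<dots> \<le> gauge_of p x" using gauge_of_ge[OF assms(1) v(1), of x] v(2) by simp
  finally show ?thesis .
qed simp

lemma gauge_of_upper:
  assumes "admissible p" "\<And>v. norm v = 1 \<Longrightarrow> p v \<le> C"
  shows "gauge_of p x \<le> C * norm x"
proof (rule gauge_of_le)
  fix v :: 'a assume v: "norm v = 1"
  have p: "0 < p v" using assms v by (auto simp: admissible_def)
  have "p v * (x \<bullet> v) \<le> p v * norm x"
    using p norm_cauchy_schwarz[of x v] v by (intro mult_left_mono) auto
  also have "\<dots> \<le> C * norm x" using assms(2)[OF v] by (intro mult_right_mono) auto
  finally show "p v * (x \<bullet> v) \<le> C * norm x" .
qed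

lemma gauge_of_pos: "admissible p \<Longrightarrow> x \<noteq> 0 \<Longrightarrow> 0 < gauge_of p x"
proof -
  assume a: "admissible p" "x \<noteq> 0"
  obtain c C where "0 < c" "c \<le> C" "\<And>v. norm v = 1 \<Longrightarrow> c \<le> p v \<and> p v \<le> C"
    using admissible_bounds[OF a(1)] by blast
  with gauge_of_lower[OF a(1), of c x] a(2) show ?thesis
    by (smt (verit) mult_pos_pos zero_less_norm_iff)
qed

lemma gauge_of_nonneg: "admissible p \<Longrightarrow> 0 \<le> gauge_of p x"
  by (cases "x = 0") (auto dest: gauge_of_pos intro: less_imp_le)

lemma continuous_on_gauge_of:
  assumes "admissible p"
  shows "continuous_on A (gauge_of p)"
proof -
  obtain c C where C: "0 < c" "c \<le> C" "\<And>v. norm v = 1 \<Longrightarrow> c \<le> p v \<and> p v \<le> C"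
    using admissible_bounds[OF assms] by blast
  have 1: "gauge_of p x - gauge_of p y \<le> C * dist x y" for x y
    using gauge_of_triangle[OF assms, of "x - y" y] gauge_of_upper[OF assms, of C "x - y"] C
    by (auto simp: dist_norm)
  have "C-lipschitz_on A (gauge_of p)"
    using C 1 by (intro lipschitz_onI) (auto simp: dist_real_def abs_le_iff intro: order_trans[OF 1] simp: dist_commute)
  thus ?thesis by (rule lipschitz_on_continuous_on)
qed

lemma gauge_of_mono:
  assumes "admissible p" "admissible p'" "\<And>v. norm v = 1 \<Longrightarrow> p v \<le> p' v"
  shows "gauge_of p x \<le> gauge_of p' x"
proof -
  obtain v where v: "norm v = 1" "gauge_of p x = p v * (x \<bullet> v)" using gauge_of_attained[OF assms(1)] .
  have "0 \<le> p v * (x \<bullet> v)" using gauge_of_nonneg[OF assms(1), of x] v by simp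
  moreover have "0 < p v" using assms(1) v by (auto simp: admissible_def)
  ultimately have "0 \<le> x \<bullet> v" by (simp add: zero_le_mult_iff)
  hence "p v * (x \<bullet> v) \<le> p' v * (x \<bullet> v)" using assms(3)[OF v(1)] by (intro mult_right_mono)
  also have "\<dots> \<le> gauge_of p' x" by (rule gauge_of_ge[OF assms(2) v(1)])
  finally show ?thesis using v by simp
qed

lemma admissible_scale: "admissible p \<Longrightarrow> 0 < k \<Longrightarrow> admissible (\<lambda>v. k * p v)"
  by (auto simp: admissible_def intro!: continuous_intros)

lemma gauge_of_scale:
  assumes "admissible p" "0 < k"
  shows "gauge_of (\<lambda>v. k * p v) x = k * gauge_of p x"
proof -
  note a = admissible_scale[OF assms]
  obtain v where v: "norm v = 1" "gauge_of p x = p v * (x \<bullet> v)" using gauge_of_attained[OF assms(1)] .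
  obtain v' where v': "norm v' = 1" "gauge_of (\<lambda>v. k * p v) x = k * p v' * (x \<bullet> v')"
    using gauge_of_attained[OF a] .
  have "k * gauge_of p x \<le> gauge_of (\<lambda>v. k * p v) x"
    using gauge_of_ge[OF a v(1), of x] v by (simp add: algebra_simps)
  moreover have "gauge_of (\<lambda>v. k * p v) x \<le> k * gauge_of p x"
    using mult_left_mono[OF gauge_of_ge[OF assms(1) v'(1), of x], of k] v' assms(2)
    by (simp add: algebra_simps)
  ultimately show ?thesis by simp
qed

lemma compact_body_of:
  assumes "admissible p" shows "compact (body_of p)"
proof -
  obtain c C where C: "0 < c" "c \<le> C" "\<And>v. norm v = 1 \<Longrightarrow> c \<le> p v \<and> p v \<le> C"
    using admissible_bounds[OF assms] by blast
  have "closed (body_of p)" unfolding body_of_def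
    by (intro closed_Collect_le continuous_on_gauge_of assms continuous_intros)
  moreover have "body_of p \<subseteq> cball 0 (1 / c)"
  proof
    fix x assume "x \<in> body_of p"
    hence "c * norm x \<le> 1" using gauge_of_lower[OF assms, of c x] C by (auto simp: body_of_def)
    thus "x \<in> cball 0 (1 / c)" using C by (simp add: field_simps)
  qed
  ultimately show ?thesis
    by (meson bounded_cball bounded_subset compact_eq_bounded_closed)
qed

lemma body_of_contains_ball:
  assumes "admissible p" obtains r where "0 < r" "cball 0 r \<subseteq> body_of p"
proof -
  obtain c C where C: "0 < c" "c \<le> C" "\<And>v. norm v = 1 \<Longrightarrow> c \<le> p v \<and> p v \<le> C"
    using admissible_bounds[OF assms] by blast
  show ?thesis
  proof (rule that[of "1 / C"])
    show "cball 0 (1 / C) \<subseteq> body_of p"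
    proof
      fix x :: 'a assume "x \<in> cball 0 (1 / C)"
      hence "C * norm x \<le> 1" using C by (simp add: field_simps)
      thus "x \<in> body_of p" using gauge_of_upper[OF assms, of C x] C by (auto simp: body_of_def)
    qed
  qed (use C in auto)
qed

lemma convex_body_body_of:
  assumes "admissible p" shows "convex_body (body_of p)"
proof -
  have "convex (body_of p)"
  proof (rule convexI)
    fix x y :: 'a and s t :: real
    assume *: "x \<in> body_of p" "y \<in> body_of p" "0 \<le> s" "0 \<le> t" "s + t = 1"
    have "gauge_of p (s *\<^sub>R x + t *\<^sub>R y) \<le> s * gauge_of p x + t * gauge_of p y"
      using gauge_of_triangle[OF assms, of "s *\<^sub>R x" "t *\<^sub>R y"] * assms by (simp add: gauge_of_scaleR)
    also have "\<dots> \<le> s * 1 + t * 1" using * by (intro add_mono mult_left_mono) (auto simp: body_of_def)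
    finally show "s *\<^sub>R x + t *\<^sub>R y \<in> body_of p" using * by (simp add: body_of_def)
  qed
  moreover obtain r where "0 < r" "cball 0 r \<subseteq> body_of p" using body_of_contains_ball[OF assms] .
  hence "interior (body_of p) \<noteq> {}" 
    by (metis ball_subset_cball centre_in_ball empty_iff interior_maximal open_ball subset_iff subset_trans)
  ultimately show ?thesis using compact_body_of[OF assms] by (simp add: convex_body_def)
qed

lemma origin_symmetric_body_of:
  assumes "admissible p" shows "origin_symmetric (body_of p)"
  using assms unfolding origin_symmetric_def body_of_def
  by (auto simp: gauge_of_minus image_iff) (metis gauge_of_minus minus_minus)

lemma radial_body_of:
  assumes "admissible p" "norm u = 1"
  shows "radial (body_of p) u = 1 / gauge_of p u"
proof -
  have pos: "0 < gauge_of p u" using gauge_of_pos[OF assms(1), of u] assms(2) by force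
  show ?thesis unfolding radial_def
  proof (rule Greatest_equality)
    show "(1 / gauge_of p u) *\<^sub>R u \<in> body_of p"
      using pos assms by (simp add: body_of_def gauge_of_scaleR)
    fix l assume l: "l *\<^sub>R u \<in> body_of p"
    show "l \<le> 1 / gauge_of p u"
    proof (cases "0 \<le> l")
      case True
      with l have "l * gauge_of p u \<le> 1" using assms by (simp add: body_of_def gauge_of_scaleR)
      with pos show ?thesis by (simp add: field_simps)
    next
      case False
      then show ?thesis using pos by (smt (verit) divide_pos_pos)
    qed
  qed
qed

lemma frontier_body_of:
  assumes "admissible p" "gauge_of p x = 1"
  shows "x \<in> frontier (body_of p)"
proof -
  have "x \<in> body_of p" using assms by (simp add: body_of_def)
  moreover have "x \<notin> interior (body_of p)"
  proof
    assume "x \<in> interior (body_of p)"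
    then obtain e where e: "0 < e" "ball x e \<subseteq> body_of p" by (meson mem_interior)
    have x0: "x \<noteq> 0" using assms by auto
    define t where "t = e / (2 * norm x)"
    have t: "t > 0" using e x0 by (simp add: t_def)
    have "dist x ((1 + t) *\<^sub>R x) = t * norm x"
      using t by (simp add: dist_norm algebra_simps)
    also have "\<dots> < e" using e x0 by (simp add: t_def)
    finally have "(1 + t) *\<^sub>R x \<in> body_of p" using e by auto
    hence "(1 + t) * gauge_of p x \<le> 1" using assms t by (simp add: body_of_def gauge_of_scaleR)
    thus False using assms t by simp
  qed
  ultimately show ?thesis by (auto simp: frontier_def intro: closure_subset[THEN subsetD])
qed

section \<open>Support functions of the bodies\<close>

definition support_of :: "('a::euclidean_space \<Rightarrow> real) \<Rightarrow> 'a \<Rightarrow> real" where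
  "support_of p v = (SUP x\<in>body_of p. x \<bullet> v)"

lemma support_of_ge:
  assumes "admissible p" "x \<in> body_of p" shows "x \<bullet> v \<le> support_of p v"
  unfolding support_of_def
proof (rule cSUP_upper[OF assms(2)])
  show "bdd_above ((\<lambda>x. x \<bullet> v) ` body_of p)"
    by (intro bounded_imp_bdd_above compact_imp_bounded compact_continuous_image
        compact_body_of assms continuous_intros)
qed

lemma zero_in_body_of: "0 \<in> body_of p"
  by (simp add: body_of_def)

lemma support_of_le:
  assumes "\<And>x. x \<in> body_of p \<Longrightarrow> x \<bullet> v \<le> B" shows "support_of p v \<le> B"
  unfolding support_of_def using assms zero_in_body_of by (intro cSUP_least) blast+

lemma support_of_abs_ge:
  assumes "admissible p" "x \<in> body_of p" shows "\<bar>x \<bullet> v\<bar> \<le> support_of p v"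
  using support_of_ge[OF assms] support_of_ge[OF assms(1), of "- x"] assms
  by (simp add: body_of_def gauge_of_minus abs_le_iff)

lemma support_of_lipschitz:
  assumes "admissible p" "\<And>x. x \<in> body_of p \<Longrightarrow> norm x \<le> R"
  shows "\<bar>support_of p v - support_of p w\<bar> \<le> R * norm (v - w)"
proof -
  have "support_of p v \<le> support_of p w + R * norm (v - w)" for v w
  proof (rule support_of_le)
    fix x assume x: "x \<in> body_of p"
    have "x \<bullet> v = x \<bullet> w + x \<bullet> (v - w)" by (simp add: inner_diff_right)
    also have "x \<bullet> (v - w) \<le> norm x * norm (v - w)" by (rule norm_cauchy_schwarz)
    also have "\<dots> \<le> R * norm (v - w)" using assms(2)[OF x] by (intro mult_right_mono) auto
    finally show "x \<bullet> v \<le> support_of p w + R * norm (v - w)" using support_of_ge[OF assms(1) x, of w] by simp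
  qed
  from this[of v w] this[of w v] show ?thesis by (simp add: norm_minus_commute abs_le_iff)
qed

lemma support_of_pos:
  assumes "admissible p" "norm v = 1" shows "0 < support_of p v"
proof -
  obtain r where r: "0 < r" "cball 0 r \<subseteq> body_of p" using body_of_contains_ball[OF assms(1)] .
  hence "r *\<^sub>R v \<in> body_of p" using assms by auto
  from support_of_ge[OF assms(1) this, of v] r assms show ?thesis
    by (simp add: dot_square_norm)
qed

lemma support_of_minus:
  assumes "admissible p" shows "support_of p (- v) = support_of p v"
proof -
  have "support_of p (- v) \<le> support_of p v" for v
    by (rule support_of_le) (use support_of_abs_ge[OF assms] in \<open>force simp: abs_le_iff\<close>)
  from this[of v] this[of "- v"] show ?thesis by simp
qed

lemma admissible_inverse_support:
  assumes "admissible p" shows "admissible (\<lambda>v. 1 / support_of p v)"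
proof -
  obtain R where R: "\<And>x. x \<in> body_of p \<Longrightarrow> norm x \<le> R"
    using compact_imp_bounded[OF compact_body_of[OF assms]] by (auto simp: bounded_iff)
  have "(max 0 R)-lipschitz_on (sphere 0 1) (support_of p)"
    using support_of_lipschitz[OF assms, of "max 0 R"] R
    by (intro lipschitz_onI) (auto simp: dist_norm le_max_iff_disj)
  hence "continuous_on (sphere 0 1) (support_of p)" by (rule lipschitz_on_continuous_on)
  thus ?thesis using support_of_pos[OF assms] support_of_minus[OF assms]
    by (auto simp: admissible_def intro!: continuous_intros) (metis less_irrefl)
qed

lemma le_inverse_support:
  assumes "admissible p" "norm v = 1" shows "p v \<le> 1 / support_of p v"
proof -
  have pv: "0 < p v" using assms by (auto simp: admissible_def)
  have "support_of p v \<le> 1 / p v"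
  proof (rule support_of_le)
    fix x assume "x \<in> body_of p"
    hence "p v * (x \<bullet> v) \<le> 1" using gauge_of_ge[OF assms, of x] by (simp add: body_of_def)
    thus "x \<bullet> v \<le> 1 / p v" using pv by (simp add: field_simps)
  qed
  thus ?thesis using pv support_of_pos[OF assms] by (simp add: field_simps)
qed

text \<open>\<open>body_of p\<close> is the intersection of the half-spaces
  \<open>p v * (x \<bullet> v) \<le> 1\<close>, some of which may fail to touch it. Moving each one
  inwards until it touches replaces \<open>p\<close> by \<open>1 / support_of p\<close> and cuts
  nothing off the body.\<close>

lemma gauge_of_inverse_support:
  assumes "admissible p" shows "gauge_of (\<lambda>v. 1 / support_of p v) x = gauge_of p x"
proof (rule antisym)
  show "gauge_of p x \<le> gauge_of (\<lambda>v. 1 / support_of p v) x"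
    by (rule gauge_of_mono[OF assms admissible_inverse_support[OF assms] le_inverse_support[OF assms]])
  show "gauge_of (\<lambda>v. 1 / support_of p v) x \<le> gauge_of p x"
  proof (cases "x = 0")
    case False
    have N: "0 < gauge_of p x" using gauge_of_pos[OF assms False] .
    show ?thesis
    proof (rule gauge_of_le)
      fix v :: 'a assume v: "norm v = 1"
      have "(1 / gauge_of p x) *\<^sub>R x \<in> body_of p"
        using N assms by (simp add: body_of_def gauge_of_scaleR)
      from support_of_ge[OF assms this, of v]
      show "1 / support_of p v * (x \<bullet> v) \<le> gauge_of p x"
        using N support_of_pos[OF assms v] by (simp add: field_simps)
    qed
  qed simp
qed

section \<open>Boxes adapted to a body\<close>

lemma greedy_frame:
  fixes K :: "'a::euclidean_space set"
  assumes K: "compact K" and r: "0 < r" "cball 0 r \<subseteq> K"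
    and m: "m \<le> DIM('a)"
  defines "P \<equiv> \<lambda>e i x. x - (\<Sum>j<i::nat. (x \<bullet> e j) *\<^sub>R e j)"
  shows "\<exists>e a z. orthonormal_frame m e \<and>
    (\<forall>i<m. z i \<in> K \<and> 0 < a i \<and> P e i (z i) = a i *\<^sub>R e i \<and> (\<forall>x\<in>K. norm (P e i x) \<le> a i))"
  using m
proof (induction m)
  case 0
  show ?case by (auto simp: orthonormal_frame_def)
next
  case (Suc m)
  then obtain e a z where e: "orthonormal_frame m e"
    and I: "\<And>i. i < m \<Longrightarrow> z i \<in> K \<and> 0 < a i \<and> P e i (z i) = a i *\<^sub>R e i \<and> (\<forall>x\<in>K. norm (P e i x) \<le> a i)"
    by auto
  have "continuous_on K (\<lambda>x. norm (P e m x))" unfolding P_def by (intro continuous_intros)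
  moreover have "K \<noteq> {}" using r by force
  ultimately obtain y where y: "y \<in> K" "\<And>x. x \<in> K \<Longrightarrow> norm (P e m x) \<le> norm (P e m y)"
    using continuous_attains_sup[OF K] by metis
  define b where "b = norm (P e m y)"
  have orth: "P e m x \<bullet> e j = 0" if "j < m" for x j
  proof -
    have "(\<Sum>i<m. (x \<bullet> e i) * (e i \<bullet> e j)) = (\<Sum>i<m. if i = j then x \<bullet> e j else 0)"
      using e that by (intro sum.cong) (auto simp: orthonormal_frame_def)
    thus ?thesis using that by (simp add: P_def inner_diff_left inner_sum_left)
  qed
  \<comment> \<open>The inner ball contains a vector of length \<open>r\<close> orthogonal to the
    frame built so far, and the projection fixes this vector.\<close>
  have "0 < b"
  proof -
    have "dim (e ` {..<m}) < DIM('a)" using dim_orthonormal_frame[OF e] Suc.prems by simp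
    then obtain x where x: "x \<noteq> 0" "\<And>y. y \<in> span (e ` {..<m}) \<Longrightarrow> orthogonal x y"
      using orthogonal_to_subspace_exists by blast
    define x' where "x' = (r / norm x) *\<^sub>R x"
    have "x' \<bullet> e j = 0" if "j < m" for j
      using x(2)[of "e j"] that by (simp add: x'_def orthogonal_def span_base)
    hence "P e m x' = x'" by (simp add: P_def)
    moreover have "norm x' = r" using x r by (simp add: x'_def)
    moreover from this have "x' \<in> K" using r by auto
    ultimately have "r \<le> b" using y(2)[of x'] by (simp add: b_def)
    thus ?thesis using r by linarith
  qed
  define e' where "e' = e(m := P e m y /\<^sub>R b)"
  have [simp]: "e' m = P e m y /\<^sub>R b" "\<And>i. i < m \<Longrightarrow> e' i = e i" by (auto simp: e'_def)
  have P': "P e' i = P e i" if "i \<le> m" for i using that by (auto simp: P_def fun_eq_iff)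
  have "orthonormal_frame (Suc m) e'"
    unfolding orthonormal_frame_def
  proof (intro allI impI)
    fix i j assume ij: "i < Suc m" "j < Suc m"
    have bb: "P e m y \<bullet> P e m y = b * b" by (simp add: b_def dot_square_norm power2_eq_square)
    consider "i < m" "j < m" | "i = m" "j < m" | "i < m" "j = m" | "i = m" "j = m" using ij by linarith
    thus "e' i \<bullet> e' j = (if i = j then 1 else 0)"
      by cases (use e orth \<open>0 < b\<close> in \<open>auto simp: orthonormal_frame_def bb inner_commute field_simps\<close>)
  qed
  moreover have "(z(m := y)) i \<in> K \<and> 0 < (a(m := b)) i \<and> P e' i ((z(m := y)) i) = (a(m := b)) i *\<^sub>R e' i
      \<and> (\<forall>x\<in>K. norm (P e' i x) \<le> (a(m := b)) i)" if "i < Suc m" for i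
  proof (cases "i = m")
    case True
    then show ?thesis using y \<open>0 < b\<close> by (auto simp: P' b_def)
  next
    case False
    then show ?thesis using that I[of i] by (auto simp: P')
  qed
  ultimately show ?case by blast
qed

text \<open>Maximality of the projected lengths gives the box; the points \<open>z i\<close> of
  \<open>K\<close> at which they are attained give the lower bound on widths. That bound is phrased
  with an arbitrary \<open>M\<close> so that a support function can be inserted for it.\<close>

lemma box_frame:
  fixes K :: "'a::euclidean_space set"
  assumes K: "compact K" and r: "0 < r" "cball 0 r \<subseteq> K"
  obtains e a where "orthonormal_frame DIM('a) e" "\<And>i. i < DIM('a) \<Longrightarrow> 0 < (a i :: real)"
    "\<And>i j. i \<le> j \<Longrightarrow> j < DIM('a) \<Longrightarrow> a j \<le> a i"
    "\<And>x i. x \<in> K \<Longrightarrow> i < DIM('a) \<Longrightarrow> \<bar>x \<bullet> e i\<bar> \<le> a i"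
    "\<And>x. x \<in> K \<Longrightarrow> norm x \<le> a 0"
    "\<And>v M i. (\<And>x. x \<in> K \<Longrightarrow> \<bar>x \<bullet> v\<bar> \<le> M) \<Longrightarrow> i < DIM('a) \<Longrightarrow> a i * \<bar>v \<bullet> e i\<bar> \<le> 2 ^ DIM('a) * M"
proof -
  define P where "P = (\<lambda>(e :: nat \<Rightarrow> 'a) i x. x - (\<Sum>j<i::nat. (x \<bullet> e j) *\<^sub>R e j))"
  obtain e a z where e: "orthonormal_frame DIM('a) e"
    and I: "\<And>i. i < DIM('a) \<Longrightarrow> z i \<in> K \<and> 0 < a i \<and> P e i (z i) = a i *\<^sub>R e i \<and> (\<forall>x\<in>K. norm (P e i x) \<le> a i)"
    using greedy_frame[OF K r order_refl] unfolding P_def by blast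
  have ee: "e i \<bullet> e j = (if i = j then 1 else 0)" if "i < DIM('a)" "j < DIM('a)" for i j
    using e that by (auto simp: orthonormal_frame_def)
  have Pe: "P e i x \<bullet> e j = (if j < i then 0 else x \<bullet> e j)" if "i < DIM('a)" "j < DIM('a)" for i j x
  proof -
    have "(\<Sum>l<i. (x \<bullet> e l) * (e l \<bullet> e j)) = (\<Sum>l<i. if l = j then x \<bullet> e j else 0)"
      using that by (intro sum.cong) (auto simp: ee)
    thus ?thesis by (simp add: P_def inner_diff_left inner_sum_left)
  qed
  have coord: "\<bar>x \<bullet> e i\<bar> \<le> norm (P e i x)" if "i < DIM('a)" for x i
    using Cauchy_Schwarz_ineq2[of "P e i x" "e i"] that by (simp add: Pe orthonormal_frame_norm[OF e])
  have Suc: "a (Suc i) \<le> a i" if "Suc i < DIM('a)" for i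
  proof -
    \<comment> \<open>Each projection drops one further orthogonal component, so by Pythagoras
      lengths can only decrease.\<close>
    have "P e (Suc i) x = P e i x - (P e i x \<bullet> e i) *\<^sub>R e i" for x
      using that by (simp add: Pe) (simp add: P_def)
    hence "(norm (P e (Suc i) x))\<^sup>2 = (norm (P e i x))\<^sup>2 - (P e i x \<bullet> e i)\<^sup>2" for x
      using that unfolding power2_norm_eq_inner
      by (simp add: inner_diff_left inner_diff_right ee inner_commute power2_eq_square)
    hence "(norm (P e (Suc i) x))\<^sup>2 \<le> (norm (P e i x))\<^sup>2" for x
      by simp
    hence *: "norm (P e (Suc i) x) \<le> norm (P e i x)" for x
      by (rule power2_le_imp_le) simp
    have "a (Suc i) = norm (P e (Suc i) (z (Suc i)))"
      using I[OF that] orthonormal_frame_norm[OF e that] by simp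
    also have "\<dots> \<le> norm (P e i (z (Suc i)))" by (rule *)
    also have "\<dots> \<le> a i" using I[of i] I[OF that] that by simp
    finally show ?thesis .
  qed
  have mono: "a j \<le> a i" if "i \<le> j" "j < DIM('a)" for i j
    using that by (induction j rule: dec_induct) (auto intro: order_trans[OF Suc])
  have box: "\<bar>x \<bullet> e i\<bar> \<le> a i" if "x \<in> K" "i < DIM('a)" for x i
    using coord[OF that(2), of x] I[OF that(2)] that(1) by (blast intro: order_trans)
  \<comment> \<open>\<open>z i\<close> equals \<open>a i *\<^sub>R e i\<close> plus components along
    earlier frame vectors, of size at most \<open>a l\<close>. So the bound for \<open>i\<close> is
    \<open>M\<close> plus the sum of all earlier bounds, and the powers of 2 solve this
    recursion.\<close>
  have low: "a i * \<bar>v \<bullet> e i\<bar> \<le> 2 ^ i * M" if M: "\<And>x. x \<in> K \<Longrightarrow> \<bar>x \<bullet> v\<bar> \<le> M" and i: "i < DIM('a)" for v M i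
    using i
  proof (induction i rule: less_induct)
    case (less i)
    have M0: "0 \<le> M" using M[of 0] r by force
    have zi: "z i = a i *\<^sub>R e i + (\<Sum>l<i. (z i \<bullet> e l) *\<^sub>R e l)"
      using I[OF less.prems] by (simp add: P_def algebra_simps)
    have "a i * (v \<bullet> e i) = z i \<bullet> v - (\<Sum>l<i. (z i \<bullet> e l) * (v \<bullet> e l))"
      using arg_cong[OF zi, of "\<lambda>x. x \<bullet> v"]
      by (simp add: inner_add_left inner_sum_left inner_commute[of v])
    hence "a i * \<bar>v \<bullet> e i\<bar> = \<bar>z i \<bullet> v - (\<Sum>l<i. (z i \<bullet> e l) * (v \<bullet> e l))\<bar>"
      using I[OF less.prems] by (metis abs_mult abs_of_pos)
    also have "\<dots> \<le> \<bar>z i \<bullet> v\<bar> + (\<Sum>l<i. \<bar>(z i \<bullet> e l) * (v \<bullet> e l)\<bar>)"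
      by (rule order_trans[OF abs_triangle_ineq4]) (intro add_left_mono sum_abs)
    also have "\<dots> \<le> M + (\<Sum>l<i. 2 ^ l * M)"
    proof (intro add_mono sum_mono)
      show "\<bar>z i \<bullet> v\<bar> \<le> M" using M I[OF less.prems] by blast
      fix l assume l: "l \<in> {..<i}"
      have "\<bar>(z i \<bullet> e l) * (v \<bullet> e l)\<bar> \<le> a l * \<bar>v \<bullet> e l\<bar>"
        using box[of "z i" l] I[OF less.prems] l less.prems by (auto simp: abs_mult intro!: mult_right_mono)
      also have "\<dots> \<le> 2 ^ l * M" using less l by auto
      finally show "\<bar>(z i \<bullet> e l) * (v \<bullet> e l)\<bar> \<le> 2 ^ l * M" .
    qed
    also have "\<dots> = 2 ^ i * M"
    proof -
      have "(\<Sum>l<i. 2 ^ l :: real) = 2 ^ i - 1" using geometric_sum[of "2::real" i] by simp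
      hence "M + (\<Sum>l<i. 2 ^ l) * M = 2 ^ i * M" by (simp add: left_diff_distrib)
      thus ?thesis by (simp add: sum_distrib_right)
    qed
    finally show ?case .
  qed
  show ?thesis
  proof (rule that[of e a])
    fix x assume "x \<in> K"
    thus "norm x \<le> a 0" using I[of 0] by (auto simp: P_def)
  next
    fix v M i assume M: "\<And>x. x \<in> K \<Longrightarrow> \<bar>x \<bullet> v\<bar> \<le> M" and i: "i < DIM('a)"
    have "0 \<le> M" using M[of 0] r by force
    hence "2 ^ i * M \<le> 2 ^ DIM('a) * M" using i by (intro mult_right_mono power_increasing) auto
    with low[OF M i] show "a i * \<bar>v \<bullet> e i\<bar> \<le> 2 ^ DIM('a) * M" by linarith
  qed (use e I mono box in auto)
qed

section \<open>Volume estimates for bodies in a box\<close>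

lemma measurable_direction_borel [measurable]:
  "(\<lambda>x::'a::euclidean_space. x /\<^sub>R norm x) \<in> borel_measurable borel"
  by measurable

lemma nn_integral_surface_measure:
  fixes f :: "'a::euclidean_space \<Rightarrow> ennreal"
  assumes f: "f \<in> borel_measurable sphere_borel"
  shows "(\<integral>\<^sup>+u. f u \<partial>surface_measure) =
    ennreal (real DIM('a)) * (\<integral>\<^sup>+x. f (x /\<^sub>R norm x) * indicator (ball 0 1 - {0}) x \<partial>lborel)"
proof -
  have "(\<integral>\<^sup>+u. f u \<partial>surface_measure) = ennreal (real DIM('a)) *
     (\<integral>\<^sup>+x. f (x /\<^sub>R norm x) \<partial>restrict_space lborel (ball 0 1 - {0}))"
    unfolding surface_measure_def
    by (subst nn_integral_scale_measure)
      (simp_all add: f nn_integral_distr[OF measurable_direction] measurable_cong_sets[OF sets_distr refl])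
  also have "(\<integral>\<^sup>+x. f (x /\<^sub>R norm x) \<partial>restrict_space lborel (ball 0 1 - {0})) =
     (\<integral>\<^sup>+x. f (x /\<^sub>R norm x) * indicator (ball 0 1 - {0}) x \<partial>lborel)"
    by (rule nn_integral_restrict_space) simp
  finally show ?thesis .
qed

lemma finite_measure_surface_measure: "finite_measure (surface_measure :: 'a::euclidean_space measure)"
proof
  have "emeasure (surface_measure :: 'a measure) (sphere 0 1) \<le> ennreal (real DIM('a)) * emeasure lborel (ball (0::'a) 1)"
  proof -
    have "sphere 0 1 \<in> sets (sphere_borel :: 'a measure)"
      using sets.top[of "sphere_borel :: 'a measure"] by (simp add: space_restrict_space)
    thus ?thesis
      by (subst emeasure_surface_measure) (auto intro!: mult_left_mono emeasure_mono)
  qed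
  also have "\<dots> < \<infinity>" using emeasure_lborel_ball_finite[of "0::'a" 1]
    by (simp add: ennreal_mult_less_top)
  finally show "emeasure (surface_measure :: 'a measure) (space surface_measure) \<noteq> \<infinity>"
    by simp
qed

text \<open>The value at 0 is set by hand because \<open>0 powr (- s) = 0\<close>.\<close>

definition singular_factor :: "real \<Rightarrow> real \<Rightarrow> ennreal" where
  "singular_factor s y = (if y = 0 then \<infinity> else ennreal (\<bar>y\<bar> powr (- s)))"

lemma measurable_singular_factor [measurable]: "singular_factor s \<in> borel_measurable borel"
  unfolding singular_factor_def by measurable

lemma nn_integral_singular_factor:
  assumes s: "s < 1"
  shows "(\<integral>\<^sup>+y. singular_factor s y * indicator {-1..1} y \<partial>lborel) \<le> ennreal (2 / (1 - s))"
proof -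
  let ?H = "\<lambda>y. singular_factor s y * indicator {0..1} y"
  have "(\<integral>\<^sup>+y. ?H y \<partial>lborel) = (\<integral>\<^sup>+y. ennreal (y powr (- s)) * indicator {0..1} y \<partial>lborel)"
  proof (rule nn_integral_cong_AE)
    show "AE y in lborel. ?H y = ennreal (y powr (- s)) * indicator {0..1} y"
      using AE_lborel_singleton[of "0::real"]
      by eventually_elim (auto simp: singular_factor_def indicator_def)
  qed
  also have "\<dots> = ennreal (1 / (1 - s))"
    using has_integral_powr_from_0[of "- s" 1] s
    by (intro nn_integral_has_integral_lebesgue') auto
  finally have H: "(\<integral>\<^sup>+y. ?H y \<partial>lborel) = ennreal (1 / (1 - s))" .
  have "orthogonal_transformation (uminus :: real \<Rightarrow> real)"
    by (auto simp: orthogonal_transformation_def linear_uminus)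
  hence H': "(\<integral>\<^sup>+y. ?H (- y) \<partial>lborel) = ennreal (1 / (1 - s))"
    using H by (subst nn_integral_lborel_orthogonal_transformation[where f="?H"]) auto
  have "(\<integral>\<^sup>+y. singular_factor s y * indicator {-1..1} y \<partial>lborel) \<le> (\<integral>\<^sup>+y. ?H y + ?H (- y) \<partial>lborel)"
    by (intro nn_integral_mono) (auto simp: indicator_def singular_factor_def)
  also have "\<dots> = ennreal (1 / (1 - s)) + ennreal (1 / (1 - s))"
    using H H' by (subst nn_integral_add) auto
  also have "\<dots> = ennreal (2 / (1 - s))" using s by (simp add: ennreal_plus[symmetric] del: ennreal_plus)
  finally show ?thesis .
qed

lemma measurable_sphere_borelI: "f \<in> borel_measurable borel \<Longrightarrow> f \<in> borel_measurable sphere_borel"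
  by (rule measurable_restrict_space1)

text \<open>Inside the unit ball the coordinates of \<open>x\<close> are no larger than those of its
  direction, so passing from the direction to \<open>x\<close> only increases the negative powers.
  The spherical integral is then bounded by a product of one-dimensional integrals over [-1, 1],
  finite because every exponent is below 1, and the frame no longer enters the value.\<close>

lemma singular_prod_bound:
  fixes s :: "nat \<Rightarrow> real"
  assumes s: "\<And>i. i < DIM('a::euclidean_space) \<Longrightarrow> 0 < s i \<and> s i < 1"
  obtains C where "0 < C" "\<And>e :: nat \<Rightarrow> 'a. orthonormal_frame DIM('a) e \<Longrightarrow>
     (\<integral>\<^sup>+u. (\<Prod>i<DIM('a). singular_factor (s i) (u \<bullet> e i)) \<partial>surface_measure) \<le> ennreal C"
proof
  define C where "C = real DIM('a) * (\<Prod>i<DIM('a). 2 / (1 - s i))"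
  show "0 < C" unfolding C_def using s by (intro mult_pos_pos prod_pos) auto
  fix e :: "nat \<Rightarrow> 'a" assume e: "orthonormal_frame DIM('a) e"
  have le: "singular_factor (s i) ((x /\<^sub>R norm x) \<bullet> e i) \<le> singular_factor (s i) (x \<bullet> e i) * indicator {-1..1} (x \<bullet> e i)"
    if x: "x \<in> ball 0 1 - {0}" and i: "i < DIM('a)" for x i
  proof -
    have nx: "0 < norm x" "norm x < 1" using x by auto
    have "\<bar>x \<bullet> e i\<bar> \<le> norm x"
      using Cauchy_Schwarz_ineq2[of x "e i"] by (simp add: orthonormal_frame_norm[OF e i])
    hence 1: "x \<bullet> e i \<in> {-1..1}" using nx by (auto simp: abs_le_iff)
    show ?thesis
    proof (cases "x \<bullet> e i = 0")
      case False
      have "\<bar>x \<bullet> e i\<bar> * 1 \<le> \<bar>x \<bullet> e i\<bar> * inverse (norm x)"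
        using nx by (intro mult_left_mono) (auto simp: field_simps)
      hence "(\<bar>x \<bullet> e i\<bar> * inverse (norm x)) powr (- s i) \<le> \<bar>x \<bullet> e i\<bar> powr (- s i)"
        using s[OF i] False by (intro powr_mono2') auto
      thus ?thesis using 1 False nx by (auto simp: singular_factor_def abs_mult mult.commute)
    qed (use 1 in \<open>simp add: singular_factor_def\<close>)
  qed
  have "(\<integral>\<^sup>+u. (\<Prod>i<DIM('a). singular_factor (s i) (u \<bullet> e i)) \<partial>surface_measure)
     = ennreal (real DIM('a)) * (\<integral>\<^sup>+x. (\<Prod>i<DIM('a). singular_factor (s i) ((x /\<^sub>R norm x) \<bullet> e i)) *
        indicator (ball 0 1 - {0}) x \<partial>lborel)"
    by (rule nn_integral_surface_measure) (rule measurable_sphere_borelI, measurable)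
  also have "\<dots> \<le> ennreal (real DIM('a)) *
     (\<integral>\<^sup>+x. (\<Prod>i<DIM('a). singular_factor (s i) (x \<bullet> e i) * indicator {-1..1} (x \<bullet> e i)) \<partial>lborel)"
  proof (intro mult_left_mono nn_integral_mono)
    fix x :: 'a
    show "(\<Prod>i<DIM('a). singular_factor (s i) ((x /\<^sub>R norm x) \<bullet> e i)) * indicator (ball 0 1 - {0}) x
       \<le> (\<Prod>i<DIM('a). singular_factor (s i) (x \<bullet> e i) * indicator {-1..1} (x \<bullet> e i))"
    proof (cases "x \<in> ball 0 1 - {0}")
      case True
      have "(\<Prod>i<DIM('a). singular_factor (s i) ((x /\<^sub>R norm x) \<bullet> e i))
        \<le> (\<Prod>i<DIM('a). singular_factor (s i) (x \<bullet> e i) * indicator {-1..1} (x \<bullet> e i))"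
        by (rule prod_mono_ennreal, rule le[OF True]) simp
      thus ?thesis using True by simp
    next
      case False
      hence i0: "indicator (ball 0 1 - {0}) x = (0::ennreal)" by (rule indicator_simps(2))
      show ?thesis unfolding i0 by simp
    qed
  qed simp
  also have "\<dots> = ennreal (real DIM('a)) *
      (\<Prod>i<DIM('a). \<integral>\<^sup>+y. singular_factor (s i) y * indicator {-1..1} y \<partial>lborel)"
    by (subst nn_integral_orthonormal_frame_prod[OF e]) auto
  also have "\<dots> \<le> ennreal (real DIM('a)) * (\<Prod>i<DIM('a). ennreal (2 / (1 - s i)))"
    using s by (intro mult_left_mono prod_mono_ennreal nn_integral_singular_factor) auto
  also have "\<dots> = ennreal C" unfolding C_def using s
    by (subst prod_ennreal) (auto simp: ennreal_mult' intro: less_imp_le)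
  finally show "(\<integral>\<^sup>+u. (\<Prod>i<DIM('a). singular_factor (s i) (u \<bullet> e i)) \<partial>surface_measure) \<le> ennreal C" .
qed

text \<open>The point of the body in direction \<open>u\<close> has length
  \<open>1 / gauge_of p u\<close>, so the box yields
  \<open>\<bar>u \<bullet> e i\<bar> / a i \<le> gauge_of p u\<close> for every \<open>i\<close>.
  The exponents split the power \<open>- q\<close> among these bounds; a vanishing coordinate makes
  its factor infinite and the bound trivial.\<close>

lemma gauge_power_le_singular_prod:
  fixes p :: "'a::euclidean_space \<Rightarrow> real"
  assumes p: "admissible p" and s: "\<And>i. i < DIM('a) \<Longrightarrow> 0 < s i" and q: "(\<Sum>i<DIM('a). s i) = q"
    and a: "\<And>i. i < DIM('a) \<Longrightarrow> 0 < a i"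
    and box: "\<And>x i. x \<in> body_of p \<Longrightarrow> i < DIM('a) \<Longrightarrow> \<bar>x \<bullet> e i\<bar> \<le> a i"
    and u: "norm u = 1"
  shows "ennreal (gauge_of p u powr (- q)) \<le>
     ennreal (\<Prod>i<DIM('a). a i powr s i) * (\<Prod>i<DIM('a). singular_factor (s i) (u \<bullet> e i))"
proof -
  have N: "0 < gauge_of p u" using gauge_of_pos[OF p, of u] u by force
  have "ennreal (gauge_of p u powr (- q)) = (\<Prod>i<DIM('a). ennreal (gauge_of p u powr (- s i)))"
    using N by (simp add: prod_ennreal powr_sum[symmetric] sum_negf q)
  also have "\<dots> \<le> (\<Prod>i<DIM('a). ennreal (a i powr s i) * singular_factor (s i) (u \<bullet> e i))"
  proof (rule prod_mono_ennreal)
    fix i assume "i \<in> {..<DIM('a)}"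
    hence i: "i < DIM('a)" by simp
    show "ennreal (gauge_of p u powr (- s i)) \<le> ennreal (a i powr s i) * singular_factor (s i) (u \<bullet> e i)"
    proof (cases "u \<bullet> e i = 0")
      case True
      then show ?thesis using a[OF i] by (simp add: singular_factor_def ennreal_mult_top)
    next
      case False
      have "(1 / gauge_of p u) *\<^sub>R u \<in> body_of p" using N p by (simp add: body_of_def gauge_of_scaleR)
      from box[OF this i] N have "\<bar>u \<bullet> e i\<bar> / a i \<le> gauge_of p u"
        using a[OF i] by (simp add: field_simps abs_mult)
      hence "gauge_of p u powr (- s i) \<le> (\<bar>u \<bullet> e i\<bar> / a i) powr (- s i)"
        using s[OF i] False a[OF i] by (intro powr_mono2') auto
      also have "\<dots> = a i powr s i * \<bar>u \<bullet> e i\<bar> powr (- s i)"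
        using a[OF i] by (simp add: powr_divide powr_minus field_simps)
      finally show ?thesis using False by (simp add: singular_factor_def ennreal_mult[symmetric])
    qed
  qed
  also have "\<dots> = ennreal (\<Prod>i<DIM('a). a i powr s i) * (\<Prod>i<DIM('a). singular_factor (s i) (u \<bullet> e i))"
    by (simp add: prod.distrib prod_ennreal)
  finally show ?thesis .
qed

section \<open>The functional and the mass of neighbourhoods of subspaces\<close>

text \<open>With \<open>w\<close> equal to the power \<open>DIM('a) - q\<close> of the radial
  function of Q, this is DIM times the dual mixed volume of order \<open>q\<close> of
  \<open>body_of p\<close> and Q, that is, DIM times the total mass of the dual curvature
  measure.\<close>

definition volume_of :: "real \<Rightarrow> ('a::euclidean_space \<Rightarrow> real) \<Rightarrow> ('a \<Rightarrow> real) \<Rightarrow> real" where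
  "volume_of q w p = (\<integral>u. gauge_of p u powr (- q) * w u \<partial>surface_measure)"

definition minkowski_functional ::
    "real \<Rightarrow> ('a::euclidean_space \<Rightarrow> real) \<Rightarrow> 'a measure \<Rightarrow> ('a \<Rightarrow> real) \<Rightarrow> real" where
  "minkowski_functional q w \<mu> p =
     ln (volume_of q w p) / q + (\<integral>v. ln (p v) \<partial>\<mu>) / measure \<mu> (sphere 0 1)"

lemma sphere_in_sets:
  assumes "sets M = sets (sphere_borel :: 'a::euclidean_space measure)"
  shows "sphere 0 1 \<in> sets M" "space M = sphere 0 1"
  using sets_eq_imp_space_eq[OF assms] sets.top[of M] by (auto simp: space_restrict_space)

lemma measurable_on_sphere:
  assumes "sets M = sets (sphere_borel :: 'a::euclidean_space measure)" "continuous_on (sphere 0 1) f"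
  shows "f \<in> borel_measurable M"
  using borel_measurable_continuous_on_restrict[OF assms(2)] measurable_cong_sets[OF assms(1) refl]
  by auto

lemma integrable_on_sphere:
  fixes f :: "'a::euclidean_space \<Rightarrow> real"
  assumes M: "sets M = sets (sphere_borel :: 'a measure)" "finite_measure M"
    and f: "continuous_on (sphere 0 1) f"
  shows "integrable M f"
proof -
  obtain B where B: "\<forall>x\<in>sphere 0 1. norm (f x) \<le> B"
    using compact_imp_bounded[OF compact_continuous_image[OF f compact_sphere]]
    by (auto simp: bounded_iff)
  show ?thesis
    by (rule finite_measure.integrable_const_bound[OF M(2), of _ B])
      (use B measurable_on_sphere[OF M(1) f] sphere_in_sets[OF M(1)] in auto)
qed

lemma continuous_on_volume_integrand:
  assumes "admissible p" "continuous_on (sphere 0 1) w"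
  shows "continuous_on (sphere 0 1) (\<lambda>u. gauge_of p u powr r * w u)"
proof -
  have "gauge_of p u \<noteq> 0" if "u \<in> sphere 0 1" for u
    using gauge_of_pos[OF assms(1), of u] that by force
  thus ?thesis by (intro continuous_intros continuous_on_gauge_of[OF assms(1)] assms(2)) auto
qed

lemma surface_measure_sphere_pos: "0 < measure (surface_measure :: 'a::euclidean_space measure) (sphere 0 1)"
proof -
  have "sphere 0 1 \<in> sets (sphere_borel :: 'a measure)"
    using sets.top[of "sphere_borel :: 'a measure"] by (simp add: space_restrict_space)
  hence "emeasure (surface_measure :: 'a measure) (sphere 0 1) = ennreal (real DIM('a)) * emeasure lborel (ball (0::'a) 1 - {0})"
    by (subst emeasure_surface_measure) (auto intro!: arg_cong[where f="\<lambda>A. ennreal (real DIM('a)) * emeasure lborel A"])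
  also have "emeasure lborel (ball (0::'a) 1 - {0}) = emeasure lborel (ball (0::'a) 1)"
    by (rule emeasure_Diff_null_set) (auto simp: null_sets_def)
  finally show ?thesis using content_ball_pos[of 1 "0::'a"]
    by (simp add: measure_def enn2real_mult)
qed

lemma volume_of_pos:
  assumes p: "admissible p" and w: "continuous_on (sphere 0 1) w" "\<And>u. norm u = 1 \<Longrightarrow> 0 < w u"
  shows "0 < volume_of q w (p :: 'a::euclidean_space \<Rightarrow> real)"
proof -
  let ?f = "\<lambda>u. gauge_of p u powr (- q) * w u"
  note c = continuous_on_volume_integrand[OF p w(1), of "- q"]
  obtain x where x: "x \<in> sphere 0 1" "\<forall>y\<in>sphere 0 1. ?f x \<le> ?f y"
    using continuous_attains_inf[OF compact_sphere sphere_ne c] by blast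
  have fx: "0 < ?f x" using x(1) w(2)[of x] gauge_of_pos[OF p, of x] by force
  interpret finite_measure "surface_measure :: 'a measure" by (rule finite_measure_surface_measure)
  have "0 < ?f x * measure (surface_measure :: 'a measure) (sphere 0 1)"
    using fx surface_measure_sphere_pos by (rule mult_pos_pos)
  also have "\<dots> = integral\<^sup>L (surface_measure :: 'a measure) (\<lambda>_. ?f x)" by simp
  also have "\<dots> \<le> volume_of q w p" unfolding volume_of_def
    using x by (intro integral_mono integrable_on_sphere[OF sets_surface_measure finite_measure_surface_measure] c) auto
  finally show ?thesis .
qed

lemma volume_of_scale:
  assumes "admissible p" "0 < k"
  shows "volume_of q w (\<lambda>v. k * p v) = k powr (- q) * volume_of q w p"
proof -
  have "(\<lambda>u. gauge_of (\<lambda>v. k * p v) u powr (- q) * w u) = (\<lambda>u. k powr (- q) * (gauge_of p u powr (- q) * w u))"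
    using assms by (simp add: gauge_of_scale powr_mult gauge_of_nonneg mult.assoc)
  thus ?thesis by (simp add: volume_of_def)
qed

lemma continuous_on_ln_admissible: "admissible p \<Longrightarrow> continuous_on (sphere 0 1) (\<lambda>v. ln (p v))"
  by (auto simp: admissible_def intro!: continuous_intros)

text \<open>The factors \<open>1 / q\<close> and \<open>1 / measure \<mu> (sphere 0 1)\<close> are
  chosen so that the two changes by \<open>ln k\<close> cancel. This freedom serves twice: to
  normalize a maximizing sequence, and to give the maximizer the right total mass at the
  end.\<close>

lemma minkowski_functional_scale:
  assumes p: "admissible p" and k: "0 < k" and q: "0 < q"
    and w: "continuous_on (sphere 0 1) w" "\<And>u. norm u = 1 \<Longrightarrow> 0 < w u"
    and M: "sets \<mu> = sets sphere_borel" "finite_measure \<mu>" "0 < measure \<mu> (sphere 0 1)"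
  shows "minkowski_functional q w \<mu> (\<lambda>v. k * p v) = minkowski_functional q w \<mu> p"
proof -
  interpret finite_measure \<mu> by (rule M)
  have "ln (k * p v) = ln k + ln (p v)" if "norm v = 1" for v
    using p k that ln_mult[of k "p v"] by (force simp: admissible_def)
  hence "(\<integral>v. ln (k * p v) \<partial>\<mu>) = (\<integral>v. ln k + ln (p v) \<partial>\<mu>)"
    using sphere_in_sets[OF M(1)]
    by (intro Bochner_Integration.integral_cong) auto
  also have "\<dots> = ln k * measure \<mu> (sphere 0 1) + (\<integral>v. ln (p v) \<partial>\<mu>)"
    using sphere_in_sets[OF M(1)]
    by (subst Bochner_Integration.integral_add)
      (auto intro!: integrable_on_sphere M continuous_on_ln_admissible p)
  finally have "(\<integral>v. ln (k * p v) \<partial>\<mu>) / measure \<mu> (sphere 0 1) = ln k + (\<integral>v. ln (p v) \<partial>\<mu>) / measure \<mu> (sphere 0 1)"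
    using M by (simp add: field_simps)
  moreover have "ln (volume_of q w (\<lambda>v. k * p v)) / q = - ln k + ln (volume_of q w p) / q"
    using q k volume_of_pos[OF p w, of q]
    by (simp add: volume_of_scale[OF p k] ln_mult ln_powr diff_divide_distrib)
  ultimately show ?thesis by (simp add: minkowski_functional_def)
qed

lemma minkowski_functional_le_inverse_support:
  assumes p: "admissible p"
    and M: "sets \<mu> = sets sphere_borel" "finite_measure \<mu>"
  shows "minkowski_functional q w \<mu> p \<le> minkowski_functional q w \<mu> (\<lambda>v. 1 / support_of p v)"
proof -
  note a = admissible_inverse_support[OF p]
  have "ln (p v) \<le> ln (1 / support_of p v)" if "norm v = 1" for v
    using p that le_inverse_support[OF p that] by (intro ln_mono) (auto simp: admissible_def)
  hence "(\<integral>v. ln (p v) \<partial>\<mu>) \<le> (\<integral>v. ln (1 / support_of p v) \<partial>\<mu>)"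
    using sphere_in_sets[OF M(1)] 
    by (intro integral_mono integrable_on_sphere M continuous_on_ln_admissible p a) auto
  thus ?thesis
    unfolding minkowski_functional_def
    by (simp add: volume_of_def gauge_of_inverse_support[OF p] divide_right_mono del: ln_divide_pos)
qed

section \<open>Mass near subspaces, uniformly over all frames\<close>

lemma convergent_frame_subsequence:
  fixes E :: "nat \<Rightarrow> nat \<Rightarrow> 'a::euclidean_space"
  assumes "\<And>k l. l < i \<Longrightarrow> norm (E k l) \<le> 1"
  shows "\<exists>r e. strict_mono r \<and> (\<forall>l<i. (\<lambda>k. E (r k) l) \<longlonglongrightarrow> e l)"
  using assms
proof (induction i)
  case 0
  show ?case by (auto intro: exI[of _ id] simp: strict_mono_def)
next
  case (Suc i)
  then obtain r e where r: "strict_mono r" "\<And>l. l < i \<Longrightarrow> (\<lambda>k. E (r k) l) \<longlonglongrightarrow> e l" by force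
  have "\<forall>k. E (r k) i \<in> cball 0 1" using Suc.prems by auto
  then obtain x r' where r': "strict_mono r'" "((\<lambda>k. E (r k) i) \<circ> r') \<longlonglongrightarrow> x"
    using compact_cball[of 0 1] unfolding compact_def by meson
  show ?case
  proof (intro exI conjI allI impI)
    show "strict_mono (r \<circ> r')" using r r' by (simp add: strict_mono_o)
    fix l assume "l < Suc i"
    thus "(\<lambda>k. E ((r \<circ> r') k) l) \<longlonglongrightarrow> (e(i := x)) l"
      using r' LIMSEQ_subseq_LIMSEQ[OF r(2) r'(1), of l] by (cases "l = i") (auto simp: o_def)
  qed
qed

lemma dim_orthogonal_complement_frame:
  fixes e :: "nat \<Rightarrow> 'a::euclidean_space"
  assumes e: "orthonormal_frame i e"
  shows "subspace {v. \<forall>l<i. v \<bullet> e l = 0}" "dim {v. \<forall>l<i. v \<bullet> e l = 0} = DIM('a) - i"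
proof -
  show "subspace {v. \<forall>l<i. v \<bullet> e l = 0}" by (auto simp: subspace_def inner_add_left)
  have "dim {y \<in> UNIV. \<forall>x\<in>span (e ` {..<i}). orthogonal x y} + dim (span (e ` {..<i})) = dim (UNIV :: 'a set)"
    by (rule dim_subspace_orthogonal_to_vectors) auto
  moreover have "{y \<in> UNIV. \<forall>x\<in>span (e ` {..<i}). orthogonal x y} = {v. \<forall>l<i. v \<bullet> e l = 0}"
  proof (intro set_eqI iffI; clarsimp)
    fix x l assume "\<forall>y\<in>span (e ` {..<i}). orthogonal y x" "l < i"
    hence "orthogonal (e l) x" by (simp add: span_base)
    thus "x \<bullet> e l = 0" by (simp add: orthogonal_def inner_commute)
  next
    fix x y assume "\<forall>l<i. x \<bullet> e l = 0" "y \<in> span (e ` {..<i})"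
    hence "orthogonal x y"
      by (intro orthogonal_to_span[of y "e ` {..<i}" x]) (auto simp: orthogonal_def)
    thus "orthogonal y x" by (simp add: orthogonal_commute)
  qed
  ultimately show "dim {v. \<forall>l<i. v \<bullet> e l = 0} = DIM('a) - i"
    by (simp add: dim_orthonormal_frame[OF e])
qed

lemma near_subspace_sets:
  fixes e :: "nat \<Rightarrow> 'a::euclidean_space"
  assumes "sets \<mu> = sets (sphere_borel :: 'a measure)"
  shows "{v \<in> sphere 0 1. \<forall>l<i. \<bar>v \<bullet> e l\<bar> < d} \<in> sets \<mu>" "{v \<in> sphere 0 1. \<forall>l<i. \<bar>v \<bullet> e l\<bar> \<le> d} \<in> sets \<mu>"
proof -
  have [measurable]: "(\<lambda>v. \<bar>v \<bullet> e l\<bar>) \<in> borel_measurable \<mu>" for l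
    by (intro measurable_on_sphere[OF assms] continuous_intros)
  show "{v \<in> sphere 0 1. \<forall>l<i. \<bar>v \<bullet> e l\<bar> < d} \<in> sets \<mu>" "{v \<in> sphere 0 1. \<forall>l<i. \<bar>v \<bullet> e l\<bar> \<le> d} \<in> sets \<mu>"
    unfolding sphere_in_sets(2)[OF assms, symmetric] by measurable
qed

text \<open>If no \<open>d\<close> worked, frames violating the claim for
  \<open>d = 1 / Suc k\<close> would have first \<open>i\<close> vectors converging along a
  subsequence. Every closed neighbourhood of the complement of the limit vectors would then have
  mass at least \<open>B\<close>, and by continuity from above so would the complement itself, which
  has dimension \<open>DIM('a) - i\<close>. A single \<open>d\<close> serves both as width and as
  gap, since shrinking it weakens both demands.\<close>

lemma near_subspace_mass:
  fixes \<mu> :: "'a::euclidean_space measure"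
  assumes M: "sets \<mu> = sets sphere_borel" "finite_measure \<mu>"
    and lt: "\<And>\<xi> :: 'a set. subspace \<xi> \<Longrightarrow> dim \<xi> = DIM('a) - i \<Longrightarrow> measure \<mu> (sphere 0 1 \<inter> \<xi>) < B"
    and i: "i \<le> DIM('a)"
  shows "\<exists>d>0. \<forall>e. orthonormal_frame DIM('a) e \<longrightarrow> measure \<mu> {v \<in> sphere 0 1. \<forall>l<i. \<bar>v \<bullet> e l\<bar> < d} \<le> B - d"
proof (rule ccontr)
  interpret finite_measure \<mu> by (rule M)
  let ?S = "sphere (0::'a) 1"
  assume neg: "\<not> ?thesis"
  have "\<forall>k. \<exists>e. orthonormal_frame DIM('a) e \<and> B - 1 / real (Suc k) < measure \<mu> {v \<in> ?S. \<forall>l<i. \<bar>v \<bullet> e l\<bar> < 1 / real (Suc k)}"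
  proof (intro allI)
    fix k
    have "\<not> (\<forall>e. orthonormal_frame DIM('a) e \<longrightarrow>
        measure \<mu> {v \<in> ?S. \<forall>l<i. \<bar>v \<bullet> e l\<bar> < 1 / real (Suc k)} \<le> B - 1 / real (Suc k))"
      using neg by (meson of_nat_0_less_iff zero_less_Suc zero_less_divide_1_iff)
    thus "\<exists>e. orthonormal_frame DIM('a) e \<and> B - 1 / real (Suc k) < measure \<mu> {v \<in> ?S. \<forall>l<i. \<bar>v \<bullet> e l\<bar> < 1 / real (Suc k)}"
      by (auto simp: not_le)
  qed
  from choice[OF this] obtain E where E: "\<And>k. orthonormal_frame DIM('a) (E k)"
    and mE: "\<And>k. B - 1 / real (Suc k) < measure \<mu> {v \<in> ?S. \<forall>l<i. \<bar>v \<bullet> E k l\<bar> < 1 / real (Suc k)}"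
    by blast
  obtain r e where r: "strict_mono r" and e: "\<And>l. l < i \<Longrightarrow> (\<lambda>k. E (r k) l) \<longlonglongrightarrow> e l"
  proof -
    have "norm (E k l) \<le> 1" if "l < i" for k l
      using orthonormal_frame_norm[OF E[of k], of l] \<open>l < i\<close> i by simp
    from convergent_frame_subsequence[of i E, OF this] show ?thesis using that by blast
  qed
  have frame: "orthonormal_frame i e"
    unfolding orthonormal_frame_def
  proof (intro allI impI)
    fix a b assume ab: "a < i" "b < i"
    have "(\<lambda>k. E (r k) a \<bullet> E (r k) b) \<longlonglongrightarrow> e a \<bullet> e b" using ab by (intro tendsto_intros e)
    moreover have "(\<lambda>k. E (r k) a \<bullet> E (r k) b) = (\<lambda>k. if a = b then 1 else 0)"
      using E ab i by (auto simp: orthonormal_frame_def fun_eq_iff)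
    ultimately show "e a \<bullet> e b = (if a = b then 1 else 0)"
      using LIMSEQ_unique[OF _ tendsto_const] by fastforce
  qed
  define A where "A d = {v \<in> ?S. \<forall>l<i. \<bar>v \<bullet> e l\<bar> \<le> d}" for d
  have AM: "A d \<in> sets \<mu>" for d unfolding A_def by (rule near_subspace_sets[OF M(1)])
  have inv: "(\<lambda>k. 1 / real (Suc (r k))) \<longlonglongrightarrow> 0"
    using LIMSEQ_subseq_LIMSEQ[OF LIMSEQ_inverse_real_of_nat r] by (simp add: o_def inverse_eq_divide)
  have ge: "B \<le> measure \<mu> (A d)" if d: "0 < d" for d
  proof (rule LIMSEQ_le_const2)
    show "(\<lambda>k. B - 1 / real (Suc (r k))) \<longlonglongrightarrow> B" using tendsto_diff[OF tendsto_const inv] by simp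
    have "\<forall>\<^sub>F k in sequentially. 1 / real (Suc (r k)) < d / 2"
      using order_tendstoD(2)[OF inv, of "d / 2"] d by simp
    moreover have "\<forall>\<^sub>F k in sequentially. \<forall>l\<in>{..<i}. dist (E (r k) l) (e l) < d / 2"
      using d by (intro eventually_ball_finite ballI tendstoD[OF e]) auto
    ultimately have "\<forall>\<^sub>F k in sequentially. B - 1 / real (Suc (r k)) \<le> measure \<mu> (A d)"
    proof eventually_elim
      case (elim k)
      have "{v \<in> ?S. \<forall>l<i. \<bar>v \<bullet> E (r k) l\<bar> < 1 / real (Suc (r k))} \<subseteq> A d"
      proof
        fix v assume v: "v \<in> {v \<in> ?S. \<forall>l<i. \<bar>v \<bullet> E (r k) l\<bar> < 1 / real (Suc (r k))}"
        have "\<bar>v \<bullet> e l\<bar> \<le> d" if l: "l < i" for l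
        proof -
          have "\<bar>v \<bullet> (e l - E (r k) l)\<bar> \<le> norm v * norm (e l - E (r k) l)" by (rule Cauchy_Schwarz_ineq2)
          also have "\<dots> \<le> d / 2"
            using bspec[OF elim(2), of l] l v by (simp add: dist_norm norm_minus_commute)
          finally have "\<bar>v \<bullet> e l\<bar> \<le> \<bar>v \<bullet> E (r k) l\<bar> + d / 2"
            unfolding inner_diff_right by linarith
          also have "\<bar>v \<bullet> E (r k) l\<bar> < 1 / real (Suc (r k))" using v l by blast
          also have "1 / real (Suc (r k)) + d / 2 \<le> d" using elim(1) by linarith
          finally show ?thesis by simp
        qed
        thus "v \<in> A d" using v by (auto simp: A_def)
      qed
      from finite_measure_mono[OF this AM] mE[of "r k"] show ?case by linarith
    qed
    thus "\<exists>N. \<forall>n\<ge>N. B - 1 / real (Suc (r n)) \<le> measure \<mu> (A d)"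
      by (simp add: eventually_sequentially)
  qed
  have "(\<lambda>j. measure \<mu> (A (1 / real (Suc j)))) \<longlonglongrightarrow> measure \<mu> (\<Inter>j. A (1 / real (Suc j)))"
  proof (rule finite_Lim_measure_decseq)
    show "decseq (\<lambda>j. A (1 / real (Suc j)))"
    proof (rule antimonoI)
      fix j k :: nat assume "j \<le> k"
      hence "1 / real (Suc k) \<le> 1 / real (Suc j)" by (simp add: frac_le)
      thus "A (1 / real (Suc k)) \<subseteq> A (1 / real (Suc j))"
        unfolding A_def by (blast intro: order_trans)
    qed
  qed (use AM in auto)
  hence "B \<le> measure \<mu> (\<Inter>j. A (1 / real (Suc j)))"
    by (rule LIMSEQ_le_const) (intro exI allI impI ge, simp)
  also have "(\<Inter>j. A (1 / real (Suc j))) = ?S \<inter> {v. \<forall>l<i. v \<bullet> e l = 0}"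
  proof (intro set_eqI iffI)
    fix v assume v: "v \<in> (\<Inter>j. A (1 / real (Suc j)))"
    have "v \<bullet> e l = 0" if "l < i" for l
    proof (rule ccontr)
      assume "v \<bullet> e l \<noteq> 0"
      then obtain j where "1 / real (Suc j) < \<bar>v \<bullet> e l\<bar>"
        using reals_Archimedean[of "\<bar>v \<bullet> e l\<bar>"] by (auto simp: inverse_eq_divide)
      moreover have "\<bar>v \<bullet> e l\<bar> \<le> 1 / real (Suc j)" using v that by (auto simp: A_def)
      ultimately show False by simp
    qed
    thus "v \<in> ?S \<inter> {v. \<forall>l<i. v \<bullet> e l = 0}" using v by (auto simp: A_def)
  qed (auto simp: A_def)
  finally show False using lt[OF dim_orthogonal_complement_frame[OF frame]] by simp
qed

lemma uniform_mass_gap: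
  fixes \<mu> :: "'a::euclidean_space measure"
  assumes M: "sets \<mu> = sets sphere_borel" "finite_measure \<mu>" "0 < measure \<mu> (sphere 0 1)"
    and lt: "\<And>i (\<xi> :: 'a set). i \<in> {1..DIM('a) - 1} \<Longrightarrow> subspace \<xi> \<Longrightarrow> dim \<xi> = i \<Longrightarrow>
      measure \<mu> (sphere 0 1 \<inter> \<xi>) / measure \<mu> (sphere 0 1) < min (real i / q) 1"
  obtains d where "0 < d" "d \<le> 1 / real DIM('a)" "d \<le> 1 / 2"
    "\<And>e i. orthonormal_frame DIM('a) e \<Longrightarrow> i \<in> {1..DIM('a) - 1} \<Longrightarrow>
       measure \<mu> {v \<in> sphere 0 1. \<forall>l<i. \<bar>v \<bullet> e l\<bar> < d}
         \<le> (min (real (DIM('a) - i) / q) 1 - d) * measure \<mu> (sphere 0 1)"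
proof -
  interpret finite_measure \<mu> by (rule M)
  let ?m = "measure \<mu> (sphere 0 1)"
  let ?P = "\<lambda>i d. \<forall>e. orthonormal_frame DIM('a) e \<longrightarrow> measure \<mu> {v \<in> sphere 0 1. \<forall>l<i. \<bar>v \<bullet> e l\<bar> < d}
     \<le> min (real (DIM('a) - i) / q) 1 * ?m - d"
  have "\<exists>d>0. ?P i d" if i: "i \<in> {1..DIM('a) - 1}" for i
  proof (rule near_subspace_mass[OF M(1,2)])
    fix \<xi> :: "'a set" assume \<xi>: "subspace \<xi>" "dim \<xi> = DIM('a) - i"
    have "DIM('a) - i \<in> {1..DIM('a) - 1}" using i by auto
    from lt[OF this \<xi>] M(3)
    show "measure \<mu> (sphere 0 1 \<inter> \<xi>) < min (real (DIM('a) - i) / q) 1 * ?m"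
      by (simp only: pos_divide_less_eq)
  qed (use i in auto)
  hence "\<forall>i\<in>{1..DIM('a) - 1}. \<exists>d. 0 < d \<and> ?P i d" by blast
  from bchoice[OF this] obtain D where D: "\<And>i. i \<in> {1..DIM('a) - 1} \<Longrightarrow> 0 < D i \<and> ?P i (D i)"
    by blast
  \<comment> \<open>The bound \<open>1 / DIM\<close> ensures that every unit vector has a frame
    coordinate of size at least \<open>d\<close>; the bound \<open>1 / 2\<close> makes
    \<open>d / 2\<close> a legitimate mixing weight for the exponents.\<close>
  define T where "T = insert (1 / real DIM('a)) (insert (1 / 2) (D ` {1..DIM('a) - 1}))"
  define d0 where "d0 = Min T"
  have T: "finite T" "T \<noteq> {}" "\<And>x. x \<in> T \<Longrightarrow> 0 < x" using D by (auto simp: T_def)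
  have "0 < d0" unfolding d0_def using Min_in[OF T(1,2)] T(3) by blast
  moreover have "d0 \<le> x" if "x \<in> T" for x unfolding d0_def using Min_le[OF T(1) that] .
  ultimately have d0: "0 < d0" "d0 \<le> 1 / real DIM('a)" "d0 \<le> 1 / 2"
    "\<And>i. i \<in> {1..DIM('a) - 1} \<Longrightarrow> d0 \<le> D i"
    unfolding T_def by blast+
  \<comment> \<open>The gap is to be measured relative to the total mass, hence the second
    term.\<close>
  define d where "d = min d0 (d0 / ?m)"
  have d: "0 < d" "d \<le> d0" "d * ?m \<le> d0"
    using d0 M(3) unfolding d_def by (auto simp: min_def field_simps)
  show ?thesis
  proof (rule that[of d])
    fix e :: "nat \<Rightarrow> 'a" and i assume e: "orthonormal_frame DIM('a) e" and i: "i \<in> {1..DIM('a) - 1}"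
    have dD: "d \<le> D i" "d * ?m \<le> D i" using d d0(4)[OF i] by auto
    have "measure \<mu> {v \<in> sphere 0 1. \<forall>l<i. \<bar>v \<bullet> e l\<bar> < d} \<le> measure \<mu> {v \<in> sphere 0 1. \<forall>l<i. \<bar>v \<bullet> e l\<bar> < D i}"
      using dD by (intro finite_measure_mono near_subspace_sets[OF M(1)]) force
    also have "\<dots> \<le> min (real (DIM('a) - i) / q) 1 * ?m - D i"
      using D[OF i] e by blast
    also have "\<dots> \<le> (min (real (DIM('a) - i) / q) 1 - d) * ?m"
      using dD by (simp add: left_diff_distrib)
    finally show "measure \<mu> {v \<in> sphere 0 1. \<forall>l<i. \<bar>v \<bullet> e l\<bar> < d}
         \<le> (min (real (DIM('a) - i) / q) 1 - d) * ?m" .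
  qed (use d d0 in auto)
qed

section \<open>Choice of exponents and the upper bound for the functional\<close>

lemma abel_summation:
  fixes L s :: "nat \<Rightarrow> real"
  shows "(\<Sum>l<Suc N. s l * L l) = (\<Sum>l<Suc N. s l) * L 0 - (\<Sum>i<N. (L i - L (Suc i)) * (\<Sum>l\<in>{Suc i..<Suc N}. s l))"
proof (induction N)
  case (Suc N)
  have "(\<Sum>i<Suc N. (L i - L (Suc i)) * (\<Sum>l\<in>{Suc i..<Suc (Suc N)}. s l))
      = (\<Sum>i<Suc N. (L i - L (Suc i)) * (\<Sum>l\<in>{Suc i..<Suc N}. s l)) + (\<Sum>i<Suc N. (L i - L (Suc i)) * s (Suc N))"
    by (simp add: sum.distrib[symmetric] distrib_left)
  also have "(\<Sum>i<Suc N. (L i - L (Suc i)) * s (Suc N)) = (L 0 - L (Suc N)) * s (Suc N)"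
    by (simp only: sum_distrib_right[symmetric] sum_lessThan_telescope')
  finally show ?case using Suc.IH by (simp add: algebra_simps)
qed simp

text \<open>The exponents put the full weight 1 on the shortest sides as long as the total \<open>q\<close> allows it;
  mixing in a small constant keeps them strictly between 0 and 1.\<close>

lemma greedy_exponents:
  fixes q t :: real
  assumes q: "0 < q" "q < real n" and t: "0 < t" "t < 1"
  obtains s :: "nat \<Rightarrow> real" where "\<And>i. i < n \<Longrightarrow> 0 < s i \<and> s i < 1" "(\<Sum>i<n. s i) = q"
    "\<And>i. i \<le> n \<Longrightarrow> min (real (n - i)) q - t * q \<le> (\<Sum>l\<in>{i..<n}. s l)"
proof -
  \<comment> \<open>The decrements of \<open>min (n - l) q\<close>: 1 on the last indices, 0 on the
    first ones, a fractional remainder at the transition. Tail sums telescope. Since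
    \<open>q / n\<close> lies strictly between 0 and 1, averaging with it moves all exponents off
    the endpoints.\<close>
  define g where "g l = min (real n - real l) q - min (real n - real (Suc l)) q" for l
  define s where "s l = (1 - t) * g l + t * (q / real n)" for l
  have g: "0 \<le> g l" "g l \<le> 1" for l unfolding g_def by auto
  have gsum: "(\<Sum>l\<in>{i..<n}. g l) = min (real n - real i) q" if "i \<le> n" for i
    using sum_Suc_diff'[OF that, of "\<lambda>l. - min (real n - real l) q"] q by (simp add: g_def)
  have qn: "0 < q / real n" "q / real n < 1" using q by (auto simp: field_simps)
  have ssum: "(\<Sum>l\<in>{i..<n}. s l) = (1 - t) * min (real n - real i) q + t * (q / real n) * real (n - i)" if "i \<le> n" for i
    by (simp add: s_def sum.distrib sum_distrib_left[symmetric] gsum[OF that])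
  show ?thesis
  proof (rule that[of s])
    fix i assume "i < n"
    have *: "0 < x + y \<and> x + y < 1" if "0 \<le> x" "x \<le> 1 - t" "0 < y" "y < t" for x y
      using that by auto
    have "(1 - t) * g i \<le> 1 - t" using g t mult_left_mono[of "g i" 1 "1 - t"] by simp
    moreover have "t * (q / real n) < t" using mult_strict_left_mono[OF qn(2) t(1)] by simp
    moreover have "0 < t * (q / real n)" using t(1) qn(1) by (rule mult_pos_pos)
    moreover have "0 \<le> (1 - t) * g i" using g t by simp
    ultimately show "0 < s i \<and> s i < 1" unfolding s_def by (intro *)
  next
    show "(\<Sum>i<n. s i) = q" using ssum[of 0] q by (simp add: lessThan_atLeast0 algebra_simps)
  next
    fix i assume i: "i \<le> n"
    have "t * min (real n - real i) q \<le> t * q" using t by (intro mult_left_mono) auto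
    moreover have "0 \<le> t * (q / real n) * real (n - i)"
      by (intro mult_nonneg_nonneg less_imp_le[OF t(1)] less_imp_le[OF qn(1)]) simp
    ultimately show "min (real (n - i)) q - t * q \<le> (\<Sum>l\<in>{i..<n}. s l)"
      using ssum[OF i] i by (simp add: left_diff_distrib of_nat_diff)
  qed
qed

lemma volume_of_le_box:
  fixes p w :: "'a::euclidean_space \<Rightarrow> real"
  assumes p: "admissible p" and w: "continuous_on (sphere 0 1) w" "\<And>u. norm u = 1 \<Longrightarrow> 0 < w u \<and> w u \<le> W"
    and s: "\<And>i. i < DIM('a) \<Longrightarrow> 0 < s i" and q: "(\<Sum>i<DIM('a). s i) = q"
    and a: "\<And>i. i < DIM('a) \<Longrightarrow> 0 < a i"
    and box: "\<And>x i. x \<in> body_of p \<Longrightarrow> i < DIM('a) \<Longrightarrow> \<bar>x \<bullet> e i\<bar> \<le> a i"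
    and C: "0 \<le> C" "(\<integral>\<^sup>+u. (\<Prod>i<DIM('a). singular_factor (s i) (u \<bullet> e i)) \<partial>(surface_measure :: 'a measure)) \<le> ennreal C"
  shows "volume_of q w p \<le> W * (\<Prod>i<DIM('a). a i powr s i) * C"
proof -
  let ?A = "\<Prod>i<DIM('a). a i powr s i"
  obtain u0 :: 'a where "norm u0 = 1" using vector_choose_size[of 1] by (metis zero_le_one)
  hence W: "0 \<le> W" using w(2)[of u0] by auto
  have A: "0 \<le> ?A" by (intro prod_nonneg) auto
  note c = continuous_on_volume_integrand[OF p w(1), of "- q"]
  have "ennreal (volume_of q w p) = (\<integral>\<^sup>+u. ennreal (gauge_of p u powr (- q) * w u) \<partial>surface_measure)"
    unfolding volume_of_def
    using w(2)
    by (intro nn_integral_eq_integral[symmetric] integrable_on_sphere c finite_measure_surface_measure sets_surface_measure)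
      (auto intro!: AE_I2 mult_nonneg_nonneg intro: less_imp_le)
  also have "\<dots> \<le> (\<integral>\<^sup>+u. ennreal (W * ?A) * (\<Prod>i<DIM('a). singular_factor (s i) (u \<bullet> e i)) \<partial>surface_measure)"
  proof (rule nn_integral_mono)
    fix u :: 'a assume "u \<in> space surface_measure"
    hence u: "norm u = 1" by simp
    have "ennreal (gauge_of p u powr (- q) * w u) = ennreal (w u) * ennreal (gauge_of p u powr (- q))"
      using w(2)[OF u] by (simp add: ennreal_mult mult.commute less_imp_le)
    also have "\<dots> \<le> ennreal W * (ennreal ?A * (\<Prod>i<DIM('a). singular_factor (s i) (u \<bullet> e i)))"
      using w(2)[OF u] gauge_power_le_singular_prod[OF p s q a box u]
      by (intro mult_mono ennreal_leI) auto
    finally show "ennreal (gauge_of p u powr (- q) * w u) \<le> ennreal (W * ?A) * (\<Prod>i<DIM('a). singular_factor (s i) (u \<bullet> e i))"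
      using W A by (simp add: ennreal_mult mult.assoc)
  qed
  also have "\<dots> = ennreal (W * ?A) * (\<integral>\<^sup>+u. (\<Prod>i<DIM('a). singular_factor (s i) (u \<bullet> e i)) \<partial>surface_measure)"
  proof (rule nn_integral_cmult)
    have "(\<lambda>u. \<Prod>i<DIM('a). singular_factor (s i) (u \<bullet> e i)) \<in> borel_measurable (sphere_borel :: 'a measure)"
      by (rule measurable_sphere_borelI, measurable)
    thus "(\<lambda>u. \<Prod>i<DIM('a). singular_factor (s i) (u \<bullet> e i)) \<in> borel_measurable (surface_measure :: 'a measure)"
      using measurable_cong_sets[OF sets_surface_measure refl] by blast
  qed
  also have "\<dots> \<le> ennreal (W * ?A) * ennreal C" by (intro mult_left_mono C) simp
  also have "\<dots> = ennreal (W * ?A * C)" using W A C by (simp add: ennreal_mult)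
  finally show ?thesis using W A C by (subst (asm) ennreal_le_iff) auto
qed

text \<open>Let \<open>j\<close> be the first index at which the coordinate of \<open>v\<close> is
  at least \<open>d\<close>. The support function at \<open>v\<close> is then at least a constant
  times \<open>a j\<close>, and \<open>v\<close> lies in the neighbourhoods belonging to all
  \<open>i < j\<close>, so the indicators pick out the telescoping sum for
  \<open>ln (a 0) - ln (a j)\<close>. The form with indicators can be integrated against
  \<mu>.\<close>

lemma ln_support_lower_bound:
  fixes p :: "'a::euclidean_space \<Rightarrow> real"
  assumes p: "admissible p" and e: "orthonormal_frame DIM('a) e"
    and a: "\<And>i. i < DIM('a) \<Longrightarrow> 0 < a i" "\<And>i j. i \<le> j \<Longrightarrow> j < DIM('a) \<Longrightarrow> a j \<le> a i"
    and low: "\<And>v i. i < DIM('a) \<Longrightarrow> a i * \<bar>v \<bullet> e i\<bar> \<le> 2 ^ DIM('a) * support_of p v"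
    and d: "0 < d" "d \<le> 1 / real DIM('a)" and v: "norm v = 1"
  shows "ln (d / 2 ^ DIM('a)) + ln (a 0) - (\<Sum>i<DIM('a) - 1. (ln (a i) - ln (a (Suc i))) *
      indicat_real {v \<in> sphere 0 1. \<forall>l<Suc i. \<bar>v \<bullet> e l\<bar> < d} v) \<le> ln (support_of p v)"
proof -
  let ?U = "\<lambda>i. {v \<in> sphere 0 1. \<forall>l<Suc i. \<bar>v \<bullet> e l\<bar> < d}"
  obtain i0 where "i0 < DIM('a)" "d \<le> \<bar>v \<bullet> e i0\<bar>"
    using orthonormal_frame_large_coordinate[OF e v] d(2) by force
  hence ex: "\<exists>j. j < DIM('a) \<and> d \<le> \<bar>v \<bullet> e j\<bar>" by blast
  define j where "j = (LEAST j. j < DIM('a) \<and> d \<le> \<bar>v \<bullet> e j\<bar>)"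
  have j: "j < DIM('a)" "d \<le> \<bar>v \<bullet> e j\<bar>" using LeastI_ex[OF ex] by (auto simp: j_def)
  have jl: "\<bar>v \<bullet> e l\<bar> < d" if "l < j" for l
    using not_less_Least[of l "\<lambda>j. j < DIM('a) \<and> d \<le> \<bar>v \<bullet> e j\<bar>"] that j(1) by (auto simp: j_def)
  have dec: "0 \<le> ln (a i) - ln (a (Suc i))" if "i < DIM('a) - 1" for i
    using a(1)[of "Suc i"] a(2)[of i "Suc i"] that by (simp add: ln_mono)
  have "ln (a 0) - ln (a j) = (\<Sum>i<j. ln (a i) - ln (a (Suc i)))" by (rule sum_lessThan_telescope'[symmetric])
  also have "\<dots> = (\<Sum>i<j. (ln (a i) - ln (a (Suc i))) * indicat_real (?U i) v)"
    using jl v by (intro sum.cong) (auto simp: indicator_def)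
  also have "\<dots> \<le> (\<Sum>i<DIM('a) - 1. (ln (a i) - ln (a (Suc i))) * indicat_real (?U i) v)"
    using j(1) dec by (intro sum_mono2) auto
  finally have 1: "ln (a 0) - (\<Sum>i<DIM('a) - 1. (ln (a i) - ln (a (Suc i))) * indicat_real (?U i) v) \<le> ln (a j)" by simp
  have "d * a j \<le> a j * \<bar>v \<bullet> e j\<bar>" using j a(1)[of j] by (simp add: mult.commute)
  also have "\<dots> \<le> 2 ^ DIM('a) * support_of p v" by (rule low[OF j(1)])
  finally have "d / 2 ^ DIM('a) * a j \<le> support_of p v" by (simp add: field_simps)
  moreover have "0 < d / 2 ^ DIM('a) * a j" using d a j by simp
  ultimately have "ln (d / 2 ^ DIM('a) * a j) \<le> ln (support_of p v)" by (intro ln_mono) auto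
  thus ?thesis using 1 d(1) a(1)[OF j(1)] ln_mult[of "d / 2 ^ DIM('a)" "a j"] by simp
qed

text \<open>Both terms of the functional are expanded in the nonnegative differences
  \<open>D i = ln (a i) - ln (a (Suc i))\<close>. The volume contributes the coefficient
  \<open>- (g i - d / 2)\<close> and the integral at most \<open>g i - d\<close>; the thresholds
  \<open>g i\<close> and the scale \<open>ln (a 0)\<close> cancel, and \<open>- d / 2\<close> times
  the sum of the \<open>D i\<close> is left.\<close>

lemma minkowski_functional_bound:
  fixes \<mu> :: "'a::euclidean_space measure"
  assumes q: "0 < q" "q < real DIM('a)"
    and w: "continuous_on (sphere 0 1) w" "\<And>u. norm u = 1 \<Longrightarrow> 0 < w u"
    and M: "sets \<mu> = sets sphere_borel" "finite_measure \<mu>" "0 < measure \<mu> (sphere 0 1)"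
    and lt: "\<And>i (\<xi> :: 'a set). i \<in> {1..DIM('a) - 1} \<Longrightarrow> subspace \<xi> \<Longrightarrow> dim \<xi> = i \<Longrightarrow>
      measure \<mu> (sphere 0 1 \<inter> \<xi>) / measure \<mu> (sphere 0 1) < min (real i / q) 1"
  obtains C \<epsilon> k where "0 < \<epsilon>" "0 < k"
    "\<And>p. admissible p \<Longrightarrow> \<exists>a b. 0 < b \<and> b \<le> a \<and> (\<forall>x\<in>body_of p. norm x \<le> a) \<and>
        (\<forall>v. norm v = 1 \<longrightarrow> b \<le> k * support_of p v) \<and>
        minkowski_functional q w \<mu> (\<lambda>v. 1 / support_of p v) \<le> C - \<epsilon> * ln (a / b)"
proof -
  let ?n = "DIM('a)" and ?m = "measure \<mu> (sphere 0 1)"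
  interpret finite_measure \<mu> by (rule M)
  obtain d where d: "0 < d" "d \<le> 1 / real ?n" "d \<le> 1 / 2" and gap:
    "\<And>e i. orthonormal_frame ?n e \<Longrightarrow> i \<in> {1..?n - 1} \<Longrightarrow>
       measure \<mu> {v \<in> sphere 0 1. \<forall>l<i. \<bar>v \<bullet> e l\<bar> < d} \<le> (min (real (?n - i) / q) 1 - d) * ?m"
    using uniform_mass_gap[OF M lt] by blast
  \<comment> \<open>Half of the gap \<open>d\<close> is spent on keeping the exponents inside (0,
    1); the other half survives as the final \<epsilon>.\<close>
  obtain s where s: "\<And>i. i < ?n \<Longrightarrow> 0 < s i \<and> s i < 1" "(\<Sum>i<?n. s i) = q"
    "\<And>i. i \<le> ?n \<Longrightarrow> min (real (?n - i)) q - d / 2 * q \<le> (\<Sum>l\<in>{i..<?n}. s l)"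
    using greedy_exponents[OF q, of "d / 2"] d by auto
  obtain B where B: "0 < B" "\<And>e :: nat \<Rightarrow> 'a. orthonormal_frame ?n e \<Longrightarrow>
     (\<integral>\<^sup>+u. (\<Prod>i<?n. singular_factor (s i) (u \<bullet> e i)) \<partial>surface_measure) \<le> ennreal B"
    using singular_prod_bound[where 'a='a and s=s, OF s(1)] by blast
  obtain W where W: "0 < W" "\<And>u. norm u = 1 \<Longrightarrow> w u \<le> W"
  proof -
    obtain z where z: "z \<in> sphere 0 1" "\<forall>y\<in>sphere 0 1. w y \<le> w z"
      using continuous_attains_sup[OF compact_sphere sphere_ne w(1)] by blast
    show ?thesis using z w(2)[of z] by (intro that[of "w z"]) auto
  qed
  define C where "C = ln (W * B) / q - ln (d / 2 ^ ?n)"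
  show ?thesis
  proof (rule that[of "d / 2" "2 ^ ?n * real ?n" C])
    fix p :: "'a \<Rightarrow> real" assume p: "admissible p"
    obtain r where r: "0 < r" "cball 0 r \<subseteq> body_of p" using body_of_contains_ball[OF p] .
    obtain e a where e: "orthonormal_frame ?n e" and a0: "\<And>i. i < ?n \<Longrightarrow> 0 < (a i :: real)"
      and amono: "\<And>i j. i \<le> j \<Longrightarrow> j < ?n \<Longrightarrow> a j \<le> a i"
      and box: "\<And>x i. x \<in> body_of p \<Longrightarrow> i < ?n \<Longrightarrow> \<bar>x \<bullet> e i\<bar> \<le> a i"
      and nrm: "\<And>x. x \<in> body_of p \<Longrightarrow> norm x \<le> a 0"
      and low0: "\<And>v M i. (\<And>x. x \<in> body_of p \<Longrightarrow> \<bar>x \<bullet> v\<bar> \<le> M) \<Longrightarrow> i < ?n \<Longrightarrow> a i * \<bar>v \<bullet> e i\<bar> \<le> 2 ^ ?n * M"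
      using box_frame[OF compact_body_of[OF p] r] by blast
    have low: "a i * \<bar>v \<bullet> e i\<bar> \<le> 2 ^ ?n * support_of p v" if "i < ?n" for v i
      by (rule low0[OF support_of_abs_ge[OF p] that])
    define N where "N = ?n - 1"
    have N: "?n = Suc N" by (simp add: N_def)
    define L where "L i = ln (a i)" for i
    define D where "D i = L i - L (Suc i)" for i
    \<comment> \<open>The shift by one matters: \<open>D i\<close> is paired with vectors nearly
      orthogonal to \<open>e 0, ..., e i\<close>, a complement of dimension
      \<open>?n - Suc i\<close>.\<close>
    define g where "g i = min (real (?n - Suc i) / q) 1" for i
    have D: "0 \<le> D i" if "i < N" for i
      using amono[of i "Suc i"] a0[of "Suc i"] that by (simp add: D_def L_def N ln_mono)
    have Dsum: "(\<Sum>i<N. D i) = L 0 - L N" unfolding D_def by (rule sum_lessThan_telescope')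
    define U where "U i = {v \<in> sphere 0 1. \<forall>l<Suc i. \<bar>v \<bullet> e l\<bar> < d}" for i
    have lnV: "ln (volume_of q w p) / q \<le> ln (W * B) / q + L 0 - (\<Sum>i<N. D i * (g i - d / 2))"
    proof -
      have V: "volume_of q w p \<le> W * (\<Prod>i<?n. a i powr s i) * B"
      proof (rule volume_of_le_box[OF p w(1) _ _ s(2) a0 box _ B(2)[OF e]])
      qed (use s(1) W(2) w(2) B(1) in \<open>auto intro: less_imp_le\<close>)
      have P: "0 < (\<Prod>i<?n. a i powr s i)" using a0 by (intro prod_pos) (auto dest: a0)
      have *: "ln (W * x * B) = ln (W * B) + ln x" if "0 < x" for x
        using that W(1) B(1) by (simp add: ln_mult)
      have "ln (volume_of q w p) \<le> ln (W * (\<Prod>i<?n. a i powr s i) * B)"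
        using V volume_of_pos[OF p w, of q] by (intro ln_mono) auto
      also have "\<dots> = ln (W * B) + ln (\<Prod>i<?n. a i powr s i)"
        by (rule *[OF P])
      also have "ln (\<Prod>i<?n. a i powr s i) = (\<Sum>i<?n. s i * L i)"
        using a0 by (subst ln_prod) (auto simp: L_def ln_powr dest: a0)
      \<comment> \<open>Abel summation trades the individual exponents for their tail sums, the
        quantities that are comparable with masses near subspaces; the signs of the
        \<open>D i\<close> then permit termwise estimates.\<close>
      also have "\<dots> = q * L 0 - (\<Sum>i<N. D i * (\<Sum>l\<in>{Suc i..<?n}. s l))"
        unfolding N D_def using abel_summation[of s L N] s(2) by (simp add: N)
      also have "\<dots> \<le> q * L 0 - (\<Sum>i<N. D i * (q * (g i - d / 2)))"
      proof -
        have "q * (g i - d / 2) \<le> (\<Sum>l\<in>{Suc i..<?n}. s l)" if "i < N" for i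
        proof -
          have "q * g i = min (real (?n - Suc i)) q"
            using q min_mult_distrib_left[of q "real (?n - Suc i) / q" 1] by (simp add: g_def)
          thus ?thesis using s(3)[of "Suc i"] that N by (simp add: right_diff_distrib mult.commute)
        qed
        thus ?thesis by (intro diff_left_mono sum_mono mult_left_mono D) auto
      qed
      also have "(\<Sum>i<N. D i * (q * (g i - d / 2))) = q * (\<Sum>i<N. D i * (g i - d / 2))"
        by (simp add: sum_distrib_left algebra_simps)
      finally have "ln (volume_of q w p) \<le> q * (ln (W * B) / q + L 0 - (\<Sum>i<N. D i * (g i - d / 2)))"
        using q by (simp add: algebra_simps)
      thus ?thesis using q by (simp add: pos_divide_le_eq mult.commute)
    qed
    have lnh: "ln (d / 2 ^ ?n) + L 0 - (\<Sum>i<N. D i * (g i - d)) \<le> (\<integral>v. ln (support_of p v) \<partial>\<mu>) / ?m"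
    proof -
      have gapi: "measure \<mu> (U i) \<le> (g i - d) * ?m" if "i \<in> {..<N}" for i
        unfolding g_def U_def by (rule gap[OF e]) (use that N in auto)
      have U: "U i \<in> sets \<mu>" for i unfolding U_def by (rule near_subspace_sets[OF M(1)])
      have UI: "integrable \<mu> (\<lambda>v. D i * indicat_real (U i) v)" for i
        using U by (intro integrable_mult_right integrable_real_indicator) (auto simp: less_top[symmetric])
      have "(ln (d / 2 ^ ?n) + L 0) * ?m - (\<Sum>i<N. D i * ((g i - d) * ?m)) \<le>
        (ln (d / 2 ^ ?n) + L 0) * ?m - (\<Sum>i<N. D i * measure \<mu> (U i))"
        by (intro diff_left_mono sum_mono mult_left_mono D gapi) auto
      also have "\<dots> = (\<integral>v. (ln (d / 2 ^ ?n) + L 0) - (\<Sum>i<N. D i * indicat_real (U i) v) \<partial>\<mu>)"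
      proof -
        have "(\<integral>v. (\<Sum>i<N. D i * indicat_real (U i) v) \<partial>\<mu>) = (\<Sum>i<N. D i * measure \<mu> (U i))"
          by (subst Bochner_Integration.integral_sum[OF UI])
            (simp add: Int_absorb2[OF sets.sets_into_space[OF U]])
        thus ?thesis using UI sphere_in_sets[OF M(1)]
          by (subst Bochner_Integration.integral_diff[OF _ Bochner_Integration.integrable_sum[OF UI]]) (simp_all del: sum_mult_indicator)
      qed
      also have "\<dots> \<le> (\<integral>v. ln (support_of p v) \<partial>\<mu>)"
      proof (rule integral_mono)
        show "integrable \<mu> (\<lambda>v. (ln (d / 2 ^ ?n) + L 0) - (\<Sum>i<N. D i * indicat_real (U i) v))"
          using UI by (intro Bochner_Integration.integrable_diff Bochner_Integration.integrable_sum) auto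
        have "continuous_on (sphere 0 1) (\<lambda>v. - ln (1 / support_of p v))"
          by (intro continuous_intros continuous_on_ln_admissible[OF admissible_inverse_support[OF p]])
        hence "continuous_on (sphere 0 1) (\<lambda>v. ln (support_of p v))"
          by (rule continuous_on_eq) (use support_of_pos[OF p] in \<open>simp add: ln_div\<close>)
        thus "integrable \<mu> (\<lambda>v. ln (support_of p v))" by (intro integrable_on_sphere M)
        fix v assume "v \<in> space \<mu>"
        hence v: "norm v = 1" using sphere_in_sets[OF M(1)] by simp
        show "(ln (d / 2 ^ ?n) + L 0) - (\<Sum>i<N. D i * indicat_real (U i) v) \<le> ln (support_of p v)"
          using ln_support_lower_bound[OF p e a0 amono low d(1,2) v] by (simp add: L_def D_def N_def U_def)
      qed
      finally have "(ln (d / 2 ^ ?n) + L 0 - (\<Sum>i<N. D i * (g i - d))) * ?m \<le> (\<integral>v. ln (support_of p v) \<partial>\<mu>)"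
        by (simp add: left_diff_distrib sum_distrib_right mult.assoc)
      thus ?thesis using M(3) by (simp add: pos_le_divide_eq)
    qed
    have "(\<integral>v. ln (1 / support_of p v) \<partial>\<mu>) = (\<integral>v. - ln (support_of p v) \<partial>\<mu>)"
      using sphere_in_sets[OF M(1)] support_of_pos[OF p]
      by (intro Bochner_Integration.integral_cong) (auto simp: ln_div)
    hence "minkowski_functional q w \<mu> (\<lambda>v. 1 / support_of p v) =
       ln (volume_of q w p) / q - (\<integral>v. ln (support_of p v) \<partial>\<mu>) / ?m"
      by (simp add: minkowski_functional_def volume_of_def gauge_of_inverse_support[OF p])
    also have "\<dots> \<le> C - (\<Sum>i<N. D i * (g i - d / 2)) + (\<Sum>i<N. D i * (g i - d))"
      using lnV lnh unfolding C_def by linarith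
    also have "\<dots> = C - (\<Sum>i<N. D i) * (d / 2)"
    proof -
      have "(\<Sum>i<N. D i * (g i - d / 2)) - (\<Sum>i<N. D i * (g i - d)) = (\<Sum>i<N. D i) * (d / 2)"
        unfolding sum_subtractf[symmetric] sum_distrib_right
        by (intro sum.cong) (auto simp: field_simps)
      thus ?thesis by linarith
    qed
    finally have J: "minkowski_functional q w \<mu> (\<lambda>v. 1 / support_of p v) \<le> C - d / 2 * ln (a 0 / a N)"
      using a0[of 0] a0[of N] by (simp add: Dsum L_def ln_div N mult.commute)
    \<comment> \<open>Some frame coordinate of \<open>v\<close> is at least \<open>1 / ?n\<close>,
      and \<open>a N\<close> is the shortest half side.\<close>
    have b: "a N \<le> 2 ^ ?n * real ?n * support_of p v" if v: "norm v = 1" for v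
    proof -
      obtain i where i: "i < ?n" "1 / real ?n \<le> \<bar>v \<bullet> e i\<bar>" using orthonormal_frame_large_coordinate[OF e v] by blast
      have "a N * (1 / real ?n) \<le> a i * \<bar>v \<bullet> e i\<bar>"
        using i amono[of i N] a0[OF i(1)] N by (intro mult_mono) auto
      also have "\<dots> \<le> 2 ^ ?n * support_of p v" by (rule low[OF i(1)])
      finally show ?thesis by (simp add: field_simps)
    qed
    show "\<exists>a b. 0 < b \<and> b \<le> a \<and> (\<forall>x\<in>body_of p. norm x \<le> a) \<and>
        (\<forall>v. norm v = 1 \<longrightarrow> b \<le> 2 ^ ?n * real ?n * support_of p v) \<and>
        minkowski_functional q w \<mu> (\<lambda>v. 1 / support_of p v) \<le> C - d / 2 * ln (a / b)"
      using a0[of N] amono[of 0 N] nrm b J N by (intro exI[of _ "a 0"] exI[of _ "a N"]) auto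
  qed (use d in auto)
qed

section \<open>Existence of a maximizer\<close>

lemma gauge_of_tendsto:
  fixes p :: "'a::euclidean_space \<Rightarrow> real"
  assumes P: "\<And>k. admissible (P k)" and p: "admissible p"
    and unif: "\<And>e. 0 < e \<Longrightarrow> \<forall>\<^sub>F k in sequentially. \<forall>v. norm v = 1 \<longrightarrow> \<bar>P k v - p v\<bar> \<le> e"
  shows "(\<lambda>k. gauge_of (P k) x) \<longlonglongrightarrow> gauge_of p x"
proof (rule tendstoI)
  have le: "gauge_of p1 x \<le> gauge_of p2 x + e * norm x"
    if "admissible p1" "admissible p2" "\<And>v. norm v = 1 \<Longrightarrow> \<bar>p1 v - p2 v\<bar> \<le> e" for p1 p2 :: "'a \<Rightarrow> real" and e
  proof (rule gauge_of_le)
    fix v :: 'a assume v: "norm v = 1"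
    have "(p1 v - p2 v) * (x \<bullet> v) \<le> \<bar>p1 v - p2 v\<bar> * \<bar>x \<bullet> v\<bar>" by (metis abs_ge_self abs_mult)
    also have "\<dots> \<le> e * norm x"
      using that(3)[OF v] Cauchy_Schwarz_ineq2[of x v] v by (intro mult_mono) auto
    finally show "p1 v * (x \<bullet> v) \<le> gauge_of p2 x + e * norm x"
      using gauge_of_ge[OF that(2) v, of x] by (simp add: left_diff_distrib)
  qed
  fix e :: real assume e: "0 < e"
  define d where "d = e / (norm x + 1)"
  have pos: "0 < norm x + 1" using norm_ge_zero[of x] by linarith
  have d: "0 < d" using e pos by (simp add: d_def)
  have "d * norm x < d * (norm x + 1)" using d by (intro mult_strict_left_mono) auto
  also have "\<dots> = e" using pos by (simp add: d_def)
  finally have de: "d * norm x < e" .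
  show "\<forall>\<^sub>F k in sequentially. dist (gauge_of (P k) x) (gauge_of p x) < e"
    using unif[OF d]
  proof eventually_elim
    case (elim k)
    have "gauge_of (P k) x \<le> gauge_of p x + d * norm x" using elim by (intro le P p) auto
    moreover have "gauge_of p x \<le> gauge_of (P k) x + d * norm x"
      using elim by (intro le P p) (auto simp: abs_minus_commute)
    ultimately show ?case using de by (simp add: dist_real_def)
  qed
qed

lemma gauge_power_bound:
  assumes p: "admissible p" and c: "0 < c" "\<And>v. norm v = 1 \<Longrightarrow> c \<le> p v" and q: "0 \<le> q" and u: "norm u = 1"
  shows "gauge_of p u powr (- q) \<le> c powr (- q)"
proof -
  have "c \<le> gauge_of p u" using gauge_of_lower[OF p c(2), of u] u by simp
  thus ?thesis using c q by (intro powr_mono2') auto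
qed

text \<open>The common bounds \<open>c\<close> and \<open>B\<close> keep gauges and logarithms away
  from their singularities and so dominate both integrands.\<close>

lemma minkowski_functional_tendsto:
  fixes p w :: "'a::euclidean_space \<Rightarrow> real"
  assumes P: "\<And>k. admissible (P k)" and p: "admissible p"
    and unif: "\<And>e. 0 < e \<Longrightarrow> \<forall>\<^sub>F k in sequentially. \<forall>v. norm v = 1 \<longrightarrow> \<bar>P k v - p v\<bar> \<le> e"
    and c: "0 < c" "\<And>k v. norm v = 1 \<Longrightarrow> c \<le> P k v \<and> P k v \<le> B"
    and q: "0 < q"
    and w: "continuous_on (sphere 0 1) w" "\<And>u. norm u = 1 \<Longrightarrow> 0 < w u"
    and M: "sets \<mu> = sets sphere_borel" "finite_measure \<mu>"
  shows "(\<lambda>k. minkowski_functional q w \<mu> (P k)) \<longlonglongrightarrow> minkowski_functional q w \<mu> p"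
proof -
  interpret finite_measure \<mu> by (rule M)
  have V: "(\<lambda>k. volume_of q w (P k)) \<longlonglongrightarrow> volume_of q w p"
    unfolding volume_of_def
  proof (rule integral_dominated_convergence)
    show "integrable surface_measure (\<lambda>u. c powr (- q) * w u)"
      by (intro integrable_on_sphere sets_surface_measure finite_measure_surface_measure continuous_intros w)
    show "AE u in surface_measure. (\<lambda>k. gauge_of (P k) u powr (- q) * w u) \<longlonglongrightarrow> gauge_of p u powr (- q) * w u"
    proof (rule AE_I2)
      fix u :: 'a assume "u \<in> space surface_measure"
      hence "gauge_of p u \<noteq> 0" using gauge_of_pos[OF p, of u] by force
      thus "(\<lambda>k. gauge_of (P k) u powr (- q) * w u) \<longlonglongrightarrow> gauge_of p u powr (- q) * w u"
        by (intro tendsto_intros gauge_of_tendsto[OF P p unif]) auto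
    qed
    show "AE u in surface_measure. norm (gauge_of (P k) u powr (- q) * w u) \<le> c powr (- q) * w u" for k
    proof (rule AE_I2)
      fix u :: 'a assume "u \<in> space surface_measure"
      hence u: "norm u = 1" by simp
      show "norm (gauge_of (P k) u powr (- q) * w u) \<le> c powr (- q) * w u"
        using gauge_power_bound[OF P c(1), of k q u] c(2) q w(2)[OF u] u by (auto simp: abs_mult intro!: mult_right_mono)
    qed
  qed (intro measurable_on_sphere[OF sets_surface_measure] continuous_on_volume_integrand P p w)+
  have lim: "(\<lambda>k. P k v) \<longlonglongrightarrow> p v" if v: "norm v = 1" for v
  proof (rule tendstoI)
    fix e :: real assume "0 < e"
    hence "\<forall>\<^sub>F k in sequentially. \<forall>v. norm v = 1 \<longrightarrow> \<bar>P k v - p v\<bar> \<le> e / 2" by (intro unif) simp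
    thus "\<forall>\<^sub>F k in sequentially. dist (P k v) (p v) < e"
      by eventually_elim (use v \<open>0 < e\<close> in \<open>fastforce simp: dist_real_def\<close>)
  qed
  have L: "(\<lambda>k. \<integral>v. ln (P k v) \<partial>\<mu>) \<longlonglongrightarrow> (\<integral>v. ln (p v) \<partial>\<mu>)"
  proof (rule integral_dominated_convergence)
    show "integrable \<mu> (\<lambda>v. \<bar>ln c\<bar> + \<bar>ln B\<bar>)" by simp
    show "AE v in \<mu>. (\<lambda>k. ln (P k v)) \<longlonglongrightarrow> ln (p v)"
    proof (rule AE_I2)
      fix v assume "v \<in> space \<mu>"
      hence v: "norm v = 1" using sphere_in_sets[OF M(1)] by simp
      hence "p v \<noteq> 0" using p by (force simp: admissible_def)
      thus "(\<lambda>k. ln (P k v)) \<longlonglongrightarrow> ln (p v)" by (intro tendsto_ln lim[OF v])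
    qed
    show "AE v in \<mu>. norm (ln (P k v)) \<le> \<bar>ln c\<bar> + \<bar>ln B\<bar>" for k
    proof (rule AE_I2)
      fix v assume "v \<in> space \<mu>"
      hence v: "norm v = 1" using sphere_in_sets[OF M(1)] by simp
      have "ln c \<le> ln (P k v)" "ln (P k v) \<le> ln B" using c(1) c(2)[OF v, of k] by (auto intro!: ln_mono)
      thus "norm (ln (P k v)) \<le> \<bar>ln c\<bar> + \<bar>ln B\<bar>"
        unfolding real_norm_def by linarith
    qed
  qed (intro measurable_on_sphere[OF M(1)] continuous_on_ln_admissible P p)+
  show ?thesis
    unfolding minkowski_functional_def divide_inverse
    using volume_of_pos[OF p w, of q] by (intro tendsto_intros V L) auto
qed

lemma admissible_one: "admissible (\<lambda>_. 1)"
  by (auto simp: admissible_def)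

text \<open>An almost optimal \<open>p\<close> may oscillate arbitrarily, but its improvement
  \<open>1 / support_of p\<close> does not: after scaling, the support functions are Lipschitz with
  constant 1 and bounded above by 1 on the sphere, and the bound on the functional keeps them away
  from 0. Compactness is therefore applied to the support functions and not to the \<open>p\<close>
  themselves.\<close>

lemma maximizer_exists:
  fixes \<mu> :: "'a::euclidean_space measure"
  assumes q: "0 < q" "q < real DIM('a)"
    and w: "continuous_on (sphere 0 1) w" "\<And>u. norm u = 1 \<Longrightarrow> 0 < w u"
    and M: "sets \<mu> = sets sphere_borel" "finite_measure \<mu>" "0 < measure \<mu> (sphere 0 1)"
    and lt: "\<And>i (\<xi> :: 'a set). i \<in> {1..DIM('a) - 1} \<Longrightarrow> subspace \<xi> \<Longrightarrow> dim \<xi> = i \<Longrightarrow>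
      measure \<mu> (sphere 0 1 \<inter> \<xi>) / measure \<mu> (sphere 0 1) < min (real i / q) 1"
  obtains p where "admissible p"
    "\<And>p'. admissible p' \<Longrightarrow> minkowski_functional q w \<mu> p' \<le> minkowski_functional q w \<mu> p"
proof -
  let ?J = "minkowski_functional q w \<mu>"
  obtain C \<epsilon> k :: real where \<epsilon>: "0 < \<epsilon>" "0 < (k::real)" and bound:
    "\<And>p. admissible p \<Longrightarrow> \<exists>a b. 0 < b \<and> b \<le> a \<and> (\<forall>x\<in>body_of p. norm x \<le> a) \<and>
        (\<forall>v. norm v = 1 \<longrightarrow> b \<le> k * support_of p v) \<and> ?J (\<lambda>v. 1 / support_of p v) \<le> C - \<epsilon> * ln (a / b)"
  proof (rule minkowski_functional_bound[OF q w M lt])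
    fix C \<epsilon> k :: real
    assume "0 < \<epsilon>" "0 < k"
      "\<And>p. admissible p \<Longrightarrow> \<exists>a b. 0 < b \<and> b \<le> a \<and> (\<forall>x\<in>body_of p. norm x \<le> a) \<and>
        (\<forall>v. norm v = 1 \<longrightarrow> b \<le> k * support_of p v) \<and> ?J (\<lambda>v. 1 / support_of p v) \<le> C - \<epsilon> * ln (a / b)"
    thus thesis by (rule that)
  qed
  have leC: "?J p \<le> C" if p: "admissible p" for p
  proof -
    obtain a b where "0 < b" "b \<le> a" "?J (\<lambda>v. 1 / support_of p v) \<le> C - \<epsilon> * ln (a / b)"
      using bound[OF p] by blast
    moreover from this have "0 \<le> \<epsilon> * ln (a / b)" using \<epsilon> by (intro mult_nonneg_nonneg) auto
    ultimately show ?thesis using minkowski_functional_le_inverse_support[OF p M(1,2), of q w] by linarith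
  qed
  define s where "s = (SUP p\<in>Collect admissible. ?J p)"
  have bdd: "bdd_above (?J ` Collect admissible)" using leC by (auto intro!: bdd_aboveI[of _ C])
  have ne: "Collect admissible \<noteq> ({} :: ('a \<Rightarrow> real) set)" using admissible_one by blast
  have les: "?J p \<le> s" if "admissible p" for p
    unfolding s_def using that by (intro cSUP_upper bdd) auto
  \<comment> \<open>For a value of the functional above \<open>s - 1\<close> the upper bound gives
    \<open>\<epsilon> * ln (a / b) \<le> C - s + 1\<close>, hence a lower bound for
    \<open>b / a\<close>; the factor \<open>k\<close> passes from \<open>b\<close> to the support
    function.\<close>
  define c where "c = exp (- ((C - s + 1) / \<epsilon>)) / k"
  have c: "0 < c" using \<epsilon> by (simp add: c_def)
  define R where "R j H \<longleftrightarrow> admissible (\<lambda>v. 1 / H v) \<and> s - 1 / real (Suc j) \<le> ?J (\<lambda>v. 1 / H v) \<and>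
     (\<forall>v. norm v = 1 \<longrightarrow> c \<le> H v \<and> H v \<le> 1) \<and> (\<forall>v w. \<bar>H v - H w\<bar> \<le> norm (v - w))" for j H
  have "\<forall>j. \<exists>H. R j H"
  proof
    fix j
    have "s - 1 / real (Suc j) < s" by simp
    then obtain p where p: "admissible p" "s - 1 / real (Suc j) < ?J p"
      using less_cSUP_iff[OF ne bdd] unfolding s_def by blast
    obtain a b where ab: "0 < b" "b \<le> a" "\<And>x. x \<in> body_of p \<Longrightarrow> norm x \<le> a"
      "\<And>v. norm v = 1 \<Longrightarrow> b \<le> k * support_of p v" "?J (\<lambda>v. 1 / support_of p v) \<le> C - \<epsilon> * ln (a / b)"
      using bound[OF p(1)] by blast
    have a: "0 < a" using ab by simp
    \<comment> \<open>The body lies in the ball of radius \<open>a\<close>, so dividing by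
      \<open>a\<close> makes both the upper bound and the Lipschitz constant equal to 1, while scale
      invariance leaves the functional unchanged.\<close>
    define H where "H v = support_of p v / a" for v
    have eq: "(\<lambda>v. 1 / H v) = (\<lambda>v. a * (1 / support_of p v))" by (simp add: H_def)
    have Jp: "?J p \<le> ?J (\<lambda>v. 1 / support_of p v)" by (rule minkowski_functional_le_inverse_support[OF p(1) M(1,2)])
    have "\<epsilon> * ln (a / b) \<le> C - s + 1"
    proof -
      have "1 / real (Suc j) \<le> 1" by simp
      thus ?thesis using ab(5) Jp p(2) by linarith
    qed
    hence "ln (a / b) \<le> (C - s + 1) / \<epsilon>" using \<epsilon> by (simp add: pos_le_divide_eq mult.commute)
    hence "a / b \<le> exp ((C - s + 1) / \<epsilon>)" using a ab(1) using exp_le_cancel_iff[of "ln (a / b)"] by simp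
    hence ratio: "exp (- ((C - s + 1) / \<epsilon>)) \<le> b / a"
      using a ab(1) by (simp add: exp_minus field_simps)
    have "c \<le> H v \<and> H v \<le> 1" if v: "norm v = 1" for v
    proof
      have "c * k \<le> b / a" using ratio \<epsilon> by (simp add: c_def)
      also have "\<dots> \<le> k * support_of p v / a" using ab(4)[OF v] a by (intro divide_right_mono) auto
      finally have "c * k \<le> H v * k" by (simp add: H_def mult.commute)
      thus "c \<le> H v" using \<epsilon> by simp
      have "support_of p v \<le> a"
      proof (rule support_of_le)
        fix x assume "x \<in> body_of p"
        thus "x \<bullet> v \<le> a" using ab(3)[of x] norm_cauchy_schwarz[of x v] v by simp
      qed
      thus "H v \<le> 1" using a by (simp add: H_def)
    qed
    moreover have "\<bar>H v - H w\<bar> \<le> norm (v - w)" for v w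
      using support_of_lipschitz[OF p(1) ab(3), of v w] a
      by (simp add: H_def diff_divide_distrib[symmetric] abs_divide pos_divide_le_eq mult.commute)
    moreover have "admissible (\<lambda>v. 1 / H v)" unfolding eq
      by (rule admissible_scale[OF admissible_inverse_support[OF p(1)] a])
    moreover have "s - 1 / real (Suc j) \<le> ?J (\<lambda>v. 1 / H v)" unfolding eq
      using minkowski_functional_scale[OF admissible_inverse_support[OF p(1)] a q(1) w M] Jp p(2) by simp
    ultimately show "\<exists>H. R j H" unfolding R_def by blast
  qed
  then obtain H where "\<And>j. R j (H j)" by metis
  hence HA: "\<And>j. admissible (\<lambda>v. 1 / H j v)"
    and HJ: "\<And>j. s - 1 / real (Suc j) \<le> ?J (\<lambda>v. 1 / H j v)"
    and Hb: "\<And>j v. norm v = 1 \<Longrightarrow> c \<le> H j v \<and> H j v \<le> 1"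
    and HL: "\<And>j v w. \<bar>H j v - H j w\<bar> \<le> norm (v - w)"
    unfolding R_def by blast+
  obtain g r where g: "continuous_on (sphere 0 1) g" and r: "strict_mono (r :: nat \<Rightarrow> nat)"
    and conv: "\<And>e. 0 < e \<Longrightarrow> \<exists>N. \<forall>n x. n \<ge> N \<and> x \<in> sphere 0 1 \<longrightarrow> norm (H (r n) x - g x) < e"
  proof (rule Arzela_Ascoli[of "sphere (0::'a) 1" H 1])
    show "norm (H n x) \<le> 1" if "x \<in> sphere 0 1" for n x using Hb[of x n] that c by auto
    show "\<exists>d>0. \<forall>n y. y \<in> sphere 0 1 \<and> norm (x - y) < d \<longrightarrow> norm (H n x - H n y) < e" if "0 < e" for x e
      using that HL by (intro exI[of _ e]) (auto intro: le_less_trans)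
  next
    fix g and r :: "nat \<Rightarrow> nat"
    assume "continuous_on (sphere 0 1) g" "strict_mono r"
      "\<And>e. 0 < e \<Longrightarrow> \<exists>N. \<forall>n x. n \<ge> N \<and> x \<in> sphere 0 1 \<longrightarrow> norm (H (r n) x - g x) < e"
    thus thesis by (rule that)
  qed simp
  have lim: "(\<lambda>n. H (r n) v) \<longlonglongrightarrow> g v" if "norm v = 1" for v
    using conv that by (intro LIMSEQ_I) force
  have gb: "c \<le> g v" "g v \<le> 1" if v: "norm v = 1" for v
    using Hb[OF v] by (auto intro!: LIMSEQ_le_const[OF lim[OF v]] LIMSEQ_le_const2[OF lim[OF v]])
  define p where "p v = 1 / g v" for v
  have p: "admissible p"
    unfolding admissible_def
  proof (intro conjI ballI)
    show "continuous_on (sphere 0 1) p" unfolding p_def using gb c g by (intro continuous_intros) force+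
    fix v :: 'a assume "v \<in> sphere 0 1"
    hence v: "norm v = 1" by simp
    show "0 < p v" using gb(1)[OF v] c by (simp add: p_def)
    have "H j (- v) = H j v" for j using HA[of j] v by (auto simp: admissible_def)
    hence "g (- v) = g v" using lim[OF v] lim[of "- v"] v by (auto intro: LIMSEQ_unique)
    thus "p (- v) = p v" by (simp add: p_def)
  qed
  have "(\<lambda>n. ?J (\<lambda>v. 1 / H (r n) v)) \<longlonglongrightarrow> ?J p"
  proof (rule minkowski_functional_tendsto[OF HA p _ _ _ q(1) w M(1,2)])
    show "(1::real) > 0" by simp
    show "1 \<le> 1 / H (r n) v \<and> 1 / H (r n) v \<le> 1 / c" if "norm v = 1" for n v
      using Hb[OF that, of "r n"] c by (auto simp: field_simps)
    fix e :: real assume e: "0 < e"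
    \<comment> \<open>Reciprocals of numbers at least \<open>c\<close> differ by at most their
      difference divided by \<open>c * c\<close>.\<close>
    have "0 < e * c * c" using e c by simp
    from conv[OF this] obtain N where N: "\<And>n x. n \<ge> N \<Longrightarrow> norm x = 1 \<Longrightarrow> \<bar>H (r n) x - g x\<bar> < e * c * c" by auto
    have "\<bar>1 / H (r n) v - p v\<bar> \<le> e" if n: "N \<le> n" and v: "norm v = 1" for n v
    proof -
      have H: "c \<le> H (r n) v" "c \<le> g v" using Hb[OF v] gb(1)[OF v] by auto
      have "1 / H (r n) v - p v = (g v - H (r n) v) / (H (r n) v * g v)"
        using H c by (simp add: p_def field_simps)
      hence "\<bar>1 / H (r n) v - p v\<bar> = \<bar>H (r n) v - g v\<bar> / (H (r n) v * g v)"
        using H c by (simp add: abs_divide abs_mult abs_minus_commute)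
      also have "\<dots> \<le> (e * c * c) / (c * c)"
        using H c N[OF n v] by (intro frac_le mult_mono mult_pos_pos) auto
      finally show ?thesis using c by simp
    qed
    thus "\<forall>\<^sub>F n in sequentially. \<forall>v. norm v = 1 \<longrightarrow> \<bar>1 / H (r n) v - p v\<bar> \<le> e"
      unfolding eventually_sequentially by blast
  qed
  moreover have "(\<lambda>n. s - 1 / real (Suc (r n))) \<longlonglongrightarrow> s"
  proof -
    have "(\<lambda>n. 1 / real (Suc (r n))) \<longlonglongrightarrow> 0"
      using LIMSEQ_subseq_LIMSEQ[OF LIMSEQ_inverse_real_of_nat r] by (simp add: o_def inverse_eq_divide)
    from tendsto_diff[OF tendsto_const this, of s] show ?thesis by simp
  qed
  ultimately have "s \<le> ?J p" using HJ by (intro LIMSEQ_le[of "\<lambda>n. s - 1 / real (Suc (r n))"]) auto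
  thus ?thesis using les p that by (meson order_trans)
qed

section \<open>Directions with a unique normal\<close>

lemma emeasure_lborel_translate_vimage:
  assumes "A \<in> sets borel"
  shows "emeasure lborel ((+) c -` A) = emeasure lborel (A :: 'a::euclidean_space set)"
proof -
  have "emeasure lborel A = emeasure (distr lborel borel ((+) c)) A" by (simp add: lborel_distr_plus)
  thus ?thesis using assms by (simp add: emeasure_distr)
qed

text \<open>Infinitely many translates of a bounded part of \<open>A\<close> in direction \<open>e\<close> are disjoint and fit
  into one ball.\<close>

lemma null_if_meets_lines_once:
  fixes A :: "'a::euclidean_space set"
  assumes A: "A \<in> sets borel" and e: "norm e = 1"
    and once: "\<And>x t. 0 < t \<Longrightarrow> x \<in> A \<Longrightarrow> x + t *\<^sub>R e \<notin> A"
  shows "emeasure lborel A = 0"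
proof -
  have null: "emeasure lborel (A \<inter> cball 0 (real R)) = 0" for R :: nat
  proof (rule ccontr)
    let ?B = "A \<inter> cball 0 (real R)"
    assume c0: "emeasure lborel ?B \<noteq> 0"
    have fin: "emeasure lborel (cball (0::'a) (real R + 1)) < \<infinity>"
      by (rule emeasure_lborel_cball_finite)
    define T where "T k = (+) ((1 / real (Suc k)) *\<^sub>R e) -` ?B" for k
    have B: "?B \<in> sets borel" using A by auto
    have T: "T k \<in> sets lborel" for k
      unfolding T_def using measurable_sets_borel[OF _ B, of "(+) ((1 / real (Suc k)) *\<^sub>R e)"] by simp
    have eT: "emeasure lborel (T k) = emeasure lborel ?B" for k
      unfolding T_def by (rule emeasure_lborel_translate_vimage[OF B])
    have "T j \<inter> T k = {}" if "j < k" for j k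
    proof -
      have False if "x \<in> T j" "x \<in> T k" for x
      proof -
        define t where "t = 1 / real (Suc j) - 1 / real (Suc k)"
        have "0 < t" using \<open>j < k\<close> by (simp add: t_def frac_less2)
        moreover have "(1 / real (Suc k)) *\<^sub>R e + x \<in> A" using that by (simp add: T_def)
        ultimately have notin: "(1 / real (Suc k)) *\<^sub>R e + x + t *\<^sub>R e \<notin> A" by (rule once)
        have eq: "(1 / real (Suc k)) *\<^sub>R e + x + t *\<^sub>R e = (1 / real (Suc j)) *\<^sub>R e + x"
          by (simp add: t_def scaleR_diff_left)
        from notin have "(1 / real (Suc j)) *\<^sub>R e + x \<notin> A" unfolding eq .
        thus False using that(1) by (simp add: T_def)
      qed
      thus ?thesis by blast
    qed
    hence disj: "disjoint_family T" unfolding disjoint_family_on_def by (metis Int_commute nat_neq_iff)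
    have sub: "T k \<subseteq> cball 0 (real R + 1)" for k
    proof
      fix x assume "x \<in> T k"
      hence "norm ((1 / real (Suc k)) *\<^sub>R e + x) \<le> real R" by (simp add: T_def)
      moreover have "norm x \<le> norm ((1 / real (Suc k)) *\<^sub>R e + x) + norm ((1 / real (Suc k)) *\<^sub>R e)"
        by (metis add.commute add_diff_cancel_right' norm_triangle_ineq4)
      moreover have "norm ((1 / real (Suc k)) *\<^sub>R e) \<le> 1" using e by simp
      ultimately show "x \<in> cball 0 (real R + 1)" unfolding mem_cball_0 by linarith
    qed
    have "of_nat n * emeasure lborel ?B \<le> emeasure lborel (cball (0::'a) (real R + 1))" for n
    proof -
      have "of_nat n * emeasure lborel ?B = (\<Sum>k<n. emeasure lborel (T k))" by (simp add: eT)
      also have "\<dots> = emeasure lborel (\<Union>k<n. T k)"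
        using T disj by (intro sum_emeasure) (auto intro: disjoint_family_on_mono)
      also have "\<dots> \<le> emeasure lborel (cball (0::'a) (real R + 1))"
        using sub by (intro emeasure_mono) auto
      finally show ?thesis .
    qed note le = this
    from le[of 1] fin have "emeasure lborel ?B < \<infinity>" by (simp add: order.strict_trans1)
    then obtain b where b: "emeasure lborel ?B = ennreal b" "0 \<le> b" by (metis ennreal_cases infinity_ennreal_def less_irrefl)
    from fin obtain M where M: "emeasure lborel (cball (0::'a) (real R + 1)) = ennreal M" "0 \<le> M"
      by (metis ennreal_cases infinity_ennreal_def less_irrefl)
    have "0 < b" using b c0 by (cases "b = 0") auto
    then obtain n where "M < real n * b" using reals_Archimedean3 by blast
    moreover have "real n * b \<le> M"
      using le[of n] M b by (simp add: ennreal_of_nat_eq_real_of_nat ennreal_mult[symmetric])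
    ultimately show False by simp
  qed
  have "A = (\<Union>R::nat. A \<inter> cball 0 (real R))"
    using real_arch_simple by auto
  moreover have "emeasure lborel (\<Union>R::nat. A \<inter> cball 0 (real R)) = 0"
    using A null by (intro emeasure_UN_eq_0) auto
  ultimately show ?thesis by simp
qed

text \<open>Two distinct subgradients of the norm at \<open>x\<close> differ in some direction \<open>e\<close>, and rational
  numbers \<open>r < s\<close> between their values on \<open>e\<close> put \<open>x\<close> into the set defined next. Convexity of the
  norm along a line does not allow two such points on it, so these sets are null.\<close>

definition kink_set :: "('a::euclidean_space \<Rightarrow> real) \<Rightarrow> 'a \<Rightarrow> real \<Rightarrow> real \<Rightarrow> 'a set" where
  "kink_set p e r s = {x. \<forall>t>0. gauge_of p x + t * s \<le> gauge_of p (x + t *\<^sub>R e) \<and>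
                             gauge_of p x - t * r \<le> gauge_of p (x - t *\<^sub>R e)}"

definition singular_set :: "('a::euclidean_space \<Rightarrow> real) \<Rightarrow> 'a set" where
  "singular_set p = (\<Union>e\<in>Basis. \<Union>r\<in>\<rat>. \<Union>s\<in>{s\<in>\<rat>. r < s}. kink_set p e r s)"

lemma closed_kink_set:
  assumes "admissible p" shows "closed (kink_set p e r s)"
proof -
  have "kink_set p e r s = (\<Inter>t\<in>{0<..}. {x. gauge_of p x + t * s \<le> gauge_of p (x + t *\<^sub>R e)} \<inter>
      {x. gauge_of p x - t * r \<le> gauge_of p (x - t *\<^sub>R e)})"
    by (auto simp: kink_set_def)
  moreover have "continuous_on UNIV (\<lambda>x. gauge_of p (x + t *\<^sub>R e))" "continuous_on UNIV (\<lambda>x. gauge_of p (x - t *\<^sub>R e))" for t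
    by (rule continuous_on_compose2[OF continuous_on_gauge_of[OF assms, of UNIV]]; auto intro!: continuous_intros)+
  ultimately show ?thesis
    by (auto intro!: closed_INT closed_Int closed_Collect_le continuous_intros continuous_on_gauge_of[OF assms])
qed

lemma kink_set_null:
  assumes "admissible p" "norm e = 1" "r < s"
  shows "emeasure lborel (kink_set p e r s) = 0"
proof (rule null_if_meets_lines_once[OF borel_closed[OF closed_kink_set[OF assms(1)]] assms(2)])
  fix x t assume t: "0 < (t::real)" and x: "x \<in> kink_set p e r s"
  show "x + t *\<^sub>R e \<notin> kink_set p e r s"
  proof
    assume "x + t *\<^sub>R e \<in> kink_set p e r s"
    hence "gauge_of p (x + t *\<^sub>R e) - t * r \<le> gauge_of p x" using t by (force simp: kink_set_def)
    moreover have "gauge_of p x + t * s \<le> gauge_of p (x + t *\<^sub>R e)" using x t by (simp add: kink_set_def)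
    moreover have "t * r < t * s" using t assms(3) by simp
    ultimately show False by linarith
  qed
qed

text \<open>The class \<open>N\<close> is left open so that one decomposition yields both
  measurability, with the Borel sets, and nullity, with the null sets.\<close>

lemma countable_union_kinks:
  assumes "\<And>e r s. e \<in> Basis \<Longrightarrow> r < s \<Longrightarrow> kink_set p e r s \<in> N"
    and "\<And>A. countable A \<Longrightarrow> A \<subseteq> N \<Longrightarrow> \<Union>A \<in> N"
  shows "singular_set (p :: 'a::euclidean_space \<Rightarrow> real) \<in> N"
proof -
  have "singular_set p = \<Union> ((\<lambda>(e, r, s). kink_set p e r s) ` {(e, r, s). e \<in> Basis \<and> r \<in> \<rat> \<and> s \<in> \<rat> \<and> r < s})"
    by (auto simp: singular_set_def)
  also have "\<dots> \<in> N"
  proof (rule assms(2))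
    have "{(e, r, s). e \<in> (Basis :: 'a set) \<and> r \<in> (\<rat> :: real set) \<and> s \<in> (\<rat> :: real set) \<and> r < s} \<subseteq> Basis \<times> \<rat> \<times> \<rat>"
      by auto
    moreover have "countable ((Basis :: 'a set) \<times> (\<rat> :: real set) \<times> (\<rat> :: real set))"
      by (intro countable_SIGMA countable_rat) (auto intro: countable_finite)
    ultimately show "countable ((\<lambda>(e, r, s). kink_set p e r s) ` {(e, r, s). e \<in> Basis \<and> r \<in> \<rat> \<and> s \<in> \<rat> \<and> r < s})"
      by (blast intro: countable_image countable_subset)
  qed (use assms(1) in auto)
  finally show ?thesis .
qed

lemma singular_set_borel: "admissible p \<Longrightarrow> singular_set p \<in> sets borel"
  by (rule countable_union_kinks) (auto intro: borel_closed closed_kink_set)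

lemma singular_set_null:
  assumes "admissible p" shows "singular_set p \<in> null_sets lborel"
proof (rule countable_union_kinks)
  fix e :: 'a and r s :: real assume "e \<in> Basis" "r < s"
  thus "kink_set p e r s \<in> null_sets lborel"
    using kink_set_null[OF assms, of e r s] borel_closed[OF closed_kink_set[OF assms, of e r s]]
    by (auto simp: null_sets_def)
next
  fix A :: "'a set set" assume "countable A" "A \<subseteq> null_sets lborel"
  thus "\<Union>A \<in> null_sets lborel" using null_sets_UN'[of A "\<lambda>x. x" lborel] by auto
qed

text \<open>Positive homogeneity of the gauge. It lets Lebesgue nullity descend to the sphere:
  surface measure is read off from the cone over a set, and the cone over the singular directions
  stays in the singular set.\<close>

lemma kink_set_cone:
  assumes p: "admissible p" and c: "0 < c" and x: "x \<in> kink_set p e r s"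
  shows "c *\<^sub>R x \<in> kink_set p e r s"
  unfolding kink_set_def
proof (intro CollectI allI impI)
  fix t :: real assume t: "0 < t"
  have "gauge_of p x + (t / c) * s \<le> gauge_of p (x + (t / c) *\<^sub>R e)"
    "gauge_of p x - (t / c) * r \<le> gauge_of p (x - (t / c) *\<^sub>R e)"
    using x[unfolded kink_set_def mem_Collect_eq, rule_format, of "t / c"] t c by auto
  hence "c * (gauge_of p x + (t / c) * s) \<le> c * gauge_of p (x + (t / c) *\<^sub>R e)"
    "c * (gauge_of p x - (t / c) * r) \<le> c * gauge_of p (x - (t / c) *\<^sub>R e)"
    using c by (auto intro: mult_left_mono)
  moreover have "c * gauge_of p (x + (t / c) *\<^sub>R e) = gauge_of p (c *\<^sub>R x + t *\<^sub>R e)"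
    "c * gauge_of p (x - (t / c) *\<^sub>R e) = gauge_of p (c *\<^sub>R x - t *\<^sub>R e)"
    using c p gauge_of_scaleR[of c p "x + (t / c) *\<^sub>R e"] gauge_of_scaleR[of c p "x - (t / c) *\<^sub>R e"]
    by (simp_all add: scaleR_add_right scaleR_diff_right)
  ultimately show "gauge_of p (c *\<^sub>R x) + t * s \<le> gauge_of p (c *\<^sub>R x + t *\<^sub>R e) \<and>
      gauge_of p (c *\<^sub>R x) - t * r \<le> gauge_of p (c *\<^sub>R x - t *\<^sub>R e)"
    using c p by (simp add: gauge_of_scaleR distrib_left right_diff_distrib)
qed

lemma AE_not_singular:
  fixes p :: "'a::euclidean_space \<Rightarrow> real"
  assumes p: "admissible p"
  shows "AE u in surface_measure. u \<notin> singular_set p"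
proof (rule AE_I)
  have S: "singular_set p \<inter> sphere 0 1 \<in> sets (sphere_borel :: 'a measure)"
    using singular_set_borel[OF p] by (auto simp: sets_restrict_space)
  show "{u \<in> space surface_measure. \<not> u \<notin> singular_set p} \<subseteq> singular_set p \<inter> sphere 0 1" by auto
  show "singular_set p \<inter> sphere 0 1 \<in> sets surface_measure" using S by simp
  have "{x::'a. 0 < norm x \<and> norm x < 1 \<and> x /\<^sub>R norm x \<in> singular_set p \<inter> sphere 0 1} \<subseteq> singular_set p"
  proof
    fix x :: 'a assume x: "x \<in> {x. 0 < norm x \<and> norm x < 1 \<and> x /\<^sub>R norm x \<in> singular_set p \<inter> sphere 0 1}"
    then obtain e r s where e: "e \<in> Basis" "r \<in> \<rat>" "s \<in> \<rat>" "r < s" "x /\<^sub>R norm x \<in> kink_set p e r s"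
      by (auto simp: singular_set_def)
    have "norm x *\<^sub>R (x /\<^sub>R norm x) \<in> kink_set p e r s" using x by (intro kink_set_cone[OF p _ e(5)]) auto
    thus "x \<in> singular_set p" using x e by (auto simp: singular_set_def)
  qed
  hence "emeasure lborel {x::'a. 0 < norm x \<and> norm x < 1 \<and> x /\<^sub>R norm x \<in> singular_set p \<inter> sphere 0 1}
     \<le> emeasure lborel (singular_set p)"
    using singular_set_borel[OF p] by (intro emeasure_mono) auto
  also have "\<dots> = 0" using singular_set_null[OF p] by auto
  finally show "emeasure surface_measure (singular_set p \<inter> sphere 0 1) = 0"
    using emeasure_surface_measure[OF S] by simp
qed

lemma subgradient_unique:
  fixes s1 s2 :: "'a::euclidean_space"
  assumes "x \<notin> singular_set p"
    and 1: "\<And>y. s1 \<bullet> y \<le> gauge_of p y" "s1 \<bullet> x = gauge_of p x"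
    and 2: "\<And>y. s2 \<bullet> y \<le> gauge_of p y" "s2 \<bullet> x = gauge_of p x"
  shows "s1 = s2"
proof (rule ccontr)
  assume "s1 \<noteq> s2"
  then obtain e where e: "e \<in> Basis" "s1 \<bullet> e \<noteq> s2 \<bullet> e" using euclidean_eqI by blast
  have *: "x \<in> singular_set p"
    if less: "a \<bullet> e < b \<bullet> e" and a: "\<And>y. a \<bullet> y \<le> gauge_of p y" "a \<bullet> x = gauge_of p x"
      and b: "\<And>y. b \<bullet> y \<le> gauge_of p y" "b \<bullet> x = gauge_of p x" for a b :: 'a
  proof -
    obtain r where r: "r \<in> \<rat>" "a \<bullet> e < r" "r < b \<bullet> e" using Rats_dense_in_real[OF less] by blast
    obtain s where s: "s \<in> \<rat>" "r < s" "s < b \<bullet> e" using Rats_dense_in_real[OF r(3)] by blast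
    have "x \<in> kink_set p e r s"
      unfolding kink_set_def
    proof (intro CollectI allI impI conjI)
      fix t :: real assume t: "0 < t"
      have "t * s \<le> t * (b \<bullet> e)" "t * (a \<bullet> e) \<le> t * r" using t r s by auto
      with a(2) b(2) a(1)[of "x - t *\<^sub>R e"] b(1)[of "x + t *\<^sub>R e"]
      show "gauge_of p x + t * s \<le> gauge_of p (x + t *\<^sub>R e)" "gauge_of p x - t * r \<le> gauge_of p (x - t *\<^sub>R e)"
        by (simp_all add: inner_add_right inner_diff_right)
    qed
    thus ?thesis using e r s by (auto simp: singular_set_def)
  qed
  from e(2) *[OF _ 1 2] *[OF _ 2 1] assms(1) show False by (meson linorder_neqE)
qed

section \<open>The normal map and the dual curvature measure of a body\<close>

lemma maximizer_subgradient:
  assumes "admissible p" "norm v = 1"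
  shows "p v *\<^sub>R v \<bullet> y \<le> gauge_of p y"
  using gauge_of_ge[OF assms, of y] by (simp add: inner_commute)

text \<open>Every maximizing \<open>v\<close> provides the subgradient
  \<open>p v *\<^sub>R v\<close> at \<open>u\<close>. Off the singular set these vectors coincide;
  the length of the common vector determines \<open>p v\<close>, and then \<open>v\<close>
  itself.\<close>

lemma maximizer_unique:
  assumes p: "admissible p" and u: "u \<notin> singular_set p"
    and v: "norm v = 1" "gauge_of p u = p v * (u \<bullet> v)"
    and w: "norm w = 1" "gauge_of p u = p w * (u \<bullet> w)"
  shows "v = w"
proof -
  have eq: "p v *\<^sub>R v = p w *\<^sub>R w"
    by (rule subgradient_unique[OF u maximizer_subgradient[OF p v(1)] _ maximizer_subgradient[OF p w(1)]])
      (simp_all add: v(2) w(2)[unfolded v(2)] inner_commute)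
  have "0 < p v" "0 < p w" using p v w by (auto simp: admissible_def)
  moreover from this have "p v = p w" using arg_cong[OF eq, of norm] v(1) w(1) by simp
  ultimately show ?thesis using eq by simp
qed

text \<open>A normal \<open>w\<close> rescaled by \<open>gauge_of p u / (w \<bullet> u)\<close> is a
  subgradient of the gauge at \<open>u\<close>, so it must agree with
  \<open>p v *\<^sub>R v\<close>. The denominator is positive because a small multiple of
  \<open>w\<close> belongs to the body.\<close>

lemma outer_unit_normal_iff:
  fixes u :: "'a::euclidean_space"
  assumes p: "admissible p" and u: "u \<notin> singular_set p" "norm u = 1"
    and v: "norm v = 1" "gauge_of p u = p v * (u \<bullet> v)"
  shows "outer_unit_normal (body_of p) (radial (body_of p) u *\<^sub>R u) w \<longleftrightarrow> w = v"
proof -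
  have N: "0 < gauge_of p u" using gauge_of_pos[OF p, of u] u by force
  have pv: "0 < p v" using p v by (auto simp: admissible_def)
  note rad = radial_body_of[OF p u(2)]
  show ?thesis
  proof
    assume w: "outer_unit_normal (body_of p) (radial (body_of p) u *\<^sub>R u) w"
    hence w1: "norm w = 1" and le: "\<And>y. y \<in> body_of p \<Longrightarrow> w \<bullet> y \<le> (w \<bullet> u) / gauge_of p u"
      by (auto simp: outer_unit_normal_def rad)
    obtain r where r: "0 < r" "cball 0 r \<subseteq> body_of p" using body_of_contains_ball[OF p] .
    have "r *\<^sub>R w \<in> body_of p" using r w1 by auto
    from le[OF this] have "r \<le> (w \<bullet> u) / gauge_of p u" using w1 by (simp add: dot_square_norm)
    hence wu: "0 < w \<bullet> u" using r N by (smt (verit) divide_nonpos_pos)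
    define s where "s = (gauge_of p u / (w \<bullet> u)) *\<^sub>R w"
    have "s = p v *\<^sub>R v"
    proof (rule subgradient_unique[OF u(1)])
      fix y
      show "s \<bullet> y \<le> gauge_of p y"
      proof (cases "y = 0")
        case False
        have Ny: "0 < gauge_of p y" by (rule gauge_of_pos[OF p False])
        hence "(1 / gauge_of p y) *\<^sub>R y \<in> body_of p" using p by (simp add: body_of_def gauge_of_scaleR)
        from le[OF this] show ?thesis using Ny N wu by (simp add: s_def field_simps)
      qed simp
      show "p v *\<^sub>R v \<bullet> y \<le> gauge_of p y" by (rule maximizer_subgradient[OF p v(1)])
    qed (use wu v in \<open>auto simp: s_def inner_commute\<close>)
    moreover have "norm s = gauge_of p u / (w \<bullet> u)" using w1 N wu by (simp add: s_def)
    moreover have "norm (p v *\<^sub>R v) = p v" using pv v by simp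
    ultimately have "p v *\<^sub>R w = p v *\<^sub>R v" by (simp add: s_def)
    thus "w = v" using pv by simp
  next
    assume w: "w = v"
    show "outer_unit_normal (body_of p) (radial (body_of p) u *\<^sub>R u) w"
      unfolding outer_unit_normal_def
    proof (intro conjI ballI)
      fix y assume "y \<in> body_of p"
      hence "p v * (y \<bullet> v) \<le> 1" using gauge_of_ge[OF p v(1), of y] by (simp add: body_of_def)
      also have "1 = p v * ((u \<bullet> v) / gauge_of p u)" using N by (simp add: v(2)[symmetric])
      finally have "y \<bullet> v \<le> (u \<bullet> v) / gauge_of p u" using pv by (simp only: mult_le_cancel_left_pos)
      thus "w \<bullet> y \<le> w \<bullet> (radial (body_of p) u *\<^sub>R u)" by (simp add: rad w inner_commute)
    qed (use v w in simp)
  qed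
qed

lemma mem_reverse_radial_gauss_image_iff:
  assumes p: "admissible p" and u: "u \<notin> singular_set p" "norm u = 1"
    and v: "norm v = 1" "gauge_of p u = p v * (u \<bullet> v)"
  shows "u \<in> reverse_radial_gauss_image (body_of p) \<eta> \<longleftrightarrow> v \<in> \<eta>"
proof -
  have N: "0 < gauge_of p u" using gauge_of_pos[OF p, of u] u by force
  have "radial (body_of p) u *\<^sub>R u \<in> frontier (body_of p)"
    using N by (intro frontier_body_of[OF p]) (simp add: radial_body_of[OF p u(2)] gauge_of_scaleR[OF _ p])
  thus ?thesis
    using u(2) outer_unit_normal_iff[OF p u v]
    by (auto simp: reverse_radial_gauss_image_def inverse_gauss_image_def)
qed

text \<open>An arbitrary selection of maximizers is forced off the singular set, where the maximizer
  is unique; a constant value on the Borel singular set then makes the selection Borel, with no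
  completion involved.\<close>

lemma normal_map_exists:
  fixes p :: "'a::euclidean_space \<Rightarrow> real"
  assumes p: "admissible p"
  obtains \<alpha> where "\<alpha> \<in> surface_measure \<rightarrow>\<^sub>M sphere_borel"
    "\<And>u. norm u = 1 \<Longrightarrow> u \<notin> singular_set p \<Longrightarrow> norm (\<alpha> u) = 1 \<and> gauge_of p u = p (\<alpha> u) * (u \<bullet> \<alpha> u)"
proof -
  let ?S = "sphere (0::'a) 1"
  define e0 :: 'a where "e0 = (SOME v. norm v = 1)"
  have e0: "norm e0 = 1" unfolding e0_def using vector_choose_size[of 1] by (metis (mono_tags) someI_ex zero_le_one)
  have "\<exists>v. norm v = 1 \<and> gauge_of p u = p v * (u \<bullet> v)" for u using gauge_of_attained[OF p] by metis
  then obtain f where f: "\<And>u. norm (f u) = 1 \<and> gauge_of p u = p (f u) * (u \<bullet> f u)" by metis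
  define \<alpha> where "\<alpha> u = (if u \<in> singular_set p then e0 else f u)" for u
  have \<alpha>1: "norm (\<alpha> u) = 1" for u using e0 f by (simp add: \<alpha>_def)
  have sing: "singular_set p \<inter> ?S \<in> sets (sphere_borel :: 'a measure)"
    using singular_set_borel[OF p] by (auto simp: sets_restrict_space)
  have "\<alpha> \<in> borel_measurable (sphere_borel :: 'a measure)"
  proof (rule borel_measurableI)
    fix W :: "'a set" assume W: "open W"
    let ?F = "?S - W"
    \<comment> \<open>Directions having at least one maximizer outside \<open>W\<close>. As the
      projection of a compact set this set is compact, and off the singular set it is the preimage
      of the complement of \<open>W\<close>.\<close>
    define Z where "Z = fst ` {z \<in> ?S \<times> ?F. gauge_of p (fst z) - p (snd z) * (fst z \<bullet> snd z) = 0}"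
    have cont: "continuous_on (?S \<times> ?F) (\<lambda>z. gauge_of p (fst z) - p (snd z) * (fst z \<bullet> snd z))"
    proof (intro continuous_intros)
      show "continuous_on (?S \<times> ?F) (\<lambda>z. gauge_of p (fst z))"
        by (rule continuous_on_compose2[OF continuous_on_gauge_of[OF p, of UNIV]]) (auto intro!: continuous_intros)
      have "continuous_on ?S p" using p by (simp add: admissible_def)
      thus "continuous_on (?S \<times> ?F) (\<lambda>z. p (snd z))"
        by (rule continuous_on_compose2) (auto intro!: continuous_intros)
    qed
    have comp: "compact (?S \<times> ?F)" using W by (intro compact_Times compact_diff) auto
    have "closedin (top_of_set (?S \<times> ?F)) {z \<in> ?S \<times> ?F. gauge_of p (fst z) - p (snd z) * (fst z \<bullet> snd z) = 0}"
      by (rule continuous_closedin_preimage_constant[OF cont])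
    hence "compact {z \<in> ?S \<times> ?F. gauge_of p (fst z) - p (snd z) * (fst z \<bullet> snd z) = 0}"
      using comp closedin_compact by blast
    hence "compact Z" unfolding Z_def by (intro compact_continuous_image continuous_intros)
    hence ZS: "Z \<inter> ?S \<in> sets (sphere_borel :: 'a measure)"
      by (auto simp: sets_restrict_space intro!: borel_closed compact_imp_closed)
    have Ziff: "u \<in> Z \<longleftrightarrow> f u \<notin> W" if u: "norm u = 1" "u \<notin> singular_set p" for u
    proof
      assume "u \<in> Z"
      then obtain v where "v \<in> ?F" "gauge_of p u = p v * (u \<bullet> v)" by (auto simp: Z_def)
      thus "f u \<notin> W" using maximizer_unique[OF p u(2), of v "f u"] f by auto
    next
      assume "f u \<notin> W"
      thus "u \<in> Z" unfolding Z_def using f[of u] u(1) by (intro image_eqI[of _ _ "(u, f u)"]) auto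
    qed
    have "\<alpha> -` W \<inter> space sphere_borel =
       (if e0 \<in> W then singular_set p \<inter> ?S else {}) \<union> ((?S - singular_set p \<inter> ?S) - Z \<inter> ?S)"
      using Ziff by (auto simp: \<alpha>_def space_restrict_space split: if_splits)
    also have "\<dots> \<in> sets sphere_borel"
      using sing ZS sphere_in_sets(1)[of "sphere_borel :: 'a measure"] by auto
    finally show "\<alpha> -` W \<inter> space sphere_borel \<in> sets sphere_borel" .
  qed
  hence "\<alpha> \<in> borel_measurable (surface_measure :: 'a measure)"
    using measurable_cong_sets[OF sets_surface_measure refl] by blast
  hence "\<alpha> \<in> surface_measure \<rightarrow>\<^sub>M sphere_borel" using \<alpha>1 by (intro measurable_restrict_space2) auto
  thus ?thesis using f by (intro that[of \<alpha>]) (auto simp: \<alpha>_def)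
qed

text \<open>Off the null singular set, membership in the reverse radial Gauss image amounts to a
  condition on \<alpha>. The completion disappears, and the result has the shape of an image under
  \<alpha> of a measure with density.\<close>

lemma dual_curvature_body_of:
  fixes p :: "'a::euclidean_space \<Rightarrow> real"
  assumes p: "admissible p"
    and \<alpha>: "\<And>u. norm u = 1 \<Longrightarrow> u \<notin> singular_set p \<Longrightarrow> norm (\<alpha> u) = 1 \<and> gauge_of p u = p (\<alpha> u) * (u \<bullet> \<alpha> u)"
  shows "dual_curvature q (body_of p) Q \<eta> = ennreal (1 / real DIM('a)) *
     (\<integral>\<^sup>+u. ennreal (gauge_of p u powr (- q) * radial Q u powr (real DIM('a) - q)) * indicator \<eta> (\<alpha> u) \<partial>surface_measure)"
  unfolding dual_curvature_def nn_integral_completion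
proof (intro arg_cong[where f="(*) (ennreal (1 / real DIM('a)))"] nn_integral_cong_AE)
  have *: "u \<in> space surface_measure \<longrightarrow> u \<notin> singular_set p \<longrightarrow>
     ennreal (radial (body_of p) u powr q * radial Q u powr (real DIM('a) - q)) * indicator (reverse_radial_gauss_image (body_of p) \<eta>) u =
     ennreal (gauge_of p u powr - q * radial Q u powr (real DIM('a) - q)) * indicator \<eta> (\<alpha> u)" for u
  proof (intro impI)
    assume u: "u \<in> space surface_measure" "u \<notin> singular_set p"
    hence u1: "norm u = 1" by simp
    have N: "0 < gauge_of p u" using gauge_of_pos[OF p, of u] u1 by force
    have "radial (body_of p) u powr q = gauge_of p u powr - q"
      using N by (simp add: radial_body_of[OF p u1] powr_divide powr_minus_divide)
    thus "ennreal (radial (body_of p) u powr q * radial Q u powr (real DIM('a) - q)) * indicator (reverse_radial_gauss_image (body_of p) \<eta>) u =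
     ennreal (gauge_of p u powr - q * radial Q u powr (real DIM('a) - q)) * indicator \<eta> (\<alpha> u)"
      using mem_reverse_radial_gauss_image_iff[OF p u(2) u1, of "\<alpha> u" \<eta>] \<alpha>[OF u1 u(2)]
      by (simp add: indicator_def)
  qed
  show "AE u in surface_measure. ennreal (radial (body_of p) u powr q * radial Q u powr (real DIM('a) - q)) * indicator (reverse_radial_gauss_image (body_of p) \<eta>) u =
     ennreal (gauge_of p u powr - q * radial Q u powr (real DIM('a) - q)) * indicator \<eta> (\<alpha> u)"
    using AE_not_singular[OF p] AE_space by eventually_elim (use * in blast)
qed

section \<open>The variational argument\<close>

text \<open>On the compact part of \<open>S\<close> outside a ball around \<open>a\<close>,
  \<open>\<bar>f x - M\<bar>\<close> has a positive minimum, so the sequence must eventually enter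
  the ball.\<close>

lemma tendsto_unique_maximizer:
  fixes f :: "'a::metric_space \<Rightarrow> real"
  assumes S: "compact S" and f: "continuous_on S f" and v: "\<And>k. v k \<in> S"
    and lim: "(\<lambda>k. f (v k)) \<longlonglongrightarrow> M" and uniq: "\<And>x. x \<in> S \<Longrightarrow> f x = M \<Longrightarrow> x = a"
  shows "v \<longlonglongrightarrow> a"
proof (rule tendstoI)
  fix e :: real assume e: "0 < e"
  let ?S = "S - ball a e"
  show "\<forall>\<^sub>F k in sequentially. dist (v k) a < e"
  proof (cases "?S = {}")
    case True
    hence "dist (v k) a < e" for k using v[of k] by (auto simp: dist_commute)
    thus ?thesis by simp
  next
    case False
    have "compact ?S" using S by (intro compact_diff) auto
    moreover have "continuous_on ?S (\<lambda>x. \<bar>f x - M\<bar>)"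
      by (intro continuous_intros continuous_on_subset[OF f]) auto
    ultimately obtain z where z: "z \<in> ?S" "\<And>x. x \<in> ?S \<Longrightarrow> \<bar>f z - M\<bar> \<le> \<bar>f x - M\<bar>"
      using continuous_attains_inf[OF _ False] by metis
    have "f z \<noteq> M" using uniq[of z] z(1) e by auto
    hence "\<forall>\<^sub>F k in sequentially. dist (f (v k)) M < \<bar>f z - M\<bar>" by (intro tendstoD[OF lim]) simp
    thus ?thesis
    proof eventually_elim
      case (elim k)
      have "v k \<notin> ?S" using z(2)[of "v k"] elim by (auto simp: dist_real_def)
      thus ?case using v[of k] by (simp add: dist_commute)
    qed
  qed
qed

lemma tendsto_exp_quotient:
  "(\<lambda>k. (exp (x * (1 / real (Suc k))) - 1) / (1 / real (Suc k))) \<longlonglongrightarrow> x"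
proof -
  have "((\<lambda>h. exp (x * h)) has_field_derivative x) (at 0)"
    by (auto intro!: derivative_eq_intros)
  hence "(\<lambda>h. (exp (x * h) - 1) / h) \<midarrow>0\<rightarrow> x" by (simp add: DERIV_def)
  moreover have "filterlim (\<lambda>k. 1 / real (Suc k)) (at 0) sequentially"
    using LIMSEQ_inverse_real_of_nat by (simp add: filterlim_at inverse_eq_divide)
  ultimately show ?thesis by (rule filterlim_compose)
qed

text \<open>Convexity of the exponential: the tangent at 0 from below, the chord over the unit
  interval from above. The bounds do not depend on \<open>t\<close>, as domination requires.\<close>

lemma exp_quotient_bounds:
  fixes x t :: real
  assumes t: "0 < t" "t \<le> 1"
  shows "x \<le> (exp (x * t) - 1) / t" "(exp (x * t) - 1) / t \<le> exp x"
proof -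
  show "x \<le> (exp (x * t) - 1) / t"
  proof -
    have "1 + x * t \<le> exp (x * t)" by (rule exp_ge_add_one_self)
    hence "x * t \<le> exp (x * t) - 1" by linarith
    thus ?thesis using t by (simp add: pos_le_divide_eq)
  qed
  have "exp ((1 - t) *\<^sub>R 0 + t *\<^sub>R x) \<le> (1 - t) * exp 0 + t * exp x"
    using t convex_onD[OF exp_convex, of t 0 x] by simp
  hence "exp (x * t) - 1 \<le> t * (exp x - 1)" by (simp add: algebra_simps)
  also have "\<dots> \<le> exp x * t" using t by (simp add: algebra_simps)
  finally show "(exp (x * t) - 1) / t \<le> exp x" using t by (simp add: pos_divide_le_eq)
qed

text \<open>The exponential form keeps positivity for every \<open>t\<close> and makes
  \<open>ln\<close> of the perturbed function affine in \<open>t\<close>.\<close>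

lemma admissible_perturb:
  assumes "admissible p" "continuous_on (sphere 0 1) g" "\<And>v. norm v = 1 \<Longrightarrow> g (- v) = g v"
  shows "admissible (\<lambda>v. p v * exp (- t * g v))"
  using assms by (auto simp: admissible_def intro!: continuous_intros)

text \<open>Each of the two maxima is tested with the maximizer of the other: \<open>a\<close> in
  the perturbed gauge and \<open>b\<close> in the original one. Together they show that
  \<open>b\<close> is almost optimal for the original gauge.\<close>

lemma gauge_perturb_bounds:
  fixes p g :: "'a::euclidean_space \<Rightarrow> real"
  assumes p: "admissible p" and p': "admissible (\<lambda>v. p v * exp (- t * g v))"
    and q: "0 < q" and u: "norm u = 1"
    and a: "norm a = 1" "gauge_of p u = p a * (u \<bullet> a)"
    and b: "norm b = 1" "gauge_of (\<lambda>v. p v * exp (- t * g v)) u = p b * exp (- t * g b) * (u \<bullet> b)"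
  shows "gauge_of p u powr (- q) * exp (q * g b * t) \<le> gauge_of (\<lambda>v. p v * exp (- t * g v)) u powr (- q)"
    and "gauge_of (\<lambda>v. p v * exp (- t * g v)) u powr (- q) \<le> gauge_of p u powr (- q) * exp (q * g a * t)"
    and "gauge_of p u * exp (t * (g b - g a)) \<le> p b * (u \<bullet> b)"
proof -
  let ?N = "gauge_of p u" and ?N' = "gauge_of (\<lambda>v. p v * exp (- t * g v)) u"
  have N: "0 < ?N" "0 < ?N'" using gauge_of_pos[OF p, of u] gauge_of_pos[OF p', of u] u by force+
  have 1: "?N * exp (- t * g a) \<le> ?N'"
    using gauge_of_ge[OF p' a(1), of u] a(2) by (simp add: mult_ac)
  have 2: "?N' \<le> ?N * exp (- t * g b)"
    using mult_right_mono[OF gauge_of_ge[OF p b(1), of u], of "exp (- t * g b)"] b(2) by (simp add: mult_ac)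
  have pw: "(?N * exp (- t * c)) powr (- q) = ?N powr (- q) * exp (q * c * t)" for c
    using N by (simp add: powr_mult exp_powr_real mult_ac)
  show "?N powr (- q) * exp (q * g b * t) \<le> ?N' powr (- q)"
    using powr_mono2'[of "- q" ?N' "?N * exp (- t * g b)"] 2 q N pw[of "g b"] by simp
  show "?N' powr (- q) \<le> ?N powr (- q) * exp (q * g a * t)"
    using powr_mono2'[of "- q" "?N * exp (- t * g a)" ?N'] 1 q N pw[of "g a"] by simp
  have "?N * exp (- t * g a) * exp (t * g b) \<le> p b * exp (- t * g b) * (u \<bullet> b) * exp (t * g b)"
    using 1 b(2) by (intro mult_right_mono) auto
  also have "\<dots> = p b * (u \<bullet> b)" by (simp add: exp_minus)
  also have "?N * exp (- t * g a) * exp (t * g b) = ?N * exp (t * (g b - g a))"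
    by (simp add: mult.assoc exp_add[symmetric] algebra_simps)
  finally show "?N * exp (t * (g b - g a)) \<le> p b * (u \<bullet> b)" .
qed

lemma bounded_on_sphere:
  fixes g :: "'a::euclidean_space \<Rightarrow> real"
  assumes "continuous_on (sphere 0 1) g"
  obtains G where "0 < G" "\<And>v. norm v = 1 \<Longrightarrow> \<bar>g v\<bar> \<le> G"
  using compact_imp_bounded[OF compact_continuous_image[OF assms compact_sphere]] that
  by (auto simp: bounded_pos)

text \<open>The perturbed maximizers are optimal for the unperturbed gauge up to a factor
  \<open>exp (- 2 * G * t)\<close>, which tends to 1; uniqueness of the maximizer at nonsingular
  \<open>u\<close> does the rest.\<close>

lemma perturbation_maximizers_tendsto:
  fixes p g :: "'a::euclidean_space \<Rightarrow> real"
  assumes p: "admissible p" and g: "continuous_on (sphere 0 1) g" "\<And>v. norm v = 1 \<Longrightarrow> g (- v) = g v"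
    and u: "norm u = 1" "u \<notin> singular_set p"
    and a: "norm a = 1" "gauge_of p u = p a * (u \<bullet> a)"
    and b: "\<And>k. norm (b k) = 1" "\<And>k. gauge_of (\<lambda>v. p v * exp (- (1 / real (Suc k)) * g v)) u =
       p (b k) * exp (- (1 / real (Suc k)) * g (b k)) * (u \<bullet> b k)"
  shows "b \<longlonglongrightarrow> a"
proof (rule tendsto_unique_maximizer)
  obtain G where G: "0 < G" "\<And>v. norm v = 1 \<Longrightarrow> \<bar>g v\<bar> \<le> G" using bounded_on_sphere[OF g(1)] by blast
  have N: "0 < gauge_of p u" using gauge_of_pos[OF p, of u] u by force
  show "continuous_on (sphere 0 1) (\<lambda>v. p v * (u \<bullet> v))" by (rule continuous_on_gauge_term[OF p])
  show "b k \<in> sphere 0 1" for k using b(1) by simp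
  show "x = a" if "x \<in> sphere 0 1" "p x * (u \<bullet> x) = gauge_of p u" for x
    using maximizer_unique[OF p u(2) _ _ a, of x] that by simp
  have inv: "(\<lambda>k. 1 / real (Suc k)) \<longlonglongrightarrow> 0"
    using LIMSEQ_inverse_real_of_nat by (simp add: inverse_eq_divide)
  show "(\<lambda>k. p (b k) * (u \<bullet> b k)) \<longlonglongrightarrow> gauge_of p u"
  proof (rule real_tendsto_sandwich)
    have "(\<lambda>k. gauge_of p u * exp ((1 / real (Suc k)) * (- 2 * G))) \<longlonglongrightarrow> gauge_of p u * exp (0 * (- 2 * G))"
      by (intro tendsto_intros inv)
    thus "(\<lambda>k. gauge_of p u * exp ((1 / real (Suc k)) * (- 2 * G))) \<longlonglongrightarrow> gauge_of p u" by simp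
    show "\<forall>\<^sub>F k in sequentially. gauge_of p u * exp ((1 / real (Suc k)) * (- 2 * G)) \<le> p (b k) * (u \<bullet> b k)"
    proof (intro always_eventually allI)
      fix k
      have "- 2 * G \<le> g (b k) - g a" using G(2)[OF b(1)[of k]] G(2)[OF a(1)] by linarith
      hence "gauge_of p u * exp ((1 / real (Suc k)) * (- 2 * G)) \<le> gauge_of p u * exp ((1 / real (Suc k)) * (g (b k) - g a))"
        using N by (intro mult_left_mono iffD2[OF exp_le_cancel_iff]) auto
      also have "\<dots> \<le> p (b k) * (u \<bullet> b k)"
        by (rule gauge_perturb_bounds(3)[OF p admissible_perturb[OF p g] zero_less_one u(1) a b])
      finally show "gauge_of p u * exp ((1 / real (Suc k)) * (- 2 * G)) \<le> p (b k) * (u \<bullet> b k)" .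
    qed
    show "\<forall>\<^sub>F k in sequentially. p (b k) * (u \<bullet> b k) \<le> gauge_of p u"
      using gauge_of_ge[OF p b(1)] by simp
  qed simp
qed simp

text \<open>An envelope theorem: the moving maximizer does not contribute to the derivative. The
  quotient is squeezed between a term at the perturbed maximizer \<open>b k\<close>, which converges
  to \<open>a\<close>, and one at the fixed maximizer \<open>a\<close>.\<close>

lemma gauge_power_derivative:
  fixes p g :: "'a::euclidean_space \<Rightarrow> real"
  assumes p: "admissible p" and g: "continuous_on (sphere 0 1) g" "\<And>v. norm v = 1 \<Longrightarrow> g (- v) = g v"
    and q: "0 < q"
    and u: "norm u = 1" "u \<notin> singular_set p"
    and a: "norm a = 1" "gauge_of p u = p a * (u \<bullet> a)"
  shows "(\<lambda>k. (gauge_of (\<lambda>v. p v * exp (- (1 / real (Suc k)) * g v)) u powr (- q) - gauge_of p u powr (- q)) / (1 / real (Suc k)))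
           \<longlonglongrightarrow> q * g a * gauge_of p u powr (- q)"
    (is "?D \<longlonglongrightarrow> _")
proof -
  have "\<exists>v. norm v = 1 \<and> gauge_of (\<lambda>v. p v * exp (- (1 / real (Suc k)) * g v)) u =
       p v * exp (- (1 / real (Suc k)) * g v) * (u \<bullet> v)" for k
    using gauge_of_attained[OF admissible_perturb[OF p g]] by metis
  then obtain b where b: "\<And>k. norm (b k) = 1" "\<And>k. gauge_of (\<lambda>v. p v * exp (- (1 / real (Suc k)) * g v)) u =
       p (b k) * exp (- (1 / real (Suc k)) * g (b k)) * (u \<bullet> b k)" by metis
  note bnd = gauge_perturb_bounds[OF p admissible_perturb[OF p g] q u(1) a b]
  let ?P = "gauge_of p u powr (- q)"
  have "b \<longlonglongrightarrow> a" by (rule perturbation_maximizers_tendsto[OF p g u a b])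
  hence gb: "(\<lambda>k. g (b k)) \<longlonglongrightarrow> g a"
    using continuous_on_tendsto_compose[OF g(1), of b a sequentially] a(1) b(1) by simp
  show ?thesis
  proof (rule real_tendsto_sandwich)
    show "(\<lambda>k. q * g (b k) * ?P) \<longlonglongrightarrow> q * g a * ?P" by (intro tendsto_intros gb)
    have "(\<lambda>k. (exp (q * g a * (1 / real (Suc k))) - 1) / (1 / real (Suc k)) * ?P) \<longlonglongrightarrow> q * g a * ?P"
      by (intro tendsto_intros tendsto_exp_quotient)
    thus "(\<lambda>k. (exp (q * g a * (1 / real (Suc k))) - 1) / (1 / real (Suc k)) * ?P) \<longlonglongrightarrow> q * g a * ?P" .
    show "\<forall>\<^sub>F k in sequentially. q * g (b k) * ?P \<le> ?D k"
    proof (intro always_eventually allI)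
      fix k
      define t where "t = 1 / real (Suc k)"
      have t: "0 < t" "t \<le> 1" by (auto simp: t_def)
      have "q * g (b k) * ?P \<le> (exp (q * g (b k) * t) - 1) / t * ?P"
        using exp_quotient_bounds(1)[OF t] by (intro mult_right_mono) auto
      also have "\<dots> = (?P * exp (q * g (b k) * t) - ?P) / t" by (simp add: field_simps)
      also have "\<dots> \<le> ?D k" using bnd(1)[of k] t unfolding t_def[symmetric]
        by (intro divide_right_mono) auto
      finally show "q * g (b k) * ?P \<le> ?D k" .
    qed
    show "\<forall>\<^sub>F k in sequentially. ?D k \<le> (exp (q * g a * (1 / real (Suc k))) - 1) / (1 / real (Suc k)) * ?P"
    proof (intro always_eventually allI)
      fix k
      define t where "t = 1 / real (Suc k)"
      have t: "0 < t" "t \<le> 1" by (auto simp: t_def)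
      have "?D k \<le> (?P * exp (q * g a * t) - ?P) / t" using bnd(2)[of k] t unfolding t_def[symmetric]
        by (intro divide_right_mono) auto
      also have "\<dots> = (exp (q * g a * t) - 1) / t * ?P" by (simp add: field_simps)
      finally show "?D k \<le> (exp (q * g a * (1 / real (Suc k))) - 1) / (1 / real (Suc k)) * ?P" unfolding t_def .
    qed
  qed
qed

text \<open>The constant adds the two one-sided bounds, \<open>exp (q * G)\<close> from above and
  \<open>- q * G\<close> from below. Any maximizers will do here, so singular directions are covered
  as well.\<close>

lemma gauge_power_quotient_bound:
  fixes p g :: "'a::euclidean_space \<Rightarrow> real"
  assumes p: "admissible p" and g: "continuous_on (sphere 0 1) g" "\<And>v. norm v = 1 \<Longrightarrow> g (- v) = g v"
    and q: "0 < q" and G: "\<And>v. norm v = 1 \<Longrightarrow> \<bar>g v\<bar> \<le> G" and u: "norm u = 1"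
    and t: "0 < t" "t \<le> 1"
  shows "\<bar>(gauge_of (\<lambda>v. p v * exp (- t * g v)) u powr (- q) - gauge_of p u powr (- q)) / t\<bar>
           \<le> (q * G + exp (q * G)) * gauge_of p u powr (- q)"
proof -
  obtain a where a: "norm a = 1" "gauge_of p u = p a * (u \<bullet> a)" using gauge_of_attained[OF p] .
  obtain b where b: "norm b = 1" "gauge_of (\<lambda>v. p v * exp (- t * g v)) u = p b * exp (- t * g b) * (u \<bullet> b)"
    using gauge_of_attained[OF admissible_perturb[OF p g]] .
  note bnd = gauge_perturb_bounds[OF p admissible_perturb[OF p g] q u a b]
  let ?P = "gauge_of p u powr (- q)" and ?P' = "gauge_of (\<lambda>v. p v * exp (- t * g v)) u powr (- q)"
  have G0: "0 \<le> G" using G[OF u] by linarith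
  have "(?P' - ?P) / t \<le> (?P * exp (q * g a * t) - ?P) / t" using bnd(2) t by (intro divide_right_mono) auto
  also have "\<dots> = (exp (q * g a * t) - 1) / t * ?P" by (simp add: field_simps)
  also have "\<dots> \<le> exp (q * g a) * ?P" using exp_quotient_bounds(2)[OF t] by (intro mult_right_mono) auto
  also have "\<dots> \<le> (q * G + exp (q * G)) * ?P"
  proof (intro mult_right_mono)
    have "exp (q * g a) \<le> exp (q * G)" using G[OF a(1)] q by (auto simp: abs_le_iff)
    moreover have "0 \<le> q * G" using q G0 by simp
    ultimately show "exp (q * g a) \<le> q * G + exp (q * G)" by linarith
  qed simp
  finally have 1: "(?P' - ?P) / t \<le> (q * G + exp (q * G)) * ?P" .
  have "- (q * G + exp (q * G)) * ?P \<le> q * g b * ?P"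
  proof (intro mult_right_mono)
    have "q * (- G) \<le> q * g b" using G[OF b(1)] q by (intro mult_left_mono) (auto simp: abs_le_iff)
    moreover have "0 < exp (q * G)" by simp
    ultimately show "- (q * G + exp (q * G)) \<le> q * g b" by linarith
  qed simp
  also have "\<dots> \<le> (exp (q * g b * t) - 1) / t * ?P" using exp_quotient_bounds(1)[OF t] by (intro mult_right_mono) auto
  also have "\<dots> = (?P * exp (q * g b * t) - ?P) / t" by (simp add: field_simps)
  also have "\<dots> \<le> (?P' - ?P) / t" using bnd(1) t by (intro divide_right_mono) auto
  finally have "- ((q * G + exp (q * G)) * ?P) \<le> (?P' - ?P) / t" by (simp only: mult_minus_left)
  with 1 show ?thesis by (simp add: abs_le_iff)
qed

text \<open>Only positive \<open>t\<close> are considered, which yields an inequality; equality will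
  come from inserting the negative of \<open>g\<close>. Pointwise derivatives exist almost
  everywhere, and dominated convergence along \<open>t = 1 / Suc k\<close> turns them into the
  derivative of the volume.\<close>

lemma maximizer_inequality:
  fixes p g w :: "'a::euclidean_space \<Rightarrow> real"
  assumes p: "admissible p"
    and max: "\<And>p'. admissible p' \<Longrightarrow> minkowski_functional q w \<mu> p' \<le> minkowski_functional q w \<mu> p"
    and g: "continuous_on (sphere 0 1) g" "\<And>v. norm v = 1 \<Longrightarrow> g (- v) = g v"
    and q: "0 < q"
    and w: "continuous_on (sphere 0 1) w" "\<And>u. norm u = 1 \<Longrightarrow> 0 < w u"
    and M: "sets \<mu> = sets sphere_borel" "finite_measure \<mu>" "0 < measure \<mu> (sphere 0 1)"
    and \<alpha>: "\<alpha> \<in> surface_measure \<rightarrow>\<^sub>M sphere_borel"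
      "\<And>u. norm u = 1 \<Longrightarrow> u \<notin> singular_set p \<Longrightarrow> norm (\<alpha> u) = 1 \<and> gauge_of p u = p (\<alpha> u) * (u \<bullet> \<alpha> u)"
  shows "(\<integral>u. g (\<alpha> u) * (gauge_of p u powr (- q) * w u) \<partial>surface_measure)
           \<le> volume_of q w p / measure \<mu> (sphere 0 1) * (\<integral>v. g v \<partial>\<mu>)"
proof -
  let ?m = "measure \<mu> (sphere 0 1)"
  define I where "I = (\<integral>v. g v \<partial>\<mu>) / ?m"
  define V where "V = volume_of q w p"
  define t where "t k = 1 / real (Suc k)" for k
  have t: "0 < t k" "t k \<le> 1" for k by (auto simp: t_def)
  define P where "P k v = p v * exp (- t k * g v)" for k v
  have P: "admissible (P k)" for k using admissible_perturb[OF p g, of "t k"] by (simp add: P_def[abs_def])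
  have V0: "0 < V" unfolding V_def by (rule volume_of_pos[OF p w])
  have Vk0: "0 < volume_of q w (P k)" for k by (rule volume_of_pos[OF P w])
  \<comment> \<open>Maximality, solved for the volume: the integral of \<open>ln (P k)\<close>
    changes by exactly \<open>- t k\<close> times that of \<open>g\<close>, so exponentiating bounds
    the volume by \<open>V * exp (q * I * t k)\<close>.\<close>
  have upper: "(volume_of q w (P k) - V) / t k \<le> V * ((exp (q * I * t k) - 1) / t k)" for k
  proof -
    have "(\<integral>v. ln (P k v) \<partial>\<mu>) = (\<integral>v. ln (p v) - t k * g v \<partial>\<mu>)"
    proof (rule Bochner_Integration.integral_cong)
      fix v assume "v \<in> space \<mu>"
      hence "norm v = 1" using sphere_in_sets[OF M(1)] by simp
      hence "0 < p v" using p by (simp add: admissible_def)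
      thus "ln (P k v) = ln (p v) - t k * g v" unfolding P_def by (subst ln_mult) auto
    qed simp
    also have "\<dots> = (\<integral>v. ln (p v) \<partial>\<mu>) - t k * (\<integral>v. g v \<partial>\<mu>)"
      using integrable_on_sphere[OF M(1,2) g(1)] integrable_on_sphere[OF M(1,2) continuous_on_ln_admissible[OF p]]
      by simp
    finally have "(\<integral>v. ln (P k v) \<partial>\<mu>) / ?m = (\<integral>v. ln (p v) \<partial>\<mu>) / ?m - t k * I"
      by (simp add: I_def diff_divide_distrib)
    with max[OF P[of k]] have "ln (volume_of q w (P k)) / q \<le> ln V / q + t k * I"
      by (simp add: minkowski_functional_def V_def)
    hence "ln (volume_of q w (P k)) \<le> ln V + q * I * t k"
      using q by (simp add: field_simps)
    hence "exp (ln (volume_of q w (P k))) \<le> exp (ln V + q * I * t k)" by simp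
    hence "volume_of q w (P k) \<le> V * exp (q * I * t k)" using V0 Vk0[of k] by (simp add: exp_add)
    hence "(volume_of q w (P k) - V) / t k \<le> (V * exp (q * I * t k) - V) / t k"
      using t(1)[of k] by (intro divide_right_mono) auto
    also have "\<dots> = V * ((exp (q * I * t k) - 1) / t k)" using t(1)[of k] by (simp add: field_simps)
    finally show ?thesis .
  qed
  let ?D = "\<lambda>k u. (gauge_of (P k) u powr (- q) - gauge_of p u powr (- q)) / t k * w u"
  let ?F = "\<lambda>u. q * g (\<alpha> u) * gauge_of p u powr (- q) * w u"
  obtain G where G: "0 < G" "\<And>v. norm v = 1 \<Longrightarrow> \<bar>g v\<bar> \<le> G" using bounded_on_sphere[OF g(1)] by blast
  note surf = sets_surface_measure finite_measure_surface_measure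
  have int: "integrable surface_measure (\<lambda>u. gauge_of p' u powr (- q) * w u)" if "admissible p'" for p'
    by (intro integrable_on_sphere surf continuous_on_volume_integrand that w)
  have lim: "(\<lambda>k. \<integral>u. ?D k u \<partial>surface_measure) \<longlonglongrightarrow> (\<integral>u. ?F u \<partial>surface_measure)"
  proof (rule integral_dominated_convergence)
    show "integrable surface_measure (\<lambda>u. (q * G + exp (q * G)) * (gauge_of p u powr (- q) * w u))"
      by (intro integrable_mult_right int p)
    have g\<alpha>: "(\<lambda>u. g (\<alpha> u)) \<in> borel_measurable surface_measure"
      using measurable_compose[OF \<alpha>(1) measurable_on_sphere[OF refl g(1)]] .
    have [measurable]: "(\<lambda>u. gauge_of p u powr (- q) * w u) \<in> borel_measurable surface_measure"
      by (intro measurable_on_sphere surf continuous_on_volume_integrand p w)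
    have "(\<lambda>u. q * g (\<alpha> u) * (gauge_of p u powr (- q) * w u)) \<in> borel_measurable surface_measure"
      using g\<alpha> by measurable
    thus "?F \<in> borel_measurable surface_measure" by (simp add: mult.assoc)
    show "?D k \<in> borel_measurable surface_measure" for k
    proof -
      have [measurable]: "(\<lambda>u. gauge_of (P k) u powr (- q) * w u) \<in> borel_measurable surface_measure"
        by (intro measurable_on_sphere surf continuous_on_volume_integrand P w)
      have "(\<lambda>u. (gauge_of (P k) u powr (- q) * w u - gauge_of p u powr (- q) * w u) / t k) \<in> borel_measurable surface_measure"
        by measurable
      thus ?thesis by (simp add: left_diff_distrib)
    qed
    have *: "norm u = 1 \<longrightarrow> u \<notin> singular_set p \<longrightarrow> (\<lambda>k. ?D k u) \<longlonglongrightarrow> ?F u" for u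
    proof (intro impI)
      assume u: "norm u = 1" "u \<notin> singular_set p"
      show "(\<lambda>k. ?D k u) \<longlonglongrightarrow> ?F u"
        using gauge_power_derivative[OF p g q u] \<alpha>(2)[OF u]
        unfolding P_def t_def by (intro tendsto_intros) blast
    qed
    show "AE u in surface_measure. (\<lambda>k. ?D k u) \<longlonglongrightarrow> ?F u"
      using AE_not_singular[OF p] AE_space by eventually_elim (use * in auto)
    show "AE u in surface_measure. norm (?D k u) \<le> (q * G + exp (q * G)) * (gauge_of p u powr (- q) * w u)" for k
    proof (rule AE_I2)
      fix u :: 'a assume "u \<in> space surface_measure"
      hence u: "norm u = 1" by simp
      have "norm (?D k u) = \<bar>(gauge_of (P k) u powr (- q) - gauge_of p u powr (- q)) / t k\<bar> * w u"
        using w(2)[OF u] by (simp add: abs_mult)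
      also have "\<dots> \<le> (q * G + exp (q * G)) * gauge_of p u powr (- q) * w u"
        using gauge_power_quotient_bound[OF p g q G(2) u t, of k] w(2)[OF u]
        unfolding P_def by (intro mult_right_mono) auto
      finally show "norm (?D k u) \<le> (q * G + exp (q * G)) * (gauge_of p u powr (- q) * w u)" by (simp add: mult.assoc)
    qed
  qed
  have Dint: "(\<integral>u. ?D k u \<partial>surface_measure) = (volume_of q w (P k) - V) / t k" for k
  proof -
    have "(\<integral>u. ?D k u \<partial>surface_measure) =
        (\<integral>u. (gauge_of (P k) u powr (- q) * w u - gauge_of p u powr (- q) * w u) / t k \<partial>surface_measure)"
      by (simp add: left_diff_distrib)
    thus ?thesis using int[OF p] int[OF P[of k]] by (simp add: volume_of_def V_def)
  qed
  have "(\<lambda>k. V * ((exp (q * I * t k) - 1) / t k)) \<longlonglongrightarrow> V * (q * I)"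
    unfolding t_def by (intro tendsto_intros tendsto_exp_quotient)
  with lim have "(\<integral>u. ?F u \<partial>surface_measure) \<le> V * (q * I)"
    by (rule LIMSEQ_le) (unfold Dint, intro exI[of _ 0] allI impI upper)
  moreover have "(\<integral>u. ?F u \<partial>surface_measure) = q * (\<integral>u. g (\<alpha> u) * (gauge_of p u powr (- q) * w u) \<partial>surface_measure)"
    by (simp add: mult.assoc)
  ultimately have "q * (\<integral>u. g (\<alpha> u) * (gauge_of p u powr (- q) * w u) \<partial>surface_measure) \<le> q * (V * I)"
    by (simp add: mult_ac)
  hence "(\<integral>u. g (\<alpha> u) * (gauge_of p u powr (- q) * w u) \<partial>surface_measure) \<le> V * I"
    using q by (simp only: mult_le_cancel_left_pos)
  thus ?thesis by (simp add: V_def I_def)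
qed

section \<open>Measures determined by integrals; antipodal symmetry\<close>

lemma measure_eqI_continuous_on_sphere:
  fixes \<mu> \<nu> :: "'a::euclidean_space measure"
  assumes M: "sets \<mu> = sets sphere_borel" "finite_measure \<mu>" and N: "sets \<nu> = sets sphere_borel" "finite_measure \<nu>"
    and eq: "\<And>g :: 'a \<Rightarrow> real. continuous_on (sphere 0 1) g \<Longrightarrow> (\<integral>v. g v \<partial>\<mu>) = (\<integral>v. g v \<partial>\<nu>)"
  shows "\<mu> = \<nu>"
proof -
  let ?S = "sphere (0::'a) 1"
  \<comment> \<open>Both measures are pushed forward to the whole space, where the closed sets form
    an intersection-stable generator of the Borel sets.\<close>
  have id: "(\<lambda>x. x) \<in> X \<rightarrow>\<^sub>M borel" if "sets X = sets sphere_borel" for X :: "'a measure"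
    by (rule measurable_on_sphere[OF that]) (rule continuous_on_id)
  have em: "emeasure (distr X borel (\<lambda>x. x)) A = emeasure X (A \<inter> ?S)"
    if "sets X = sets sphere_borel" "A \<in> sets borel" for X :: "'a measure" and A
    using emeasure_distr[OF id[OF that(1)] that(2)] sphere_in_sets(2)[OF that(1)] by simp
  \<comment> \<open>Truncated distance functions are continuous and converge pointwise to the
    indicator of a closed set.\<close>
  have lim: "(\<lambda>k. \<integral>v. max 0 (1 - real k * infdist v F) \<partial>X) \<longlonglongrightarrow> measure X (F \<inter> ?S)"
    if X: "sets X = sets sphere_borel" "finite_measure X" and F: "closed F" "F \<noteq> {}" for X :: "'a measure" and F
  proof -
    interpret finite_measure X by (rule X)
    have FS: "F \<inter> ?S \<in> sets X" unfolding X(1) using F by (auto simp: sets_restrict_space)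
    have "(\<lambda>k. \<integral>v. max 0 (1 - real k * infdist v F) \<partial>X) \<longlonglongrightarrow> (\<integral>v. indicat_real (F \<inter> ?S) v \<partial>X)"
    proof (rule integral_dominated_convergence)
      show "integrable X (\<lambda>_. 1 :: real)" by simp
      show "indicat_real (F \<inter> ?S) \<in> borel_measurable X" using FS by (rule borel_measurable_indicator)
      show "(\<lambda>v. max 0 (1 - real k * infdist v F)) \<in> borel_measurable X" for k
        by (intro measurable_on_sphere[OF X(1)] continuous_intros)
      show "AE v in X. norm (max 0 (1 - real k * infdist v F)) \<le> 1" for k
        by (rule AE_I2) (auto simp: infdist_nonneg)
      show "AE v in X. (\<lambda>k. max 0 (1 - real k * infdist v F)) \<longlonglongrightarrow> indicat_real (F \<inter> ?S) v"
      proof (rule AE_I2)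
        fix v assume "v \<in> space X"
        hence v: "v \<in> ?S" using sphere_in_sets(2)[OF X(1)] by simp
        show "(\<lambda>k. max 0 (1 - real k * infdist v F)) \<longlonglongrightarrow> indicat_real (F \<inter> ?S) v"
        proof (cases "v \<in> F")
          case True
          then show ?thesis using v by simp
        next
          case False
          hence "0 < infdist v F" using F by (metis in_closed_iff_infdist_zero infdist_nonneg less_eq_real_def)
          then obtain k0 where k0: "1 < real k0 * infdist v F" using reals_Archimedean3 by blast
          have "max 0 (1 - real k * infdist v F) = 0" if "k0 \<le> k" for k
          proof -
            have "real k0 * infdist v F \<le> real k * infdist v F"
              using that by (intro mult_right_mono infdist_nonneg) simp
            thus ?thesis using k0 by simp
          qed
          hence "(\<lambda>k. max 0 (1 - real k * infdist v F)) \<longlonglongrightarrow> 0"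
            by (intro tendsto_eventually) (auto simp: eventually_sequentially)
          thus ?thesis using False by simp
        qed
      qed
    qed
    thus ?thesis using FS sets.sets_into_space[OF FS] by (simp add: Int_absorb2)
  qed
  have closed_eq: "emeasure \<mu> (F \<inter> ?S) = emeasure \<nu> (F \<inter> ?S)" if F: "closed F" for F
  proof (cases "F = {}")
    case False
    have "(\<lambda>k. \<integral>v. max 0 (1 - real k * infdist v F) \<partial>\<mu>) = (\<lambda>k. \<integral>v. max 0 (1 - real k * infdist v F) \<partial>\<nu>)"
      by (rule ext, rule eq) (intro continuous_intros)
    hence "measure \<mu> (F \<inter> ?S) = measure \<nu> (F \<inter> ?S)"
      using lim[OF M F False] lim[OF N F False] by (auto intro: LIMSEQ_unique)
    thus ?thesis using finite_measure.emeasure_eq_measure[OF M(2)] finite_measure.emeasure_eq_measure[OF N(2)] by simp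
  qed simp
  have "distr \<mu> borel (\<lambda>x. x) = distr \<nu> borel (\<lambda>x. x)"
  proof (rule measure_eqI_generator_eq[where E="Collect closed" and \<Omega>=UNIV and A="\<lambda>_. UNIV"])
    show "Int_stable (Collect closed :: 'a set set)" by (auto simp: Int_stable_def)
    show "sets (distr \<mu> borel (\<lambda>x. x)) = sigma_sets UNIV (Collect closed)"
      "sets (distr \<nu> borel (\<lambda>x. x)) = sigma_sets UNIV (Collect closed)"
      by (simp_all add: borel_eq_closed)
    show "emeasure (distr \<mu> borel (\<lambda>x. x)) X = emeasure (distr \<nu> borel (\<lambda>x. x)) X" if "X \<in> Collect closed" for X
      using that closed_eq by (simp add: em[OF M(1)] em[OF N(1)] borel_closed)
    show "emeasure (distr \<mu> borel (\<lambda>x. x)) UNIV \<noteq> \<infinity>"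
      using finite_measure.emeasure_finite[OF M(2)] by (simp add: em[OF M(1)])
  qed auto
  hence *: "emeasure \<mu> (A \<inter> ?S) = emeasure \<nu> (A \<inter> ?S)" if "A \<in> sets borel" for A
    using em[OF M(1) that] em[OF N(1) that] by simp
  show ?thesis
  proof (rule measure_eqI)
    show "sets \<mu> = sets \<nu>" using M N by simp
    fix A assume "A \<in> sets \<mu>"
    hence "A \<in> sets (sphere_borel :: 'a measure)" using M by simp
    then obtain B where "B \<in> sets borel" "A = B \<inter> ?S" by (auto simp: sets_restrict_space)
    thus "emeasure \<mu> A = emeasure \<nu> A" using * by simp
  qed
qed

lemma uminus_measurable_sphere: "uminus \<in> (sphere_borel :: 'a::euclidean_space measure) \<rightarrow>\<^sub>M sphere_borel"
  by (intro measurable_restrict_space2 borel_measurable_continuous_on_restrict continuous_intros)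
    (auto simp: space_restrict_space)

lemma uminus_measurable_on_sphere:
  assumes "sets M = sets (sphere_borel :: 'a::euclidean_space measure)"
  shows "uminus \<in> M \<rightarrow>\<^sub>M M"
  unfolding measurable_cong_sets[OF assms assms] by (rule uminus_measurable_sphere)

lemma distr_uminus_surface_measure:
  "distr surface_measure surface_measure uminus = (surface_measure :: 'a::euclidean_space measure)"
proof (rule measure_eqI)
  fix A assume "A \<in> sets (distr surface_measure surface_measure (uminus :: 'a \<Rightarrow> 'a))"
  hence A: "A \<in> sets (sphere_borel :: 'a measure)" by simp
  note um = uminus_measurable_on_sphere[OF sets_surface_measure]
  define X where "X = {x::'a. 0 < norm x \<and> norm x < 1 \<and> x /\<^sub>R norm x \<in> A}"
  obtain B where B: "B \<in> sets borel" "A = sphere 0 1 \<inter> B"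
    using A unfolding sets_restrict_space by blast
  have "A \<in> sets borel" unfolding B(2) by (intro sets.Int borel_closed closed_sphere B(1))
  from measurable_sets[OF measurable_direction_borel this]
  have "(\<lambda>x. x /\<^sub>R norm x) -` A \<in> sets borel" by simp
  hence "(\<lambda>x. x /\<^sub>R norm x) -` A \<inter> (ball 0 1 - {0}) \<in> sets borel"
    by (rule sets.Int[OF _ sets.Diff[OF borel_open borel_closed]]) simp_all
  also have "(\<lambda>x. x /\<^sub>R norm x) -` A \<inter> (ball 0 1 - {0}) = X" by (auto simp: X_def)
  finally have X: "X \<in> sets borel" .
  have A': "uminus -` A \<inter> sphere 0 1 \<in> sets (sphere_borel :: 'a measure)"
    using measurable_sets[OF um, of A] A by simp
  have "orthogonal_transformation (uminus :: 'a \<Rightarrow> 'a)"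
    by (auto simp: orthogonal_transformation_def linear_uminus)
  hence "emeasure lborel X = emeasure (distr lborel borel uminus) X"
    by (simp add: lborel_distr_orthogonal_transformation)
  also have "\<dots> = emeasure lborel (uminus -` X)" using X by (simp add: emeasure_distr)
  also have "uminus -` X = {x. 0 < norm x \<and> norm x < 1 \<and> x /\<^sub>R norm x \<in> uminus -` A \<inter> sphere 0 1}"
    by (auto simp: X_def)
  finally have eq: "emeasure lborel X = emeasure lborel {x. 0 < norm x \<and> norm x < 1 \<and> x /\<^sub>R norm x \<in> uminus -` A \<inter> sphere 0 1}" .
  have "emeasure (distr surface_measure surface_measure uminus) A = emeasure surface_measure (uminus -` A \<inter> sphere 0 1)"
    using emeasure_distr[OF um, of A] A by simp
  also have "\<dots> = emeasure surface_measure A"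
    unfolding emeasure_surface_measure[OF A] emeasure_surface_measure[OF A'] X_def[symmetric] eq ..
  finally show "emeasure (distr surface_measure surface_measure uminus) A = emeasure surface_measure A" .
qed simp

lemma distr_uminus_even_measure:
  assumes M: "sets \<mu> = sets (sphere_borel :: 'a::euclidean_space measure)" and even: "even_measure \<mu>"
  shows "distr \<mu> \<mu> uminus = \<mu>"
proof (rule measure_eqI)
  fix A assume "A \<in> sets (distr \<mu> \<mu> uminus)"
  hence A: "A \<in> sets \<mu>" by simp
  have "uminus -` A \<inter> space \<mu> = uminus ` A"
  proof (intro set_eqI iffI)
    fix x assume "x \<in> uminus -` A \<inter> space \<mu>"
    thus "x \<in> uminus ` A" by (intro image_eqI[of _ _ "- x"]) auto
  next
    fix x assume "x \<in> uminus ` A"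
    thus "x \<in> uminus -` A \<inter> space \<mu>"
      using sets.sets_into_space[OF A] unfolding sphere_in_sets(2)[OF M] by auto
  qed
  thus "emeasure (distr \<mu> \<mu> uminus) A = emeasure \<mu> A"
    using even A uminus_measurable_on_sphere[OF M] by (simp add: emeasure_distr even_measure_def)
qed simp

lemma integral_uminus_sphere:
  fixes g :: "'a::euclidean_space \<Rightarrow> real"
  assumes M: "sets \<mu> = sets (sphere_borel :: 'a measure)" and inv: "distr \<mu> \<mu> uminus = \<mu>"
    and g: "g \<in> borel_measurable \<mu>"
  shows "(\<integral>v. g (- v) \<partial>\<mu>) = (\<integral>v. g v \<partial>\<mu>)"
  using integral_distr[OF uminus_measurable_on_sphere[OF M] g] by (simp add: inv)

text \<open>Since \<open>p\<close> is even, the negative of a maximizer at \<open>u\<close> is a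
  maximizer at \<open>- u\<close>, so \<alpha> is odd at every \<open>u\<close> for which neither
  \<open>u\<close> nor \<open>- u\<close> is singular. The claim follows by the substitution of
  \<open>- u\<close> for \<open>u\<close>.\<close>

lemma curvature_integral_uminus:
  fixes p g w :: "'a::euclidean_space \<Rightarrow> real"
  assumes p: "admissible p" and g: "continuous_on (sphere 0 1) g"
    and w: "continuous_on (sphere 0 1) w" "\<And>u. norm u = 1 \<Longrightarrow> w (- u) = w u"
    and \<alpha>: "\<alpha> \<in> surface_measure \<rightarrow>\<^sub>M sphere_borel"
      "\<And>u. norm u = 1 \<Longrightarrow> u \<notin> singular_set p \<Longrightarrow> norm (\<alpha> u) = 1 \<and> gauge_of p u = p (\<alpha> u) * (u \<bullet> \<alpha> u)"
  shows "(\<integral>u. g (- \<alpha> u) * (gauge_of p u powr (- q) * w u) \<partial>surface_measure) =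
         (\<integral>u. g (\<alpha> u) * (gauge_of p u powr (- q) * w u) \<partial>surface_measure)"
proof -
  let ?F = "\<lambda>u. gauge_of p u powr (- q) * w u"
  note um = uminus_measurable_on_sphere[OF sets_surface_measure]
  have gm: "(\<lambda>u. g (\<alpha> u)) \<in> borel_measurable surface_measure"
    by (rule measurable_compose[OF \<alpha>(1) measurable_on_sphere[OF refl g]])
  have gm': "(\<lambda>u. g (- \<alpha> u)) \<in> borel_measurable surface_measure"
    by (rule measurable_compose[OF \<alpha>(1) measurable_compose[OF uminus_measurable_sphere measurable_on_sphere[OF refl g]]])
  have F: "?F \<in> borel_measurable surface_measure"
    by (intro measurable_on_sphere sets_surface_measure continuous_on_volume_integrand p w)
  have AE': "AE u in surface_measure. - u \<notin> singular_set p"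
  proof -
    have "AE u in distr surface_measure surface_measure uminus. u \<notin> singular_set p"
      unfolding distr_uminus_surface_measure by (rule AE_not_singular[OF p])
    thus ?thesis by (rule AE_distrD[OF um])
  qed
  have *: "norm u = 1 \<longrightarrow> u \<notin> singular_set p \<longrightarrow> - u \<notin> singular_set p \<longrightarrow> \<alpha> (- u) = - \<alpha> u" for u
  proof (intro impI)
    assume u: "norm u = 1" "u \<notin> singular_set p" "- u \<notin> singular_set p"
    have a: "norm (\<alpha> u) = 1" "gauge_of p u = p (\<alpha> u) * (u \<bullet> \<alpha> u)" using \<alpha>(2)[OF u(1,2)] by auto
    have b: "norm (\<alpha> (- u)) = 1" "gauge_of p (- u) = p (\<alpha> (- u)) * (- u \<bullet> \<alpha> (- u))"
      using \<alpha>(2)[of "- u"] u by auto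
    have "p (- \<alpha> u) = p (\<alpha> u)" using p a(1) by (simp add: admissible_def)
    thus "\<alpha> (- u) = - \<alpha> u"
      using a by (intro maximizer_unique[OF p u(3) b]) (auto simp: gauge_of_minus[OF p])
  qed
  have "(\<integral>u. g (\<alpha> u) * ?F u \<partial>surface_measure) = (\<integral>u. g (\<alpha> (- u)) * ?F (- u) \<partial>surface_measure)"
    by (rule integral_uminus_sphere[OF sets_surface_measure distr_uminus_surface_measure, symmetric])
      (intro borel_measurable_times gm F)
  also have "\<dots> = (\<integral>u. g (- \<alpha> u) * ?F u \<partial>surface_measure)"
  proof (rule integral_cong_AE)
    show "(\<lambda>u. g (\<alpha> (- u)) * ?F (- u)) \<in> borel_measurable surface_measure"
      using measurable_compose[OF um borel_measurable_times[OF gm F]] .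
    show "(\<lambda>u. g (- \<alpha> u) * ?F u) \<in> borel_measurable surface_measure"
      by (intro borel_measurable_times gm' F)
    have **: "norm u = 1 \<longrightarrow> u \<notin> singular_set p \<longrightarrow> - u \<notin> singular_set p \<longrightarrow>
        g (\<alpha> (- u)) * ?F (- u) = g (- \<alpha> u) * ?F u" for u
      using * w(2) by (auto simp: gauge_of_minus[OF p])
    show "AE u in surface_measure. g (\<alpha> (- u)) * ?F (- u) = g (- \<alpha> u) * ?F u"
      using AE_not_singular[OF p] AE' AE_space by eventually_elim (use ** in simp)
  qed
  finally show ?thesis by simp
qed

text \<open>Evenness of the variation is needed for admissibility, so an arbitrary \<open>g\<close>
  is first symmetrized to \<open>h\<close>. Both sides are invariant under reflection, whence the
  integrals of \<open>h\<close> are twice those of \<open>g\<close>.\<close>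

lemma curvature_integral_eq:
  fixes p g w :: "'a::euclidean_space \<Rightarrow> real"
  assumes p: "admissible p"
    and max: "\<And>p'. admissible p' \<Longrightarrow> minkowski_functional q w \<mu> p' \<le> minkowski_functional q w \<mu> p"
    and g: "continuous_on (sphere 0 1) g"
    and q: "0 < q"
    and w: "continuous_on (sphere 0 1) w" "\<And>u. norm u = 1 \<Longrightarrow> 0 < w u" "\<And>u. norm u = 1 \<Longrightarrow> w (- u) = w u"
    and M: "sets \<mu> = sets sphere_borel" "finite_measure \<mu>" "0 < measure \<mu> (sphere 0 1)" "even_measure \<mu>"
    and \<alpha>: "\<alpha> \<in> surface_measure \<rightarrow>\<^sub>M sphere_borel"
      "\<And>u. norm u = 1 \<Longrightarrow> u \<notin> singular_set p \<Longrightarrow> norm (\<alpha> u) = 1 \<and> gauge_of p u = p (\<alpha> u) * (u \<bullet> \<alpha> u)"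
  shows "(\<integral>u. g (\<alpha> u) * (gauge_of p u powr (- q) * w u) \<partial>surface_measure)
           = volume_of q w p / measure \<mu> (sphere 0 1) * (\<integral>v. g v \<partial>\<mu>)"
proof -
  let ?F = "\<lambda>u. gauge_of p u powr (- q) * w u" and ?c = "volume_of q w p / measure \<mu> (sphere 0 1)"
  have g': "continuous_on (sphere 0 1) (\<lambda>v. g (- v))"
    by (rule continuous_on_compose2[OF g]) (auto intro!: continuous_intros)
  define h where "h v = g v + g (- v)" for v
  have h: "continuous_on (sphere 0 1) h" unfolding h_def by (intro continuous_intros g g')
  have hs: "h (- v) = h v" for v by (simp add: h_def)
  have le1: "(\<integral>u. h (\<alpha> u) * ?F u \<partial>surface_measure) \<le> ?c * (\<integral>v. h v \<partial>\<mu>)"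
    by (rule maximizer_inequality[OF p max h hs q w(1,2) M(1-3) \<alpha>])
  \<comment> \<open>The same inequality for the opposite variation gives the reverse
    estimate.\<close>
  have "(\<integral>u. - h (\<alpha> u) * ?F u \<partial>surface_measure) \<le> ?c * (\<integral>v. - h v \<partial>\<mu>)"
    by (rule maximizer_inequality[OF p max _ _ q w(1,2) M(1-3) \<alpha>]) (auto intro!: continuous_intros h simp: hs)
  hence le2: "?c * (\<integral>v. h v \<partial>\<mu>) \<le> (\<integral>u. h (\<alpha> u) * ?F u \<partial>surface_measure)" by simp
  have F: "integrable surface_measure ?F"
    by (intro integrable_on_sphere sets_surface_measure finite_measure_surface_measure continuous_on_volume_integrand p w)
  have int: "integrable surface_measure (\<lambda>u. k (\<alpha> u) * ?F u)"
    if k: "continuous_on (sphere 0 1) k" for k :: "'a \<Rightarrow> real"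
  proof -
    obtain B where B: "0 < B" "\<And>v. norm v = 1 \<Longrightarrow> \<bar>k v\<bar> \<le> B" using bounded_on_sphere[OF k] by blast
    have km: "(\<lambda>u. k (\<alpha> u)) \<in> borel_measurable surface_measure"
      by (rule measurable_compose[OF \<alpha>(1) measurable_on_sphere[OF refl k]])
    show ?thesis
    proof (rule Bochner_Integration.integrable_bound[OF integrable_mult_right[OF F, of B]])
      show "(\<lambda>u. k (\<alpha> u) * ?F u) \<in> borel_measurable surface_measure"
        by (intro borel_measurable_times km borel_measurable_integrable F)
      show "AE u in surface_measure. norm (k (\<alpha> u) * ?F u) \<le> norm (B * ?F u)"
      proof (rule AE_I2)
        fix u :: 'a assume "u \<in> space surface_measure"
        from measurable_space[OF \<alpha>(1) this] have "norm (\<alpha> u) = 1" by (simp add: space_restrict_space)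
        from B(2)[OF this] B(1) show "norm (k (\<alpha> u) * ?F u) \<le> norm (B * ?F u)"
          unfolding norm_mult by (intro mult_right_mono) auto
      qed
    qed
  qed
  have "(\<integral>u. h (\<alpha> u) * ?F u \<partial>surface_measure) = (\<integral>u. g (\<alpha> u) * ?F u + g (- \<alpha> u) * ?F u \<partial>surface_measure)"
    by (simp add: h_def distrib_right)
  also have "\<dots> = (\<integral>u. g (\<alpha> u) * ?F u \<partial>surface_measure) + (\<integral>u. g (- \<alpha> u) * ?F u \<partial>surface_measure)"
    by (rule Bochner_Integration.integral_add[OF int[OF g] int[OF g']])
  also have "\<dots> = 2 * (\<integral>u. g (\<alpha> u) * ?F u \<partial>surface_measure)"
    using curvature_integral_uminus[OF p g w(1,3) \<alpha>, of q] by linarith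
  finally have 1: "(\<integral>u. h (\<alpha> u) * ?F u \<partial>surface_measure) = 2 * (\<integral>u. g (\<alpha> u) * ?F u \<partial>surface_measure)" .
  have "(\<integral>v. h v \<partial>\<mu>) = (\<integral>v. g v \<partial>\<mu>) + (\<integral>v. g (- v) \<partial>\<mu>)"
    unfolding h_def by (rule Bochner_Integration.integral_add) (intro integrable_on_sphere M g g')+
  also have "(\<integral>v. g (- v) \<partial>\<mu>) = (\<integral>v. g v \<partial>\<mu>)"
    by (rule integral_uminus_sphere[OF M(1) distr_uminus_even_measure[OF M(1,4)] measurable_on_sphere[OF M(1) g]])
  finally have 2: "(\<integral>v. h v \<partial>\<mu>) = 2 * (\<integral>v. g v \<partial>\<mu>)" by simp
  have "2 * (\<integral>u. g (\<alpha> u) * ?F u \<partial>surface_measure) = 2 * (?c * (\<integral>v. g v \<partial>\<mu>))"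
    using antisym[OF le1 le2] unfolding 1 2 by (simp only: mult.left_commute)
  thus ?thesis by (subst (asm) mult_cancel_left) simp
qed

section \<open>Normalization of the maximizer and conclusion\<close>

lemma radial_uminus:
  assumes "origin_symmetric Q" shows "radial Q (- u) = radial Q u"
proof -
  have "- x \<in> Q \<longleftrightarrow> x \<in> Q" for x
    using assms unfolding origin_symmetric_def by (metis imageI minus_minus)
  hence "l *\<^sub>R (- u) \<in> Q \<longleftrightarrow> l *\<^sub>R u \<in> Q" for l by (metis scaleR_minus_right)
  thus ?thesis by (simp add: radial_def)
qed

lemma dual_minkowski:
  fixes \<mu> :: "'a::euclidean_space measure"
  assumes q: "0 < q" "q < real DIM('a)"
    and Q: "star_body Q" "origin_symmetric Q"
    and M: "sets \<mu> = sets sphere_borel" "finite_measure \<mu>" "0 < measure \<mu> (sphere 0 1)" "even_measure \<mu>"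
    and lt: "\<And>i (\<xi> :: 'a set). i \<in> {1..DIM('a) - 1} \<Longrightarrow> subspace \<xi> \<Longrightarrow> dim \<xi> = i \<Longrightarrow>
      measure \<mu> (sphere 0 1 \<inter> \<xi>) / measure \<mu> (sphere 0 1) < min (real i / q) 1"
  shows "\<exists>K. convex_body K \<and> origin_symmetric K \<and>
    (\<forall>\<eta>\<in>sets sphere_borel. dual_curvature q K Q \<eta> = emeasure \<mu> \<eta>)"
proof -
  let ?n = "real DIM('a)" and ?m = "measure \<mu> (sphere 0 1)"
  define w where "w u = radial Q u powr (?n - q)" for u
  have radpos: "0 < radial Q u" if "norm u = 1" for u using Q(1) that by (simp add: star_body_def)
  have radcont: "continuous_on (sphere 0 1) (radial Q)" using Q(1) by (simp add: star_body_def)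
  have "radial Q u \<noteq> 0" if "u \<in> sphere 0 1" for u using radpos[of u] that by simp
  hence w: "continuous_on (sphere 0 1) w" "\<And>u. norm u = 1 \<Longrightarrow> 0 < w u" "\<And>u. norm u = 1 \<Longrightarrow> w (- u) = w u"
    unfolding w_def using radpos
    by (auto intro!: continuous_intros radcont simp: radial_uminus[OF Q(2)])
  let ?J = "minkowski_functional q w \<mu>"
  obtain p0 where p0: "admissible p0" and max0: "\<And>p'. admissible p' \<Longrightarrow> ?J p' \<le> ?J p0"
  proof (rule maximizer_exists[OF q w(1,2) M(1-3) lt])
    fix p assume "admissible p" "\<And>p'. admissible p' \<Longrightarrow> ?J p' \<le> ?J p"
    thus thesis by (rule that)
  qed
  \<comment> \<open>The volume scales by \<open>k powr (- q)\<close>, so this choice makes it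
    \<open>?n * ?m\<close>. The factor \<open>volume_of q w p / ?m\<close> left by the variational
    identity then cancels against the \<open>1 / ?n\<close> in the dual curvature measure.\<close>
  define k where "k = (volume_of q w p0 / (?n * ?m)) powr (1 / q)"
  have V0: "0 < volume_of q w p0" by (rule volume_of_pos[OF p0 w(1,2)])
  hence k: "0 < k" unfolding k_def using M(3) by simp
  define p where "p v = k * p0 v" for v
  have p: "admissible p" unfolding p_def[abs_def] by (rule admissible_scale[OF p0 k])
  have max: "?J p' \<le> ?J p" if "admissible p'" for p'
    using max0[OF that] minkowski_functional_scale[OF p0 k q(1) w(1,2) M(1-3)] by (simp add: p_def[abs_def])
  have V: "volume_of q w p = ?n * ?m"
  proof -
    have "k powr (- q) = inverse (volume_of q w p0 / (?n * ?m))"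
      using q V0 M(3) by (simp add: k_def powr_powr powr_minus)
    thus ?thesis using V0 M(3) volume_of_scale[OF p0 k, of q w] by (simp add: p_def[abs_def])
  qed
  obtain \<alpha> where \<alpha>: "\<alpha> \<in> surface_measure \<rightarrow>\<^sub>M sphere_borel"
    "\<And>u. norm u = 1 \<Longrightarrow> u \<notin> singular_set p \<Longrightarrow> norm (\<alpha> u) = 1 \<and> gauge_of p u = p (\<alpha> u) * (u \<bullet> \<alpha> u)"
    using normal_map_exists[OF p] by blast
  define F where "F u = gauge_of p u powr (- q) * w u" for u
  have F: "F \<in> borel_measurable surface_measure" "integrable surface_measure F"
    unfolding F_def
    by (intro measurable_on_sphere integrable_on_sphere sets_surface_measure finite_measure_surface_measure
        continuous_on_volume_integrand p w)+
  have F0: "0 \<le> F u" if "norm u = 1" for u using w(2)[OF that] by (simp add: F_def)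
  have F0': "AE u in surface_measure. 0 \<le> F u / ?n" by (rule AE_I2) (simp add: F0)
  \<comment> \<open>The image of \<open>D\<close> under the normal map is the dual curvature measure
    of \<open>body_of p\<close>, now given as a genuine measure whose integrals can be compared with
    those of \<mu>.\<close>
  define D where "D = density surface_measure (\<lambda>u. ennreal (F u / ?n))"
  define C where "C = distr D sphere_borel \<alpha>"
  have \<alpha>D: "\<alpha> \<in> D \<rightarrow>\<^sub>M sphere_borel" using \<alpha>(1) by (simp add: D_def)
  have Fn: "(\<lambda>u. F u / ?n) \<in> borel_measurable surface_measure" using F(1) by measurable
  have em: "emeasure C \<eta> = dual_curvature q (body_of p) Q \<eta>" if \<eta>: "\<eta> \<in> sets sphere_borel" for \<eta>
  proof -
    have "emeasure C \<eta> = emeasure D (\<alpha> -` \<eta> \<inter> space surface_measure)"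
      using emeasure_distr[OF \<alpha>D \<eta>] by (simp add: C_def D_def)
    also have "\<dots> = (\<integral>\<^sup>+u. ennreal (F u / ?n) * indicator (\<alpha> -` \<eta> \<inter> space surface_measure) u \<partial>surface_measure)"
      unfolding D_def using Fn measurable_sets[OF \<alpha>(1) \<eta>] by (intro emeasure_density) auto
    also have "\<dots> = (\<integral>\<^sup>+u. ennreal (1 / ?n) * (ennreal (F u) * indicator \<eta> (\<alpha> u)) \<partial>surface_measure)"
    proof (rule nn_integral_cong)
      fix u :: 'a assume u: "u \<in> space surface_measure"
      have "ennreal (F u / ?n) = ennreal (1 / ?n) * ennreal (F u)"
        using F0[of u] u by (simp add: ennreal_mult[symmetric])
      thus "ennreal (F u / ?n) * indicator (\<alpha> -` \<eta> \<inter> space surface_measure) u =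
          ennreal (1 / ?n) * (ennreal (F u) * indicator \<eta> (\<alpha> u))"
        using u by (simp add: indicator_def)
    qed
    also have "\<dots> = ennreal (1 / ?n) * (\<integral>\<^sup>+u. ennreal (F u) * indicator \<eta> (\<alpha> u) \<partial>surface_measure)"
    proof (rule nn_integral_cmult)
      have "(\<lambda>u. indicator \<eta> (\<alpha> u) :: ennreal) \<in> borel_measurable surface_measure"
        using measurable_compose[OF \<alpha>(1) borel_measurable_indicator[OF \<eta>]] .
      thus "(\<lambda>u. ennreal (F u) * indicator \<eta> (\<alpha> u)) \<in> borel_measurable surface_measure"
        by (rule borel_measurable_times_ennreal[OF measurable_compose[OF F(1) measurable_ennreal]])
    qed
    also have "\<dots> = dual_curvature q (body_of p) Q \<eta>"
      unfolding F_def w_def by (rule dual_curvature_body_of[OF p \<alpha>(2), symmetric])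
    finally show ?thesis .
  qed
  have setsC: "sets C = sets sphere_borel" by (simp add: C_def)
  have "finite_measure D"
  proof
    have "emeasure D (space D) = (\<integral>\<^sup>+u. ennreal (F u / ?n) * indicator (space surface_measure) u \<partial>surface_measure)"
      unfolding D_def space_density
      by (rule emeasure_density[OF measurable_compose[OF Fn measurable_ennreal] sets.top])
    also have "\<dots> = (\<integral>\<^sup>+u. ennreal (F u / ?n) \<partial>surface_measure)"
      by (rule nn_integral_cong) simp
    also have "\<dots> = ennreal (\<integral>u. F u / ?n \<partial>surface_measure)"
      using F(2) F0' by (intro nn_integral_eq_integral) auto
    finally show "emeasure D (space D) \<noteq> \<infinity>" by simp
  qed
  hence finC: "finite_measure C" unfolding C_def by (rule finite_measure.finite_measure_distr[OF _ \<alpha>D])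
  have "C = \<mu>"
  proof (rule measure_eqI_continuous_on_sphere[OF setsC finC M(1,2)])
    fix g :: "'a \<Rightarrow> real" assume g: "continuous_on (sphere 0 1) g"
    have gb: "g \<in> borel_measurable sphere_borel" by (rule measurable_on_sphere[OF refl g])
    have g\<alpha>: "(\<lambda>u. g (\<alpha> u)) \<in> borel_measurable surface_measure"
      by (rule measurable_compose[OF \<alpha>(1) gb])
    have "(\<integral>v. g v \<partial>C) = (\<integral>u. g (\<alpha> u) \<partial>D)"
      unfolding C_def by (rule integral_distr[OF \<alpha>D gb])
    also have "\<dots> = (\<integral>u. (F u / ?n) *\<^sub>R g (\<alpha> u) \<partial>surface_measure)"
      unfolding D_def by (rule integral_density[OF g\<alpha> Fn F0'])
    also have "\<dots> = (\<integral>u. g (\<alpha> u) * (gauge_of p u powr (- q) * w u) \<partial>surface_measure) / ?n"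
      by (simp add: F_def mult.commute)
    also have "(\<integral>u. g (\<alpha> u) * (gauge_of p u powr (- q) * w u) \<partial>surface_measure) =
        volume_of q w p / ?m * (\<integral>v. g v \<partial>\<mu>)"
    proof (rule curvature_integral_eq[OF p _ g q(1) _ _ _ M \<alpha>])
    qed (fact max w)+
    also have "volume_of q w p / ?m * (\<integral>v. g v \<partial>\<mu>) / ?n = (\<integral>v. g v \<partial>\<mu>)"
      unfolding V using M(3) by simp
    finally show "(\<integral>v. g v \<partial>C) = (\<integral>v. g v \<partial>\<mu>)" .
  qed
  hence "\<forall>\<eta>\<in>sets sphere_borel. dual_curvature q (body_of p) Q \<eta> = emeasure \<mu> \<eta>"
    using em by simp
  thus ?thesis
    by (intro exI[of _ "body_of p"] conjI convex_body_body_of origin_symmetric_body_of p)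
qed

theorem theorem1p1:
  fixes q :: real and Q :: "(real ^ 'n) set" and \<mu> :: "(real ^ 'n) measure"
  assumes "1 < q" and "q < real CARD('n)"
    and "star_body Q" and "origin_symmetric Q"
    and "sets \<mu> = sets sphere_borel" and "finite_measure \<mu>" and "even_measure \<mu>"
    and "measure \<mu> (sphere 0 1) > 0"
    and "\<forall>i\<in>{1..CARD('n) - 1}. \<forall>\<xi>. subspace \<xi> \<and> dim \<xi> = i \<longrightarrow>
           measure \<mu> (sphere 0 1 \<inter> \<xi>) / measure \<mu> (sphere 0 1) < min (real i / q) 1"
  shows "\<exists>K :: (real ^ 'n) set. convex_body K \<and> origin_symmetric K \<and>
           (\<forall>\<eta>\<in>sets sphere_borel. dual_curvature q K Q \<eta> = emeasure \<mu> \<eta>)"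
proof (rule dual_minkowski)
  show "measure \<mu> (sphere 0 1 \<inter> \<xi>) / measure \<mu> (sphere 0 1) < min (real i / q) 1"
    if "i \<in> {1..DIM(real ^ 'n) - 1}" "subspace \<xi>" "dim \<xi> = i" for i and \<xi> :: "(real ^ 'n) set"
    using assms(9) that by simp
qed (use assms in auto)

end
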